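(* Let $F$ be a field of characteristic different from $2$ and let $n$ be a positive integer. Let $q$ be an anisotropic form over $F$ and let $\rho$ be an anisotropic Pfister form over $F$. Let $\pi\simeq\langle 1,x_1\rangle\otimes\cdots\otimes\langle 1,x_n\rangle$ over the iterated Laurent series field $K=F((x_1))\ldots((x_n))$. Then: (i) $q\otimes\pi$ is a neighbour of a Pfister form over $K$ if and only if $q\otimes\pi$ is a neighbour of $\sigma\otimes\pi$ for some Pfister form $\sigma$ over $F$. (ii) $q\otimes\pi$ is a neighbour of the Pfister form $\rho\otimes\pi$ over $K$ if and only if $q$ is a neighbour of the Pfister form $\rho$ over $F$.
   Context: "Form" means regular (nondegenerate) quadratic form of finite dimension. Forms over $F$ are viewed over $K$ by scalar extension when tensored with $\pi$. An $m$-fold Pfister form over a field $E$ is a form isometric to $\langle 1,a_1\rangle\otimes\cdots\otimes\langle 1,a_m\rangle$ with $a_i\in E^\times$ (the $0$-fold Pfister form is $\langle 1\rangle$). $p\subset q$ means $q\simeq p\perp r$ for some form $r$. A form $\tau$ over $E$ is a neighbour of a Pfister form $\theta$ over $E$ if $\tau\subset a\theta$ for some $a\in E^\times$ and $\dim\tau>\frac12\dim\theta$. *)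

theory Defs
  imports
    "Jordan_Normal_Form.Matrix"
    "HOL-Library.Cardinality"
    "HOL-Computational_Algebra.Computational_Algebra"
begin

section \<open>Iterated Laurent series fields\<close>

text \<open>
  An element of \<open>F((x\<^sub>1))\<dots>((x\<^sub>n))\<close> is encoded by its coefficient function
  \<open>int list \<Rightarrow> F\<close>, which vanishes on all lists of length different from \<open>n\<close>.  The head of an
  exponent list belongs to the outermost variable \<open>x\<^sub>n\<close>, so that the list is
  \<open>[e\<^sub>n, \<dots>, e\<^sub>1]\<close> and \<open>slice f k\<close> is the coefficient of \<open>x\<^sub>n\<^sup>k\<close>, itself an element of
  \<open>F((x\<^sub>1))\<dots>((x\<^bsub>n-1\<^esub>))\<close>.
\<close>

definition slice :: "(int list \<Rightarrow> 'a) \<Rightarrow> int \<Rightarrow> int list \<Rightarrow> 'a" where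
  "slice f k = (\<lambda>e. f (k # e))"

primrec laurent_coeffs :: "nat \<Rightarrow> (int list \<Rightarrow> 'a::zero) set" where
  "laurent_coeffs 0 = {f. \<forall>e. e \<noteq> [] \<longrightarrow> f e = 0}"
| "laurent_coeffs (Suc n) =
     {f. f [] = 0 \<and> (\<forall>k. slice f k \<in> laurent_coeffs n) \<and> (\<exists>N. \<forall>k<N. slice f k = (\<lambda>_. 0))}"

text \<open>
  The Cauchy product in the outermost variable, where coefficients are multiplied recursively.
  The sum is finite on \<open>laurent_coeffs\<close>.
\<close>

fun laurent_mult :: "(int list \<Rightarrow> 'a::comm_ring_1) \<Rightarrow> (int list \<Rightarrow> 'a) \<Rightarrow> int list \<Rightarrow> 'a" where
  "laurent_mult f g [] = f [] * g []"
| "laurent_mult f g (k # e) =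
     (\<Sum>i | slice f i \<noteq> (\<lambda>_. 0) \<and> slice g (k - i) \<noteq> (\<lambda>_. 0).
        laurent_mult (slice f i) (slice g (k - i)) e)"

definition laurent_monom :: "int list \<Rightarrow> 'a::zero \<Rightarrow> int list \<Rightarrow> 'a" where
  "laurent_monom d c = (\<lambda>e. if e = d then c else 0)"

lemma slice_simps [simp]:
  "slice (\<lambda>_. c) k = (\<lambda>_. c)"
  "slice (\<lambda>e. F e + G e) k = (\<lambda>e. slice F k e + slice G k e)"
  "slice (\<lambda>e. - F' e) k = (\<lambda>e. - slice F' k e)"
  "slice (\<lambda>e. \<Sum>i\<in>S. H i e) k = (\<lambda>e. \<Sum>i\<in>S. slice (H i) k e)"
  by (simp_all add: slice_def)

lemma slice_monom: "slice (laurent_monom (j # d) c) k = (if k = j then laurent_monom d c else (\<lambda>_. 0))"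
  by (auto simp: slice_def laurent_monom_def)

lemma laurent_coeffs_SucI:
  "f [] = 0 \<Longrightarrow> (\<And>k. slice f k \<in> laurent_coeffs n) \<Longrightarrow> \<forall>k<N. slice f k = (\<lambda>_. 0) \<Longrightarrow>
   f \<in> laurent_coeffs (Suc n)"
  by auto

lemma laurent_coeffs_zero: "(\<lambda>_. 0) \<in> laurent_coeffs n"
  by (induction n) auto

lemma laurent_coeffs_add:
  fixes f g :: "int list \<Rightarrow> 'a::comm_ring_1"
  shows "f \<in> laurent_coeffs n \<Longrightarrow> g \<in> laurent_coeffs n \<Longrightarrow> (\<lambda>e. f e + g e) \<in> laurent_coeffs n"
proof (induction n arbitrary: f g)
  case (Suc n)
  from Suc.prems obtain A B where
    "\<forall>k<A. slice f k = (\<lambda>_. 0)" "\<forall>k<B. slice g k = (\<lambda>_. 0)" by auto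
  then have "\<forall>k < min A B. slice (\<lambda>e. f e + g e) k = (\<lambda>_. 0)" by auto
  moreover have "slice (\<lambda>e. f e + g e) k \<in> laurent_coeffs n" for k
    using Suc by simp
  ultimately show ?case using Suc.prems
    by (intro laurent_coeffs_SucI[where N = "min A B"]) auto
qed auto

lemma laurent_coeffs_uminus:
  fixes f :: "int list \<Rightarrow> 'a::comm_ring_1"
  shows "f \<in> laurent_coeffs n \<Longrightarrow> (\<lambda>e. - f e) \<in> laurent_coeffs n"
proof (induction n arbitrary: f)
  case (Suc n)
  from Suc.prems obtain A where "\<forall>k<A. slice f k = (\<lambda>_. 0)" by auto
  then have "\<forall>k < A. slice (\<lambda>e. - f e) k = (\<lambda>_. 0)" by auto
  then show ?case using Suc by auto
qed auto

lemma laurent_coeffs_sum: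
  fixes F :: "'b \<Rightarrow> int list \<Rightarrow> 'a::comm_ring_1"
  assumes "\<And>i. i \<in> S \<Longrightarrow> F i \<in> laurent_coeffs n"
  shows "(\<lambda>e. \<Sum>i\<in>S. F i e) \<in> laurent_coeffs n"
  using assms
  by (induction S rule: infinite_finite_induct)
     (simp_all add: laurent_coeffs_zero laurent_coeffs_add)

lemma laurent_coeffs_monom: "laurent_monom d c \<in> laurent_coeffs (length d)"
proof (induction d)
  case (Cons j d)
  have "\<forall>k<j. slice (laurent_monom (j # d) c) k = (\<lambda>_. 0)" by (simp add: slice_monom)
  moreover have "laurent_monom (j # d) c [] = 0" by (simp add: laurent_monom_def)
  ultimately show ?case using Cons by (auto simp: slice_monom laurent_coeffs_zero)
qed (simp add: laurent_monom_def)

lemma laurent_mult_zero_left [simp]: "laurent_mult (\<lambda>_. 0) g e = 0"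
  by (cases e) auto

lemma laurent_mult_zero_right [simp]: "laurent_mult f (\<lambda>_. 0) e = 0"
  by (cases e) auto

lemma laurent_mult_window:
  assumes "\<forall>k<A. slice f k = (\<lambda>_. 0)" "\<forall>k<B. slice g k = (\<lambda>_. 0)"
    and "finite S" "{A..k - B} \<subseteq> S"
  shows "laurent_mult f g (k # e) = (\<Sum>i\<in>S. laurent_mult (slice f i) (slice g (k - i)) e)"
proof -
  have "{i. slice f i \<noteq> (\<lambda>_. 0) \<and> slice g (k - i) \<noteq> (\<lambda>_. 0)} \<subseteq> S"
  proof
    fix i assume "i \<in> {i. slice f i \<noteq> (\<lambda>_. 0) \<and> slice g (k - i) \<noteq> (\<lambda>_. 0)}"
    then have "\<not> i < A" "\<not> k - i < B" using assms(1,2) by auto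
    then show "i \<in> S" using assms(4) by auto
  qed
  then have "(\<Sum>i | slice f i \<noteq> (\<lambda>_. 0) \<and> slice g (k - i) \<noteq> (\<lambda>_. 0).
        laurent_mult (slice f i) (slice g (k - i)) e)
     = (\<Sum>i\<in>S. laurent_mult (slice f i) (slice g (k - i)) e)"
    using assms(3) by (intro sum.mono_neutral_left) auto
  then show ?thesis by simp
qed

lemma laurent_mult_commute: "laurent_mult f g e = laurent_mult g f e"
proof (induction e arbitrary: f g)
  case (Cons k e)
  show ?case unfolding laurent_mult.simps
    by (rule sum.reindex_bij_witness[of _ "\<lambda>i. k - i" "\<lambda>i. k - i"]) (auto simp: Cons)
qed (simp add: mult.commute)

lemma laurent_mult_0_Cons: "f \<in> laurent_coeffs 0 \<Longrightarrow> laurent_mult f g (k # e) = 0"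
proof -
  assume "f \<in> laurent_coeffs 0"
  then have "slice f i = (\<lambda>_. 0)" for i by (auto simp: slice_def)
  then show ?thesis by simp
qed

lemma laurent_mult_closed:
  "f \<in> laurent_coeffs n \<Longrightarrow> g \<in> laurent_coeffs n \<Longrightarrow> laurent_mult f g \<in> laurent_coeffs n"
proof (induction n arbitrary: f g)
  case 0
  have "laurent_mult f g e = 0" if "e \<noteq> []" for e
    using that 0 laurent_mult_0_Cons by (cases e) auto
  then show ?case by simp
next
  case (Suc n)
  from Suc.prems obtain A B where
    AB: "\<forall>k<A. slice f k = (\<lambda>_. 0)" "\<forall>k<B. slice g k = (\<lambda>_. 0)" by auto
  have sl: "slice (laurent_mult f g) k =
      (\<lambda>e. \<Sum>i\<in>{A..k-B}. laurent_mult (slice f i) (slice g (k - i)) e)" for k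
    unfolding slice_def[of "laurent_mult f g"]
    by (intro ext laurent_mult_window[OF AB]) auto
  have "slice (laurent_mult f g) k \<in> laurent_coeffs n" for k
    unfolding sl using Suc by (intro laurent_coeffs_sum) auto
  moreover have "\<forall>k < A + B. slice (laurent_mult f g) k = (\<lambda>_. 0)"
    unfolding sl by auto
  ultimately show ?case using Suc.prems by auto
qed

lemma laurent_mult_add_left:
  assumes "f \<in> laurent_coeffs n" "f' \<in> laurent_coeffs n" "g \<in> laurent_coeffs n"
  shows "laurent_mult (\<lambda>e. f e + f' e) g e = laurent_mult f g e + laurent_mult f' g e"
  using assms
proof (induction n arbitrary: f f' g e)
  case 0
  then show ?case
    using laurent_coeffs_add[OF 0(1,2)]
    by (cases e) (simp_all only: laurent_mult_0_Cons, simp_all add: algebra_simps)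
next
  case (Suc n)
  from Suc.prems obtain A A' B where
    AB: "\<forall>k<A. slice f k = (\<lambda>_. 0)" "\<forall>k<A'. slice f' k = (\<lambda>_. 0)" "\<forall>k<B. slice g k = (\<lambda>_. 0)"
    by auto
  have AA: "\<forall>k < min A A'. slice f k = (\<lambda>_. 0)" "\<forall>k < min A A'. slice f' k = (\<lambda>_. 0)"
    "\<forall>k < min A A'. slice (\<lambda>e. f e + f' e) k = (\<lambda>_. 0)"
    using AB by auto
  show ?case
  proof (cases e)
    case Nil
    then show ?thesis by (simp add: algebra_simps)
  next
    case (Cons k d)
    let ?S = "{min A A'..k - B}"
    have w: "laurent_mult h g (k # d) = (\<Sum>i\<in>?S. laurent_mult (slice h i) (slice g (k - i)) d)"
      if "\<forall>k < min A A'. slice h k = (\<lambda>_. 0)" for h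
      by (rule laurent_mult_window[OF that AB(3)]) auto
    have IH: "laurent_mult (slice (\<lambda>e. f e + f' e) i) (slice g (k - i)) d =
       laurent_mult (slice f i) (slice g (k - i)) d + laurent_mult (slice f' i) (slice g (k - i)) d" for i
      unfolding slice_simps using Suc.prems by (intro Suc.IH) auto
    show ?thesis
      unfolding Cons w[OF AA(1)] w[OF AA(2)] w[OF AA(3)] IH sum.distrib ..
  qed
qed

lemma laurent_mult_sum_left:
  assumes "\<And>i. i \<in> S \<Longrightarrow> F i \<in> laurent_coeffs n" "g \<in> laurent_coeffs n"
  shows "laurent_mult (\<lambda>e. \<Sum>i\<in>S. F i e) g e = (\<Sum>i\<in>S. laurent_mult (F i) g e)"
  using assms(1)
  by (induction S rule: infinite_finite_induct)
     (simp_all add: laurent_mult_add_left[OF _ laurent_coeffs_sum assms(2)])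

lemma laurent_mult_sum_right:
  assumes "\<And>i. i \<in> S \<Longrightarrow> F i \<in> laurent_coeffs n" "g \<in> laurent_coeffs n"
  shows "laurent_mult g (\<lambda>e. \<Sum>i\<in>S. F i e) e = (\<Sum>i\<in>S. laurent_mult g (F i) e)"
  using laurent_mult_sum_left[OF assms] by (simp add: laurent_mult_commute[of g])

lemma laurent_mult_assoc:
  assumes "f \<in> laurent_coeffs n" "g \<in> laurent_coeffs n" "h \<in> laurent_coeffs n"
  shows "laurent_mult (laurent_mult f g) h e = laurent_mult f (laurent_mult g h) e"
  using assms
proof (induction n arbitrary: f g h e)
  case 0
  show ?case
    by (cases e) (simp_all only: laurent_mult_0_Cons 0 laurent_mult_closed, simp add: algebra_simps)
next
  case (Suc n)
  from Suc.prems obtain A B C where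
    A: "\<forall>k<A. slice f k = (\<lambda>_. 0)" and B: "\<forall>k<B. slice g k = (\<lambda>_. 0)"
    and C: "\<forall>k<C. slice h k = (\<lambda>_. 0)"
    by auto
  have fgh: "slice f i \<in> laurent_coeffs n" "slice g i \<in> laurent_coeffs n"
    "slice h i \<in> laurent_coeffs n" for i using Suc.prems by auto
  show ?case
  proof (cases e)
    case Nil
    then show ?thesis by (simp add: algebra_simps)
  next
    case (Cons k d)
    define T where "T i j = laurent_mult (laurent_mult (slice f j) (slice g (i - j))) (slice h (k - i)) d"
      for i j
    have fg: "slice (laurent_mult f g) i =
       (\<lambda>e. \<Sum>j\<in>{A..k-B-C}. laurent_mult (slice f j) (slice g (i - j)) e)" if "i \<le> k - C" for i
      unfolding slice_def[of "laurent_mult f g"]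
      using that by (intro ext laurent_mult_window[OF A B]) auto
    have gh: "slice (laurent_mult g h) (k - j) =
       (\<lambda>e. \<Sum>i\<in>{A+B..k-C}. laurent_mult (slice g (i - j)) (slice h (k - i)) e)" if "j \<ge> A" for j
    proof
      fix e
      have "slice (laurent_mult g h) (k - j) e =
        (\<Sum>i\<in>{A+B-j..k-C-j}. laurent_mult (slice g i) (slice h (k - j - i)) e)"
        unfolding slice_def[of "laurent_mult g h"]
        using that by (intro laurent_mult_window[OF B C]) auto
      also have "\<dots> = (\<Sum>i\<in>{A+B..k-C}. laurent_mult (slice g (i - j)) (slice h (k - i)) e)"
        by (rule sum.reindex_bij_witness[of _ "\<lambda>i. i - j" "\<lambda>i. i + j"]) (auto simp: algebra_simps)
      finally show "slice (laurent_mult g h) (k - j) e = \<dots>" .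
    qed
    have fg0: "\<forall>i<A+B. slice (laurent_mult f g) i = (\<lambda>_. 0)"
    proof (intro allI impI ext)
      fix i e assume "i < A + B"
      have "slice (laurent_mult f g) i e = (\<Sum>j\<in>{A..i-B}. laurent_mult (slice f j) (slice g (i - j)) e)"
        unfolding slice_def[of "laurent_mult f g"] by (intro laurent_mult_window[OF A B]) auto
      then show "slice (laurent_mult f g) i e = 0" using \<open>i < A + B\<close> by auto
    qed
    have gh0: "\<forall>i<B+C. slice (laurent_mult g h) i = (\<lambda>_. 0)"
    proof (intro allI impI ext)
      fix i e assume "i < B + C"
      have "slice (laurent_mult g h) i e = (\<Sum>j\<in>{B..i-C}. laurent_mult (slice g j) (slice h (i - j)) e)"
        unfolding slice_def[of "laurent_mult g h"] by (intro laurent_mult_window[OF B C]) auto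
      then show "slice (laurent_mult g h) i e = 0" using \<open>i < B + C\<close> by auto
    qed
    have "laurent_mult (laurent_mult f g) h (k # d) =
        (\<Sum>i\<in>{A+B..k-C}. laurent_mult (slice (laurent_mult f g) i) (slice h (k - i)) d)"
      by (rule laurent_mult_window[OF fg0 C]) auto
    also have "\<dots> = (\<Sum>i\<in>{A+B..k-C}. \<Sum>j\<in>{A..k-B-C}. T i j)"
    proof (rule sum.cong[OF refl])
      fix i assume "i \<in> {A+B..k-C}"
      then have i: "i \<le> k - C" by simp
      show "laurent_mult (slice (laurent_mult f g) i) (slice h (k - i)) d = (\<Sum>j\<in>{A..k-B-C}. T i j)"
        unfolding fg[OF i] T_def
        by (rule laurent_mult_sum_left[where n = n]) (auto intro: laurent_mult_closed fgh)
    qed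
    also have "\<dots> = (\<Sum>j\<in>{A..k-B-C}. \<Sum>i\<in>{A+B..k-C}. T i j)"
      by (rule sum.swap)
    also have "\<dots> = (\<Sum>j\<in>{A..k-B-C}. laurent_mult (slice f j) (slice (laurent_mult g h) (k - j)) d)"
    proof (rule sum.cong[OF refl])
      fix j assume "j \<in> {A..k-B-C}"
      then have j: "j \<ge> A" by simp
      show "(\<Sum>i\<in>{A+B..k-C}. T i j) = laurent_mult (slice f j) (slice (laurent_mult g h) (k - j)) d"
        unfolding gh[OF j] T_def
        by (subst laurent_mult_sum_right[where n = n])
           (auto intro: laurent_mult_closed fgh simp: Suc.IH[OF fgh])
    qed
    also have "\<dots> = laurent_mult f (laurent_mult g h) (k # d)"
      by (rule laurent_mult_window[OF A gh0, symmetric]) auto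
    finally show ?thesis by (simp only: Cons)
  qed
qed

lemma laurent_mult_monom_left:
  assumes "f \<in> laurent_coeffs n"
  shows "laurent_mult (laurent_monom (replicate n 0) c) f e = c * f e"
  using assms
proof (induction n arbitrary: f e)
  case 0
  then show ?case
    using laurent_mult_0_Cons[OF laurent_coeffs_monom[of "[]", unfolded list.size]]
    by (cases e) (simp_all only: replicate_0, simp_all add: laurent_monom_def)
next
  case (Suc n)
  show ?case
  proof (cases e)
    case Nil
    then show ?thesis using Suc.prems by simp
  next
    case (Cons k d)
    from Suc.prems obtain B where B: "\<forall>k<B. slice f k = (\<lambda>_. 0)" by auto
    have A: "\<forall>k<0. slice (laurent_monom (replicate (Suc n) 0) c) k = (\<lambda>_. 0)"
      by (simp add: slice_monom)
    have "laurent_mult (laurent_monom (replicate (Suc n) 0) c) f (k # d) =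
      (\<Sum>i\<in>insert 0 {0..k-B}. laurent_mult (slice (laurent_monom (replicate (Suc n) 0) c) i) (slice f (k - i)) d)"
      by (rule laurent_mult_window[OF A B]) auto
    also have "\<dots> = (\<Sum>i\<in>insert 0 {0..k-B}. if i = 0 then c * f e else 0)"
    proof (rule sum.cong[OF refl])
      fix i
      have "slice f k \<in> laurent_coeffs n" using Suc.prems by auto
      from Suc.IH[OF this, of d]
      show "laurent_mult (slice (laurent_monom (replicate (Suc n) 0) c) i) (slice f (k - i)) d =
          (if i = 0 then c * f e else 0)"
        by (simp add: slice_monom) (simp add: slice_def Cons)
    qed
    also have "\<dots> = c * f e" by (subst sum.delta) auto
    finally show ?thesis by (simp only: Cons)
  qed
qed

lemma laurent_inverse_exists:
  fixes f :: "int list \<Rightarrow> 'a::field"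
  assumes "f \<in> laurent_coeffs n" "f \<noteq> (\<lambda>_. 0)"
  shows "\<exists>g \<in> laurent_coeffs n. laurent_mult f g = laurent_monom (replicate n 0) 1"
  using assms
proof (induction n arbitrary: f)
  case 0
  then have f: "\<And>e. e \<noteq> [] \<Longrightarrow> f e = 0" and nz: "f [] \<noteq> 0"
    by auto (metis ext)
  have "laurent_mult f (laurent_monom [] (inverse (f []))) e = laurent_monom [] 1 e" for e
    using 0 nz by (cases e) (simp_all only: laurent_mult_0_Cons, simp_all add: laurent_monom_def)
  then show ?case using laurent_coeffs_monom[of "[]"]
    by (intro bexI[of _ "laurent_monom [] (inverse (f []))"]) auto
next
  case (Suc n)
  from Suc.prems obtain A where A: "\<forall>k<A. slice f k = (\<lambda>_. 0)" by auto
  have "\<exists>k. slice f k \<noteq> (\<lambda>_. 0)"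
  proof (rule ccontr)
    assume "\<not> ?thesis"
    then have "f e = 0" for e using Suc.prems by (cases e) (auto simp: slice_def fun_eq_iff)
    then show False using Suc.prems by auto
  qed
  then obtain k0 where k0: "slice f k0 \<noteq> (\<lambda>_. 0)" by blast
  define m where "m = (LEAST m. slice f (A + int m) \<noteq> (\<lambda>_. 0))"
  have ex: "slice f (A + int (nat (k0 - A))) \<noteq> (\<lambda>_. 0)"
    using k0 A by (metis add_diff_cancel_left' diff_add_cancel int_nat_eq linorder_not_less
        add.commute diff_ge_0_iff_ge)
  define N where "N = A + int m"
  have N: "slice f N \<noteq> (\<lambda>_. 0)"
    unfolding N_def m_def by (rule LeastI[of "\<lambda>m. slice f (A + int m) \<noteq> (\<lambda>_. 0)", OF ex])
  have N': "\<forall>k<N. slice f k = (\<lambda>_. 0)"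
  proof (intro allI impI)
    fix k assume "k < N"
    show "slice f k = (\<lambda>_. 0)"
    proof (cases "k < A")
      case False
      then have "nat (k - A) < m" using \<open>k < N\<close> by (simp add: N_def)
      from not_less_Least[OF this[unfolded m_def]] False show ?thesis by simp
    qed (use A in auto)
  qed
  have sl: "slice f k \<in> laurent_coeffs n" for k using Suc.prems by auto
  obtain b where b: "b \<in> laurent_coeffs n"
    "laurent_mult (slice f N) b = laurent_monom (replicate n 0) 1"
    using Suc.IH[OF sl N] by blast
  \<comment> \<open>the coefficients of the inverse, by the usual recursion\<close>
  define R where "R s h = (if s = 0 then b else (\<lambda>e. - laurent_mult b
     (\<lambda>e'. \<Sum>j<s. laurent_mult (slice f (N + int (s - j))) (h j) e') e))" for s h
  define H where "H = wfrec {(x::nat, y). x < y} (\<lambda>h s. R s h)"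
  have H: "H s = R s H" for s
  proof -
    have "H s = R s (cut H {(x, y). x < y} s)"
      unfolding H_def by (rule wfrec[OF wf])
    also have "\<dots> = R s H"
      unfolding R_def by (auto simp: cut_apply fun_eq_iff intro!: arg_cong[where f = uminus]
          arg_cong2[where f = "\<lambda>g e. laurent_mult b g e"] sum.cong)
    finally show ?thesis .
  qed
  have Hcl: "H s \<in> laurent_coeffs n" for s
  proof (induction s rule: less_induct)
    case (less s)
    show ?case
      by (subst H, unfold R_def)
         (auto intro!: b laurent_coeffs_uminus laurent_mult_closed laurent_coeffs_sum sl less)
  qed
  define g where "g e = (case e of [] \<Rightarrow> 0 | k # d \<Rightarrow> if k < - N then 0 else H (nat (k + N)) d)" for e
  have slg: "slice g k = (if k < - N then (\<lambda>_. 0) else H (nat (k + N)))" for k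
    by (auto simp: slice_def g_def)
  have g0: "\<forall>k < - N. slice g k = (\<lambda>_. 0)" by (simp add: slg)
  have g: "g \<in> laurent_coeffs (Suc n)"
    using Hcl laurent_coeffs_zero g0 by (auto simp: slg) (simp add: g_def)
  have "laurent_mult f g e = laurent_monom (replicate (Suc n) 0) 1 e" for e
  proof (cases e)
    case Nil
    then show ?thesis using Suc.prems by (simp add: laurent_monom_def)
  next
    case (Cons k d)
    have w: "laurent_mult f g (k # d) = (\<Sum>i\<in>{N..k+N}. laurent_mult (slice f i) (slice g (k - i)) d)"
      by (rule laurent_mult_window[OF N' g0]) auto
    show ?thesis
    proof (cases "k < 0")
      case True
      then show ?thesis unfolding Cons w by (simp add: laurent_monom_def)
    next
      case False
      define s where "s = nat k"
      have k: "k = int s" using False by (simp add: s_def)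
      have "laurent_mult f g (k # d) = (\<Sum>j\<le>s. laurent_mult (slice f (N + int (s - j))) (H j) d)"
        unfolding w
        by (rule sum.reindex_bij_witness[of _ "\<lambda>j. N + int (s - j)" "\<lambda>i. nat (k + N - i)"])
           (auto simp: slg k of_nat_diff algebra_simps)
      also have "\<dots> = laurent_mult (slice f N) (H s) d
          + (\<Sum>j<s. laurent_mult (slice f (N + int (s - j))) (H j) d)"
        by (simp add: lessThan_Suc_atMost[symmetric])
      also have "\<dots> = laurent_monom (replicate (Suc n) 0) 1 (k # d)"
      proof (cases "s = 0")
        case True
        then show ?thesis using b(2) by (simp add: H R_def laurent_monom_def k)
      next
        case s: False
        define c where "c = (\<lambda>e'. \<Sum>j<s. laurent_mult (slice f (N + int (s - j))) (H j) e')"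
        have c: "c \<in> laurent_coeffs n"
          unfolding c_def by (auto intro!: laurent_coeffs_sum laurent_mult_closed sl Hcl)
        have bc: "laurent_mult b c \<in> laurent_coeffs n" by (intro laurent_mult_closed b c)
        have Hs: "H s = (\<lambda>e. - laurent_mult b c e)" using s by (subst H) (simp add: R_def c_def)
        have "laurent_mult (slice f N) (laurent_mult b c) d + laurent_mult (slice f N) (H s) d
            = laurent_mult (\<lambda>e. laurent_mult b c e + H s e) (slice f N) d"
          using laurent_mult_add_left[OF bc Hcl[of s] sl[of N]]
          by (simp add: laurent_mult_commute[of _ "slice f N"])
        also have "\<dots> = 0" by (simp add: Hs)
        finally have "laurent_mult (slice f N) (H s) d = - laurent_mult (slice f N) (laurent_mult b c) d"
          by (simp add: eq_neg_iff_add_eq_0 add.commute)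
        also have "laurent_mult (slice f N) (laurent_mult b c) d
            = laurent_mult (laurent_mult (slice f N) b) c d"
          by (rule laurent_mult_assoc[OF sl b(1) c, symmetric])
        also have "\<dots> = c d" using laurent_mult_monom_left[OF c, of 1] by (simp add: b(2))
        finally show ?thesis using s by (simp add: c_def laurent_monom_def k)
      qed
      finally show ?thesis by (simp only: Cons)
    qed
  qed
  then show ?case using g by auto
qed

text \<open>
  The field \<open>F((x\<^sub>1))\<dots>((x\<^sub>n))\<close>, where \<open>n = CARD('n)\<close>.  The type \<open>'n\<close> only serves to provide the
  number \<open>n\<close>.
\<close>

typedef (overloaded) ('a::field, 'n::finite) iter_laurent =
  "laurent_coeffs CARD('n) :: (int list \<Rightarrow> 'a) set"
  by (rule exI[of _ "\<lambda>_. 0"]) (rule laurent_coeffs_zero)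

setup_lifting type_definition_iter_laurent

instantiation iter_laurent :: (field, finite) field
begin

lift_definition zero_iter_laurent :: "('a, 'b) iter_laurent" is "\<lambda>_. 0"
  by (rule laurent_coeffs_zero)

lift_definition one_iter_laurent :: "('a, 'b) iter_laurent" is
  "laurent_monom (replicate CARD('b) 0) 1"
  using laurent_coeffs_monom[of "replicate CARD('b) 0"] by simp

lift_definition plus_iter_laurent ::
  "('a, 'b) iter_laurent \<Rightarrow> ('a, 'b) iter_laurent \<Rightarrow> ('a, 'b) iter_laurent"
  is "\<lambda>f g e. f e + g e"
  by (rule laurent_coeffs_add)

lift_definition uminus_iter_laurent :: "('a, 'b) iter_laurent \<Rightarrow> ('a, 'b) iter_laurent"
  is "\<lambda>f e. - f e"
  by (rule laurent_coeffs_uminus)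

definition minus_iter_laurent ::
  "('a, 'b) iter_laurent \<Rightarrow> ('a, 'b) iter_laurent \<Rightarrow> ('a, 'b) iter_laurent"
  where "minus_iter_laurent f g = f + - g"

lift_definition times_iter_laurent ::
  "('a, 'b) iter_laurent \<Rightarrow> ('a, 'b) iter_laurent \<Rightarrow> ('a, 'b) iter_laurent"
  is laurent_mult
  by (rule laurent_mult_closed)

definition inverse_iter_laurent :: "('a, 'b) iter_laurent \<Rightarrow> ('a, 'b) iter_laurent" where
  "inverse_iter_laurent f = (if f = 0 then 0 else (SOME g. f * g = 1))"

definition divide_iter_laurent ::
  "('a, 'b) iter_laurent \<Rightarrow> ('a, 'b) iter_laurent \<Rightarrow> ('a, 'b) iter_laurent"
  where "divide_iter_laurent f g = f * inverse g"

instance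
proof
  fix a b c :: "('a, 'b) iter_laurent"
  show "a * b * c = a * (b * c)" by transfer (auto simp: laurent_mult_assoc)
  show comm: "a * b = b * a" by transfer (auto simp: laurent_mult_commute)
  show "1 * a = a" by transfer (auto simp: laurent_mult_monom_left)
  show "a + b + c = a + (b + c)" by transfer (auto simp: add.assoc)
  show "a + b = b + a" by transfer (auto simp: add.commute)
  show "0 + a = a" by transfer auto
  show "- a + a = 0" by transfer auto
  show "a - b = a + - b" by (rule minus_iter_laurent_def)
  show "(a + b) * c = a * c + b * c" by transfer (auto simp: laurent_mult_add_left)
  show "(0::('a, 'b) iter_laurent) \<noteq> 1"
    by transfer (auto simp: laurent_monom_def fun_eq_iff)
  show "a div b = a * inverse b" by (rule divide_iter_laurent_def)
  show "inverse (0::('a, 'b) iter_laurent) = 0" by (simp add: inverse_iter_laurent_def)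
  assume "a \<noteq> 0"
  moreover from this have "\<exists>g. a * g = 1"
    by transfer (use laurent_inverse_exists in blast)
  ultimately have "a * inverse a = 1"
    by (auto simp: inverse_iter_laurent_def intro: someI_ex)
  then show "inverse a * a = 1"
    using laurent_mult_commute by (metis times_iter_laurent.rep_eq Rep_iter_laurent_inject ext)
qed

end

lift_definition laurent_const :: "'a::field \<Rightarrow> ('a, 'n::finite) iter_laurent" is
  "laurent_monom (replicate CARD('n) 0)"
  using laurent_coeffs_monom[of "replicate CARD('n) 0"] by simp

text \<open>
  The variable \<open>x\<^sub>i\<close> for \<open>1 \<le> i \<le> n\<close>; for other \<open>i\<close> the value is immaterial.
\<close>

definition laurent_var :: "nat \<Rightarrow> ('a::field, 'n::finite) iter_laurent" where
  "laurent_var i = Abs_iter_laurent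
     (laurent_monom (replicate (CARD('n) - i) 0 @ [1] @ replicate (i - 1) 0) 1)"

lemma Rep_laurent_var:
  assumes "1 \<le> i" "i \<le> CARD('n::finite)"
  shows "Rep_iter_laurent (laurent_var i :: ('a::field, 'n) iter_laurent) =
    laurent_monom (replicate (CARD('n) - i) 0 @ [1] @ replicate (i - 1) 0) 1"
proof -
  let ?d = "replicate (CARD('n) - i) (0::int) @ [1] @ replicate (i - 1) 0"
  have "length ?d = CARD('n)" using assms by simp
  with laurent_coeffs_monom[of ?d "1::'a"] show ?thesis
    unfolding laurent_var_def by (intro Abs_iter_laurent_inverse) (simp only:)
qed

lemma field_hom_laurent_const:
  "field_hom (laurent_const :: 'a::field \<Rightarrow> ('a, 'n::finite) iter_laurent)"
proof
  fix x y :: 'a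
  let ?h = "laurent_const :: 'a \<Rightarrow> ('a, 'n) iter_laurent"
  show "?h (x + y) = ?h x + ?h y" by transfer (auto simp: laurent_monom_def fun_eq_iff)
  show "?h 0 = 0" by transfer (auto simp: laurent_monom_def fun_eq_iff)
  show "?h 1 = 1" by transfer auto
  show "?h (x * y) = ?h x * ?h y"
  proof transfer
    fix x y :: 'a
    have "laurent_monom (replicate CARD('n) 0) y \<in> laurent_coeffs CARD('n)"
      using laurent_coeffs_monom[of "replicate CARD('n) 0" y] by simp
    then show "laurent_monom (replicate CARD('n) 0) (x * y) =
      laurent_mult (laurent_monom (replicate CARD('n) 0) x) (laurent_monom (replicate CARD('n) 0) y)"
      by (intro ext, subst laurent_mult_monom_left) (auto simp: laurent_monom_def)
  qed
qed

section \<open>Quadratic forms\<close>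

text \<open>
  In characteristic different from 2, a quadratic form on \<open>F\<^sup>d\<close> is the same as a symmetric
  bilinear form, given by its symmetric Gram matrix \<open>A\<close>; the quadratic map is
  \<open>v \<mapsto> v \<bullet> (A *\<^sub>v v)\<close>.  Forms are regular throughout.
\<close>

definition qf_eval :: "'a::field mat \<Rightarrow> 'a vec \<Rightarrow> 'a" where
  "qf_eval A v = v \<bullet> (A *\<^sub>v v)"

definition is_form :: "'a::field mat \<Rightarrow> bool" where
  "is_form A \<longleftrightarrow> square_mat A \<and> transpose_mat A = A \<and>
     (\<forall>v \<in> carrier_vec (dim_row A).
        (\<forall>w \<in> carrier_vec (dim_row A). w \<bullet> (A *\<^sub>v v) = 0) \<longrightarrow> v = 0\<^sub>v (dim_row A))"

definition anisotropic :: "'a::field mat \<Rightarrow> bool" where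
  "anisotropic A \<longleftrightarrow>
     (\<forall>v \<in> carrier_vec (dim_row A). qf_eval A v = 0 \<longrightarrow> v = 0\<^sub>v (dim_row A))"

definition isometric :: "'a::field mat \<Rightarrow> 'a mat \<Rightarrow> bool" where
  "isometric A B \<longleftrightarrow> dim_row A = dim_row B \<and>
     (\<exists>P \<in> carrier_mat (dim_row A) (dim_row A). invertible_mat P \<and>
        (\<forall>v \<in> carrier_vec (dim_row A). qf_eval B (P *\<^sub>v v) = qf_eval A v))"

definition orth_sum :: "'a::field mat \<Rightarrow> 'a mat \<Rightarrow> 'a mat" where
  "orth_sum A B = diag_block_mat [A, B]"

definition tensor_form :: "'a::field mat \<Rightarrow> 'a mat \<Rightarrow> 'a mat" where
  "tensor_form A B = mat (dim_row A * dim_row B) (dim_col A * dim_col B)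
     (\<lambda>(i, j). A $$ (i div dim_row B, j div dim_col B) * B $$ (i mod dim_row B, j mod dim_col B))"

definition subform :: "'a::field mat \<Rightarrow> 'a mat \<Rightarrow> bool" where
  "subform p q \<longleftrightarrow> (\<exists>r. is_form r \<and> isometric q (orth_sum p r))"

text \<open>The form \<open>\<langle>1, a\<^sub>1\<rangle> \<otimes> \<dots> \<otimes> \<langle>1, a\<^sub>m\<rangle>\<close>; the empty product is \<open>\<langle>1\<rangle>\<close>.\<close>

definition pfister_prod :: "'a::field list \<Rightarrow> 'a mat" where
  "pfister_prod as = foldr (\<lambda>a. tensor_form (mk_diagonal [1, a])) as (mk_diagonal [1])"

definition pfister :: "'a::field mat \<Rightarrow> bool" where
  "pfister A \<longleftrightarrow> is_form A \<and> (\<exists>as. 0 \<notin> set as \<and> isometric A (pfister_prod as))"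

definition neighbour :: "'a::field mat \<Rightarrow> 'a mat \<Rightarrow> bool" where
  "neighbour p \<theta> \<longleftrightarrow> is_form p \<and> pfister \<theta> \<and>
     (\<exists>a. a \<noteq> 0 \<and> subform p (a \<cdot>\<^sub>m \<theta>)) \<and> 2 * dim_row p > dim_row \<theta>"

abbreviation scalar_ext :: "'a::field mat \<Rightarrow> ('a, 'n::finite) iter_laurent mat" where
  "scalar_ext \<equiv> map_mat laurent_const"

end

theory Submission
  imports
    Defs
    "Jordan_Normal_Form.Determinant"
    "HOL-Combinatorics.Permutations"
    "HOL-Library.List_Lexorder"
begin

text \<open>
  Up to squares, every element of \<open>K\<close> is \<open>a x\<^sup>d\<close> with \<open>a \<in> F\<close>, where only the class of the exponent
  vector \<open>d\<close> modulo 2 matters. So a form over \<open>K\<close> splits into residue forms over \<open>F\<close>, one for each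
  class, and, as in Springer's theorem, if these are anisotropic, then comparing leading terms turns an
  embedding of \<open>\<langle>x\<^sup>d\<rangle> \<otimes> q\<close> into an embedding of \<open>q\<close> into the residue form of the class of \<open>d\<close>.

  A Pfister form over \<open>K\<close> is isometric to \<open>\<sigma> \<otimes> \<langle>1,b\<^sub>1\<rangle> \<otimes> \<dots> \<otimes> \<langle>1,b\<^sub>k\<rangle>\<close> with \<open>\<sigma>\<close> a Pfister form over \<open>F\<close>
  and slots \<open>b\<^sub>i\<close> that are independent modulo \<open>F\<^sup>\<times> K\<^sup>\<times>\<^sup>2\<close>; hence all its nonzero residue forms are multiples of
  \<open>\<sigma>\<close>. If it contains a multiple of \<open>q \<otimes> \<pi>\<close> as a neighbour, then \<open>\<sigma>\<close> is anisotropic, because an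
  isotropic Pfister form is hyperbolic and \<open>q \<otimes> \<pi>\<close> is anisotropic of more than half the dimension. All
  \<open>2\<^sup>n\<close> residue forms then contain \<open>q\<close>, so none vanishes, and \<open>q\<close> is a neighbour of \<open>\<sigma>\<close> for
  dimension reasons.
\<close>

text \<open>Everything is phrased with matrix embeddings \<open>P\<^sup>T B P = A\<close>, because
  these compose, add and tensor by matrix multiplication. The price is that \<open>subform\<close>
  asks for an orthogonal complement, which has to be recovered at the end. It is built one vector at
  a time inside an anisotropic form, where each nonzero vector orthogonal to the image has nonzero
  value. So anisotropy of \<sigma> matters twice: for reading off residue forms, and for returning
  from embeddings to subforms.

  The dimension count runs as follows. If the slots b_i produce z classes, then dim \<theta> = z dim
  \<sigma>. The 2^n monomials of \<pi> lie in different classes and each must meet its own class of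
  \<theta>, so z >= 2^n. Then dim \<theta> < 2 * 2^n * dim q leaves dim \<sigma> < 2 dim q.

  The scalar c in the definition of a neighbour lies in K. Multiplication by c only translates the
  exponent classes: modulo squares, each product of c with an entry is again a monomial with a
  coefficient from F, and that coefficient becomes the scalar over F.\<close>

no_notation fps_nth (infixl "$" 75)

section \<open>Isometric embeddings of Gram matrices\<close>

text \<open>For a regular \<open>A\<close> the matrix \<open>P\<close> is automatically injective,
  since its kernel lies in the radical of \<open>A\<close>. So this is the relation "isometric to a
  subspace of \<open>B\<close>", stated by Gram matrices.\<close>

definition embeds :: "'a::field mat \<Rightarrow> 'a mat \<Rightarrow> bool" where
  "embeds A B \<longleftrightarrow>
     (\<exists>P \<in> carrier_mat (dim_row B) (dim_row A). transpose_mat P * (B * P) = A)"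

lemma embedsI:
  "P \<in> carrier_mat n m \<Longrightarrow> A \<in> carrier_mat m m \<Longrightarrow> B \<in> carrier_mat n n \<Longrightarrow>
   transpose_mat P * (B * P) = A \<Longrightarrow> embeds A B"
  unfolding embeds_def by auto

lemma embedsE:
  assumes "embeds A B" "A \<in> carrier_mat m m" "B \<in> carrier_mat n n"
  obtains P where "P \<in> carrier_mat n m" "transpose_mat P * (B * P) = A"
  using assms unfolding embeds_def by auto

lemma embeds_refl: "A \<in> carrier_mat n n \<Longrightarrow> embeds A A"
  unfolding embeds_def by (intro bexI[of _ "1\<^sub>m n"]) auto

lemma congruence_mult:
  fixes C P Q :: "'a::field mat"
  assumes "C \<in> carrier_mat n n" "Q \<in> carrier_mat n k" "P \<in> carrier_mat k m"
  shows "transpose_mat (Q * P) * (C * (Q * P)) =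
    transpose_mat P * ((transpose_mat Q * (C * Q)) * P)"
proof -
  have "transpose_mat (Q * P) = transpose_mat P * transpose_mat Q"
    by (rule transpose_mult[OF assms(2,3)])
  moreover have "C * (Q * P) = (C * Q) * P"
    by (rule assoc_mult_mat[OF assms, symmetric])
  moreover have "transpose_mat P * transpose_mat Q * ((C * Q) * P)
      = transpose_mat P * (transpose_mat Q * ((C * Q) * P))"
    using assms by (intro assoc_mult_mat) auto
  moreover have "transpose_mat Q * ((C * Q) * P) = (transpose_mat Q * (C * Q)) * P"
    using assms by (intro assoc_mult_mat[symmetric]) auto
  ultimately show ?thesis by (simp only:)
qed

lemma embeds_trans:
  assumes "embeds A B" "embeds B C" "C \<in> carrier_mat n n"
  shows "embeds A C"
proof -
  obtain P where P: "P \<in> carrier_mat (dim_row B) (dim_row A)" "transpose_mat P * (B * P) = A"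
    using assms(1) unfolding embeds_def by blast
  have n: "dim_row C = n" using assms(3) by simp
  obtain Q where Q: "Q \<in> carrier_mat n (dim_row B)" "transpose_mat Q * (C * Q) = B"
    using assms(2) unfolding embeds_def n by blast
  have "transpose_mat (Q * P) * (C * (Q * P)) = A"
    unfolding congruence_mult[OF assms(3) Q(1) P(1)] Q(2) P(2) ..
  moreover have "Q * P \<in> carrier_mat n (dim_row A)" by (rule mult_carrier_mat[OF Q(1) P(1)])
  ultimately show ?thesis unfolding embeds_def n by blast
qed

lemma embeds_smult:
  assumes "embeds A B" "B \<in> carrier_mat n n"
  shows "embeds (c \<cdot>\<^sub>m A) (c \<cdot>\<^sub>m B)"
proof -
  obtain P where P: "P \<in> carrier_mat n (dim_row A)" "transpose_mat P * (B * P) = A"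
    using assms by (auto simp: embeds_def)
  have "transpose_mat P * ((c \<cdot>\<^sub>m B) * P) = c \<cdot>\<^sub>m A"
    unfolding P(2)[symmetric] using P(1) assms(2)
    by (simp add: mult_smult_assoc_mat[of _ n n] mult_smult_distrib[of _ "dim_row A" n _ "dim_row A"])
  then show ?thesis using P assms unfolding embeds_def by auto
qed

lemma orth_sum_carrier [simp]:
  "A \<in> carrier_mat n n \<Longrightarrow> B \<in> carrier_mat m m \<Longrightarrow> orth_sum A B \<in> carrier_mat (n + m) (n + m)"
  by (auto simp: orth_sum_def Let_def)

lemma orth_sum_altdef:
  "A \<in> carrier_mat n n \<Longrightarrow> B \<in> carrier_mat m m \<Longrightarrow>
   orth_sum A B = four_block_mat A (0\<^sub>m n m) (0\<^sub>m m n) B"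
  by (rule eq_matI) (auto simp: orth_sum_def Let_def)

lemma embeds_orth_sum:
  assumes "embeds A A'" "embeds B B'" "A \<in> carrier_mat m m" "B \<in> carrier_mat n n"
    and "A' \<in> carrier_mat m' m'" "B' \<in> carrier_mat n' n'"
  shows "embeds (orth_sum A B) (orth_sum A' B')"
proof -
  obtain P where P: "P \<in> carrier_mat m' m" "transpose_mat P * (A' * P) = A"
    using assms by (auto simp: embeds_def)
  obtain Q where Q: "Q \<in> carrier_mat n' n" "transpose_mat Q * (B' * Q) = B"
    using assms by (auto simp: embeds_def)
  let ?R = "four_block_mat P (0\<^sub>m m' n) (0\<^sub>m n' m) Q"
  have "transpose_mat ?R = four_block_mat (transpose_mat P) (0\<^sub>m m n') (0\<^sub>m n m') (transpose_mat Q)"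
    using P(1) Q(1) by (subst transpose_four_block_mat[of _ m' m _ n _ n']) auto
  moreover have "orth_sum A' B' * ?R = four_block_mat (A' * P) (0\<^sub>m m' n) (0\<^sub>m n' m) (B' * Q)"
    using P(1) Q(1) assms
    by (simp add: orth_sum_altdef mult_four_block_mat[of _ m' m' _ n' _ n' _ _ m _ n])
  moreover have "four_block_mat (transpose_mat P) (0\<^sub>m m n') (0\<^sub>m n m') (transpose_mat Q)
      * four_block_mat (A' * P) (0\<^sub>m m' n) (0\<^sub>m n' m) (B' * Q) = orth_sum A B"
    using P Q assms
    by (subst mult_four_block_mat[of _ m m' _ n' _ n _ _ m _ n]) (auto simp: orth_sum_altdef)
  ultimately have "transpose_mat ?R * (orth_sum A' B' * ?R) = orth_sum A B" by (simp only:)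
  then show ?thesis using P Q assms by (intro embedsI[of ?R "m' + n'" "m + n"]) auto
qed

lemma embeds_orth_sum_left:
  fixes A B :: "'a::field mat"
  assumes "A \<in> carrier_mat m m" "B \<in> carrier_mat n n"
  shows "embeds A (orth_sum A B)"
proof -
  let ?R = "four_block_mat (1\<^sub>m m) (0\<^sub>m m 0) (0\<^sub>m n m) (0\<^sub>m n 0) :: 'a mat"
  have "transpose_mat ?R = four_block_mat (1\<^sub>m m) (0\<^sub>m m n) (0\<^sub>m 0 m) (0\<^sub>m 0 n)"
    by (subst transpose_four_block_mat[of _ m m _ 0 _ n]) auto
  moreover have "orth_sum A B * ?R = four_block_mat A (0\<^sub>m m 0) (0\<^sub>m n m) (0\<^sub>m n 0)"
    using assms
    by (simp add: orth_sum_altdef mult_four_block_mat[of _ m m _ n _ n _ _ m _ 0])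
  moreover have "four_block_mat (1\<^sub>m m) (0\<^sub>m m n) (0\<^sub>m 0 m) (0\<^sub>m 0 n)
      * four_block_mat A (0\<^sub>m m 0) (0\<^sub>m n m) (0\<^sub>m n 0) = A"
    using assms
    by (subst mult_four_block_mat[of _ m m _ n _ 0 _ _ m _ 0]) (auto intro!: eq_matI)
  ultimately have "transpose_mat ?R * (orth_sum A B * ?R) = A" by (simp only:)
  moreover have "?R \<in> carrier_mat (m + n) (m + 0)" by (rule four_block_carrier_mat) auto
  ultimately show ?thesis using assms by (intro embedsI[of ?R "m + n" m]) auto
qed

section \<open>Quadratic values and Gram matrices\<close>

lemma qf_eval_transform:
  assumes "P \<in> carrier_mat n m" "B \<in> carrier_mat n n" "v \<in> carrier_vec m"
  shows "qf_eval B (P *\<^sub>v v) = qf_eval (transpose_mat P * (B * P)) v"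
proof -
  have "qf_eval (transpose_mat P * (B * P)) v = v \<bullet> (transpose_mat P *\<^sub>v (B *\<^sub>v (P *\<^sub>v v)))"
    unfolding qf_eval_def using assms
    by (simp add: assoc_mult_mat_vec[of _ m n _ m] assoc_mult_mat_vec[of _ n n _ m])
  also have "\<dots> = (transpose_mat P *\<^sub>v (B *\<^sub>v (P *\<^sub>v v))) \<bullet> v"
    using assms by (intro comm_scalar_prod[of _ m]) auto
  also have "\<dots> = (B *\<^sub>v (P *\<^sub>v v)) \<bullet> (P *\<^sub>v v)"
    using assms by (intro transpose_vec_mult_scalar) auto
  also have "\<dots> = qf_eval B (P *\<^sub>v v)"
    unfolding qf_eval_def using assms by (intro comm_scalar_prod[of _ n]) auto
  finally show ?thesis ..
qed

lemma qf_eval_add: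
  assumes "A \<in> carrier_mat n n" "v \<in> carrier_vec n" "w \<in> carrier_vec n"
  shows "qf_eval A (v + w) = qf_eval A v + qf_eval A w + v \<bullet> (A *\<^sub>v w) + w \<bullet> (A *\<^sub>v v)"
  unfolding qf_eval_def using assms
  by (simp add: mult_add_distrib_mat_vec[of _ n n] add_scalar_prod_distrib[of _ n]
      scalar_prod_add_distrib[of _ n])

lemma unit_vec_form:
  fixes A :: "'a::field mat"
  assumes "A \<in> carrier_mat n n" "i < n" "j < n"
  shows "unit_vec n i \<bullet> (A *\<^sub>v unit_vec n j) = A $$ (i, j)"
proof -
  have "A *\<^sub>v unit_vec n j = col A j" using assms by (intro eq_vecI) (auto simp: row_def scalar_prod_def unit_vec_def if_distrib cong: if_cong)
  then show ?thesis using assms by simp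
qed

text \<open>Polarisation at sums of two unit vectors, followed by division by 2. This is the bridge
  from \<open>isometric\<close>, which compares values, to the matrix identity in
  \<open>embeds\<close>.\<close>

lemma symmetric_mat_eqI:
  fixes A B :: "'a::field mat"
  assumes "(2::'a) \<noteq> 0" "A \<in> carrier_mat n n" "B \<in> carrier_mat n n"
    and "transpose_mat A = A" "transpose_mat B = B"
    and eq: "\<And>v. v \<in> carrier_vec n \<Longrightarrow> qf_eval A v = qf_eval B v"
  shows "A = B"
proof (rule eq_matI)
  fix i j assume "i < dim_row B" "j < dim_col B"
  then have ij: "i < n" "j < n" using assms by auto
  have sym: "A $$ (j, i) = A $$ (i, j)" "B $$ (j, i) = B $$ (i, j)"
    using assms ij by (metis carrier_matD index_transpose_mat(1))+
  have "2 * A $$ (i, j) = qf_eval A (unit_vec n i + unit_vec n j)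
      - qf_eval A (unit_vec n i) - qf_eval A (unit_vec n j)"
    using ij by (simp add: qf_eval_add[OF assms(2)] unit_vec_form[OF assms(2)] sym)
  also have "\<dots> = 2 * B $$ (i, j)"
    using ij by (simp add: eq, simp add: qf_eval_add[OF assms(3)] unit_vec_form[OF assms(3)] sym)
  finally show "A $$ (i, j) = B $$ (i, j)" using assms(1) by simp
qed (use assms in auto)

lemma form_carrier: "is_form A \<Longrightarrow> A \<in> carrier_mat (dim_row A) (dim_row A)"
  by (auto simp: is_form_def)

text \<open>Regularity is certified by an inverse Gram matrix, because inverses are easy to
  transport through tensor products, orthogonal sums, scaling and field homomorphisms.\<close>

lemma is_formI:
  assumes "A \<in> carrier_mat n n" "transpose_mat A = A" "B \<in> carrier_mat n n" "A * B = 1\<^sub>m n"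
  shows "is_form A"
proof -
  have BA: "B * A = 1\<^sub>m n" by (rule mat_mult_left_right_inverse[OF assms(1,3,4)])
  have "v = 0\<^sub>v n"
    if v: "v \<in> carrier_vec n" and z: "\<forall>w \<in> carrier_vec n. w \<bullet> (A *\<^sub>v v) = 0" for v
  proof -
    have "A *\<^sub>v v = 0\<^sub>v n"
    proof (rule eq_vecI)
      fix i assume "i < dim_vec (0\<^sub>v n :: 'a vec)"
      then have i: "i < n" by simp
      then have "(A *\<^sub>v v) $ i = unit_vec n i \<bullet> (A *\<^sub>v v)"
        using assms v by (subst scalar_prod_left_unit) auto
      then show "(A *\<^sub>v v) $ i = 0\<^sub>v n $ i" using z i by simp
    qed (use assms in auto)
    then have "(B * A) *\<^sub>v v = 0\<^sub>v n"
      using assms v by (subst assoc_mult_mat_vec[of _ n n _ n]) auto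
    then show ?thesis using v by (simp add: BA)
  qed
  then show ?thesis using assms unfolding is_form_def by auto
qed

lemma form_inverse:
  assumes "is_form A"
  obtains B where "B \<in> carrier_mat (dim_row A) (dim_row A)" "A * B = 1\<^sub>m (dim_row A)"
    "B * A = 1\<^sub>m (dim_row A)"
proof -
  let ?n = "dim_row A"
  have A: "A \<in> carrier_mat ?n ?n" using assms by (rule form_carrier)
  have "det A \<noteq> 0"
  proof
    assume "det A = 0"
    then obtain v where v: "v \<in> carrier_vec ?n" "v \<noteq> 0\<^sub>v ?n" "A *\<^sub>v v = 0\<^sub>v ?n"
      using det_0_iff_vec_prod_zero[OF A] by auto
    then show False using assms unfolding is_form_def by auto
  qed
  then show ?thesis
    using det_non_zero_imp_unit[OF A, of "()"] that
    by (auto simp: Units_def ring_mat_simps)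
qed

lemma congruence_symmetric:
  fixes C P :: "'a::field mat"
  assumes C: "C \<in> carrier_mat n n" and P: "P \<in> carrier_mat n m" and "transpose_mat C = C"
  shows "transpose_mat (transpose_mat P * (C * P)) = transpose_mat P * (C * P)"
proof -
  have "transpose_mat (transpose_mat P * (C * P)) = transpose_mat (C * P) * P"
    using C P by (subst transpose_mult) auto
  also have "transpose_mat (C * P) = transpose_mat P * C"
    using assms by (subst transpose_mult) auto
  finally show ?thesis using C P by (simp add: assoc_mult_mat[of _ m n _ n _ m])
qed

lemma isometric_embeds:
  fixes A B :: "'a::field mat"
  assumes "(2::'a) \<noteq> 0" "is_form A" "is_form B" "isometric A B"
  shows "embeds A B" "embeds B A"
proof -
  let ?n = "dim_row A"
  have n: "dim_row B = ?n" using assms by (simp add: isometric_def)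
  have A: "A \<in> carrier_mat ?n ?n" by (rule form_carrier[OF assms(2)])
  have B: "B \<in> carrier_mat ?n ?n" using form_carrier[OF assms(3)] unfolding n .
  obtain P where P: "P \<in> carrier_mat ?n ?n" "invertible_mat P"
    and PA: "\<forall>v \<in> carrier_vec ?n. qf_eval B (P *\<^sub>v v) = qf_eval A v"
    using assms by (auto simp: isometric_def)
  have BT: "transpose_mat B = B" and AT: "transpose_mat A = A"
    using assms by (auto simp: is_form_def)
  have PBP: "transpose_mat P * (B * P) = A"
  proof (rule symmetric_mat_eqI[OF assms(1) _ A congruence_symmetric[OF B P(1) BT] AT])
    show "transpose_mat P * (B * P) \<in> carrier_mat ?n ?n"
      using P(1) B by (intro mult_carrier_mat) auto
    show "qf_eval (transpose_mat P * (B * P)) v = qf_eval A v" if "v \<in> carrier_vec ?n" for v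
      using that PA qf_eval_transform[OF P(1) B that] by metis
  qed
  then show "embeds A B" by (rule embedsI[OF P(1) A B])
  \<comment> \<open>\<open>invertible_mat\<close> leaves the shape of the inverse open; its
    dimensions are read off from the two identity matrices.\<close>
  obtain Q where Q: "Q \<in> carrier_mat ?n ?n" "P * Q = 1\<^sub>m ?n" "Q * P = 1\<^sub>m ?n"
  proof -
    from P obtain Q where Q: "P * Q = 1\<^sub>m ?n" "Q * P = 1\<^sub>m (dim_row Q)"
      by (auto simp: invertible_mat_def inverts_mat_def)
    have "dim_row Q = ?n" using arg_cong[OF Q(2), of dim_col] P(1) by simp
    moreover have "dim_col Q = ?n" using arg_cong[OF Q(1), of dim_col] by simp
    ultimately have "Q \<in> carrier_mat ?n ?n" unfolding carrier_mat_def by blast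
    moreover have "Q * P = 1\<^sub>m ?n" unfolding Q(2) \<open>dim_row Q = ?n\<close> ..
    ultimately show ?thesis using Q(1) that by blast
  qed
  have "transpose_mat Q * (A * Q) = transpose_mat (P * Q) * (B * (P * Q))"
    unfolding congruence_mult[OF B P(1) Q(1)] PBP ..
  also have "\<dots> = B" unfolding Q(2) using B by simp
  finally have "transpose_mat Q * (A * Q) = B" .
  then show "embeds B A" by (rule embedsI[OF Q(1) B A])
qed

lemma embeds_isometric:
  fixes A B :: "'a::field mat"
  assumes "is_form A" "is_form B" "embeds A B" "dim_row A = dim_row B"
  shows "isometric A B"
proof -
  let ?n = "dim_row A"
  have A: "A \<in> carrier_mat ?n ?n" by (rule form_carrier[OF assms(1)])
  have B: "B \<in> carrier_mat ?n ?n" using form_carrier[OF assms(2)] unfolding assms(4) .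
  obtain P where P: "P \<in> carrier_mat ?n ?n" "transpose_mat P * (B * P) = A"
    by (rule embedsE[OF assms(3) A B])
  obtain A' where A': "A' \<in> carrier_mat ?n ?n" "A' * A = 1\<^sub>m ?n"
    using form_inverse[OF assms(1)] by metis
  \<comment> \<open>Since \<open>P\<^sup>T B P = A\<close>, multiplying on the left by the inverse
    of \<open>A\<close> exhibits a left inverse of \<open>P\<close>; for a square matrix it is
    two-sided.\<close>
  let ?Q = "A' * transpose_mat P * B"
  have Q: "?Q \<in> carrier_mat ?n ?n" using A' P B by auto
  have "?Q * P = A' * (transpose_mat P * (B * P))"
    using A' P B by (simp add: assoc_mult_mat[of _ ?n ?n _ ?n _ ?n])
  then have QP: "?Q * P = 1\<^sub>m ?n" by (simp add: P A')
  then have "P * ?Q = 1\<^sub>m ?n" by (rule mat_mult_left_right_inverse[OF Q P(1)])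
  with QP have "invertible_mat P" unfolding invertible_mat_def inverts_mat_def
    using P(1) carrier_matD(1)[OF Q] by (intro conjI exI[of _ ?Q]) (auto simp del: index_mult_mat)
  moreover have "qf_eval B (P *\<^sub>v v) = qf_eval A v" if "v \<in> carrier_vec ?n" for v
    unfolding qf_eval_transform[OF P(1) B that] P(2) ..
  ultimately show ?thesis unfolding isometric_def using P(1) assms(4) by blast
qed

section \<open>Diagonal forms and Kronecker products\<close>

lemma mk_diagonal_carrier [simp]: "mk_diagonal xs \<in> carrier_mat (length xs) (length xs)"
  by (auto simp: mk_diagonal_dim)

lemma mk_diagonal_append:
  "mk_diagonal (xs @ ys) = orth_sum (mk_diagonal xs) (mk_diagonal ys)"
  by (subst orth_sum_altdef[OF mk_diagonal_carrier mk_diagonal_carrier])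
     (simp add: mk_diagonal_def diag_block_mat_append Let_def mk_diagonal_dim[unfolded mk_diagonal_def])

lemma mk_diagonal_index:
  fixes xs :: "'a::field list"
  shows "i < length xs \<Longrightarrow> j < length xs \<Longrightarrow> mk_diagonal xs $$ (i, j) = (if i = j then xs ! i else 0)"
proof (induction xs arbitrary: i j)
  case (Cons x xs)
  have x: "mk_diagonal [x] \<in> carrier_mat 1 1" using mk_diagonal_carrier[of "[x]"] by simp
  have x': "mk_diagonal [x] $$ (0, 0) = x" by (simp add: mk_diagonal_def)
  have "mk_diagonal (x # xs) = orth_sum (mk_diagonal [x]) (mk_diagonal xs)"
    using mk_diagonal_append[of "[x]" xs] by simp
  also have "\<dots> = four_block_mat (mk_diagonal [x]) (0\<^sub>m 1 (length xs)) (0\<^sub>m (length xs) 1) (mk_diagonal xs)"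
    by (rule orth_sum_altdef[OF x mk_diagonal_carrier])
  finally show ?case using Cons x x'
    by (cases i; cases j) (auto simp: mk_diagonal_dim)
qed simp

lemma mk_diagonal_eqI:
  fixes xs :: "'a::field list"
  assumes "A \<in> carrier_mat (length xs) (length xs)"
    and "\<And>i j. i < length xs \<Longrightarrow> j < length xs \<Longrightarrow> A $$ (i, j) = (if i = j then xs ! i else 0)"
  shows "A = mk_diagonal xs"
  using assms by (intro eq_matI) (auto simp: mk_diagonal_dim mk_diagonal_index)

lemma mk_diagonal_mult_index:
  fixes P :: "'a::field mat"
  assumes "P \<in> carrier_mat (length ys) m" "k < length ys" "j < m"
  shows "(mk_diagonal ys * P) $$ (k, j) = ys ! k * P $$ (k, j)"
proof -
  have "(mk_diagonal ys * P) $$ (k, j) = (\<Sum>i = 0..<length ys. mk_diagonal ys $$ (k, i) * P $$ (i, j))"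
    using assms by (simp add: scalar_prod_def mk_diagonal_dim)
  also have "\<dots> = (\<Sum>i = 0..<length ys. if i = k then ys ! k * P $$ (k, j) else 0)"
    using assms by (intro sum.cong) (auto simp: mk_diagonal_index)
  finally show ?thesis using assms by simp
qed

lemma congruence_diagonal_index:
  fixes P :: "'a::field mat"
  assumes "P \<in> carrier_mat (length ys) m" "i < m" "j < m"
  shows "(transpose_mat P * (mk_diagonal ys * P)) $$ (i, j) =
    (\<Sum>k<length ys. ys ! k * (P $$ (k, i) * P $$ (k, j)))"
proof -
  have "(transpose_mat P * (mk_diagonal ys * P)) $$ (i, j) =
      (\<Sum>k = 0..<length ys. P $$ (k, i) * (mk_diagonal ys * P) $$ (k, j))"
    using assms by (simp add: scalar_prod_def mk_diagonal_dim)
  also have "\<dots> = (\<Sum>k<length ys. ys ! k * (P $$ (k, i) * P $$ (k, j)))"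
    unfolding atLeast0LessThan
    using assms mk_diagonal_mult_index[OF assms(1)] by (intro sum.cong) (auto simp: ac_simps simp del: index_mult_mat)
  finally show ?thesis .
qed

lemma qf_eval_diagonal:
  fixes v :: "'a::field vec"
  assumes "v \<in> carrier_vec (length xs)"
  shows "qf_eval (mk_diagonal xs) v = (\<Sum>i<length xs. xs ! i * (v $ i)\<^sup>2)"
proof -
  have *: "(mk_diagonal xs *\<^sub>v v) $ i = xs ! i * v $ i" if "i < length xs" for i
  proof -
    have "(mk_diagonal xs *\<^sub>v v) $ i = (\<Sum>j = 0..<length xs. mk_diagonal xs $$ (i, j) * v $ j)"
      using assms that by (simp add: scalar_prod_def mk_diagonal_dim)
    also have "\<dots> = (\<Sum>j = 0..<length xs. if j = i then xs ! i * v $ i else 0)"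
      using that by (intro sum.cong) (auto simp: mk_diagonal_index)
    finally show ?thesis using that by simp
  qed
  have "qf_eval (mk_diagonal xs) v = (\<Sum>i<length xs. v $ i * (mk_diagonal xs *\<^sub>v v) $ i)"
    unfolding qf_eval_def scalar_prod_def by (simp add: mk_diagonal_dim atLeast0LessThan)
  also have "\<dots> = (\<Sum>i<length xs. xs ! i * (v $ i)\<^sup>2)"
    using * by (intro sum.cong) (auto simp: power2_eq_square simp del: index_mult_mat_vec)
  finally show ?thesis .
qed

lemma smult_mk_diagonal: "c \<cdot>\<^sub>m mk_diagonal xs = mk_diagonal (map ((*) (c::'a::field)) xs)"
  by (rule mk_diagonal_eqI) (auto simp: mk_diagonal_dim mk_diagonal_index)

lemma transpose_mk_diagonal:
  "transpose_mat (mk_diagonal xs) = mk_diagonal (xs :: 'a::field list)"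
  by (rule mk_diagonal_eqI) (auto simp: mk_diagonal_dim mk_diagonal_index)

lemma is_form_mk_diagonal:
  fixes xs :: "'a::field list"
  assumes "0 \<notin> set xs"
  shows "is_form (mk_diagonal xs)"
proof (rule is_formI[OF mk_diagonal_carrier transpose_mk_diagonal])
  show B: "mk_diagonal (map inverse xs) \<in> carrier_mat (length xs) (length xs)"
    using mk_diagonal_carrier[of "map inverse xs"] by simp
  show "mk_diagonal xs * mk_diagonal (map inverse xs) = 1\<^sub>m (length xs)"
  proof (rule eq_matI)
    fix i j assume "i < dim_row (1\<^sub>m (length xs) :: 'a mat)" "j < dim_col (1\<^sub>m (length xs) :: 'a mat)"
    then have ij: "i < length xs" "j < length xs" by auto
    then have "xs ! i \<noteq> 0" using assms by (metis nth_mem)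
    then show "(mk_diagonal xs * mk_diagonal (map inverse xs)) $$ (i, j) = 1\<^sub>m (length xs) $$ (i, j)"
      using ij by (subst mk_diagonal_mult_index[OF B]) (auto simp: mk_diagonal_index)
  qed (auto simp: mk_diagonal_dim)
qed

text \<open>The basis vector with index i is sent to the basis vector with index
  \<open>f i\<close>.\<close>

lemma embeds_diagonal_inj:
  fixes xs ys :: "'a::field list"
  assumes "inj_on f {..<length xs}" "\<And>i. i < length xs \<Longrightarrow> f i < length ys"
    and "\<And>i. i < length xs \<Longrightarrow> xs ! i = ys ! f i"
  shows "embeds (mk_diagonal xs) (mk_diagonal ys)"
proof -
  let ?P = "mat (length ys) (length xs) (\<lambda>(k, i). if k = f i then 1 else 0 :: 'a)"
  have "transpose_mat ?P * (mk_diagonal ys * ?P) = mk_diagonal xs"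
  proof (rule mk_diagonal_eqI)
    fix i j assume ij: "i < length xs" "j < length xs"
    have "(transpose_mat ?P * (mk_diagonal ys * ?P)) $$ (i, j) =
        (\<Sum>k<length ys. ys ! k * (?P $$ (k, i) * ?P $$ (k, j)))"
      using ij by (intro congruence_diagonal_index) auto
    also have "\<dots> = (\<Sum>k<length ys. if k = f i then (if f i = f j then ys ! f i else 0) else 0)"
      using ij by (intro sum.cong) auto
    also have "\<dots> = (if i = j then xs ! i else 0)"
      using assms ij by (auto simp: inj_on_def)
    finally show "(transpose_mat ?P * (mk_diagonal ys * ?P)) $$ (i, j) = (if i = j then xs ! i else 0)" .
  qed (auto simp: mk_diagonal_dim)
  then show ?thesis by (intro embedsI[of ?P "length ys" "length xs"]) auto
qed

text \<open>Permuting and omitting diagonal entries is thereby reduced to an inclusion of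
  multisets.\<close>

lemma embeds_diagonal_mset:
  fixes xs ys :: "'a::field list"
  assumes "mset xs \<subseteq># mset ys"
  shows "embeds (mk_diagonal xs) (mk_diagonal ys)"
proof -
  obtain zs where "mset ys = mset xs + mset zs"
    using assms by (metis ex_mset subset_mset.add_diff_inverse)
  then have "mset (xs @ zs) = mset ys" by simp
  then obtain p where p: "p permutes {..<length ys}" "permute_list p ys = xs @ zs"
    by (rule mset_eq_permutation)
  have l: "length ys = length xs + length zs" using p(2) by (metis length_append length_permute_list)
  show ?thesis
  proof (rule embeds_diagonal_inj)
    show "inj_on p {..<length xs}" using p(1) by (meson permutes_inj_on)
    fix i assume i: "i < length xs"
    show "p i < length ys" using p(1) i l permutes_in_image[OF p(1), of i] by auto
    show "xs ! i = ys ! p i"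
      using permute_list_nth[OF p(1), of i] p(2) i l by (simp add: nth_append)
  qed
qed

section \<open>Kronecker products\<close>

lemma sum_div_mod:
  fixes f :: "nat \<Rightarrow> nat \<Rightarrow> 'a::comm_monoid_add"
  shows "(\<Sum>k<n * m. f (k div m) (k mod m)) = (\<Sum>a<n. \<Sum>b<m. f a b)"
proof -
  have "(\<Sum>k<n * m. f (k div m) (k mod m)) =
      (\<Sum>a<n. \<Sum>k\<in>{a * m..<a * m + m}. f (k div m) (k mod m))"
    by (rule sum.nat_group[symmetric])
  also have "\<dots> = (\<Sum>a<n. \<Sum>b<m. f a b)"
  proof (rule sum.cong[OF refl])
    fix a
    have "k div m = a" "k mod m = k - a * m" if "k \<in> {a * m..<a * m + m}" for k
    proof -
      have "k = a * m + (k - a * m)" "k - a * m < m" using that by auto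
      then obtain b where "k = a * m + b" "b < m" by blast
      then show "k div m = a" "k mod m = k - a * m" by auto
    qed
    then show "(\<Sum>k\<in>{a * m..<a * m + m}. f (k div m) (k mod m)) = (\<Sum>b<m. f a b)"
      by (intro sum.reindex_bij_witness[of _ "\<lambda>b. a * m + b" "\<lambda>k. k - a * m"]) auto
  qed
  finally show ?thesis .
qed

lemma tensor_form_carrier [simp]:
  "A \<in> carrier_mat m n \<Longrightarrow> B \<in> carrier_mat m' n' \<Longrightarrow> tensor_form A B \<in> carrier_mat (m * m') (n * n')"
  by (auto simp: tensor_form_def)

lemma tensor_form_dim [simp]:
  "dim_row (tensor_form A B) = dim_row A * dim_row B"
  "dim_col (tensor_form A B) = dim_col A * dim_col B"
  by (auto simp: tensor_form_def)

lemma div_mod_less: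
  fixes i m n :: nat
  assumes "i < m * n"
  shows "i div n < m" "i mod n < n"
  using assms by (auto simp: less_mult_imp_div_less intro!: mod_less_divisor)
    (metis mult_0_right not_less_zero gr0I)

lemma div_mod_eqI:
  fixes i j n :: nat
  shows "i div n = j div n \<Longrightarrow> i mod n = j mod n \<Longrightarrow> i = j"
  by (metis div_mult_mod_eq)

text \<open>The mixed product rule. It makes tensoring compatible with congruence and with inverses,
  hence with \<open>embeds\<close> and \<open>is_form\<close>.\<close>

lemma tensor_form_mult:
  fixes A B C D :: "'a::field mat"
  assumes "A \<in> carrier_mat m n" "C \<in> carrier_mat n p" "B \<in> carrier_mat m' n'" "D \<in> carrier_mat n' p'"
  shows "tensor_form A B * tensor_form C D = tensor_form (A * C) (B * D)"
proof (rule eq_matI)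
  fix i j assume "i < dim_row (tensor_form (A * C) (B * D))" "j < dim_col (tensor_form (A * C) (B * D))"
  then have ij: "i < m * m'" "j < p * p'" using assms by auto
  note [simp] = div_mod_less[OF ij(1)] div_mod_less[OF ij(2)]
  have "(tensor_form A B * tensor_form C D) $$ (i, j) =
      (\<Sum>k<n * n'. tensor_form A B $$ (i, k) * tensor_form C D $$ (k, j))"
    using assms ij by (simp add: scalar_prod_def atLeast0LessThan)
  also have "\<dots> = (\<Sum>k<n * n'. (A $$ (i div m', k div n') * C $$ (k div n', j div p')) *
      (B $$ (i mod m', k mod n') * D $$ (k mod n', j mod p')))"
    using assms ij by (intro sum.cong) (auto simp: tensor_form_def)
  also have "\<dots> = (\<Sum>a<n. \<Sum>b<n'. (A $$ (i div m', a) * C $$ (a, j div p')) *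
      (B $$ (i mod m', b) * D $$ (b, j mod p')))"
    by (rule sum_div_mod)
  also have "\<dots> = (A * C) $$ (i div m', j div p') * (B * D) $$ (i mod m', j mod p')"
    using assms ij by (simp add: scalar_prod_def atLeast0LessThan sum_product)
  also have "\<dots> = tensor_form (A * C) (B * D) $$ (i, j)"
    using assms ij by (simp add: tensor_form_def)
  finally show "(tensor_form A B * tensor_form C D) $$ (i, j) = tensor_form (A * C) (B * D) $$ (i, j)" .
qed (use assms in auto)

lemma transpose_tensor_form:
  "transpose_mat (tensor_form A B) = tensor_form (transpose_mat A) (transpose_mat B)"
  by (rule eq_matI) (auto simp: tensor_form_def div_mod_less)

lemma tensor_form_one: "tensor_form (1\<^sub>m m) (1\<^sub>m n) = (1\<^sub>m (m * n) :: 'a::field mat)"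
proof (rule eq_matI)
  fix i j assume "i < dim_row (1\<^sub>m (m * n) :: 'a mat)" "j < dim_col (1\<^sub>m (m * n) :: 'a mat)"
  then have ij: "i < m * n" "j < m * n" by auto
  then show "tensor_form (1\<^sub>m m) (1\<^sub>m n) $$ (i, j) = (1\<^sub>m (m * n) :: 'a mat) $$ (i, j)"
    using div_mod_less[OF ij(1)] div_mod_less[OF ij(2)]
    by (auto simp: tensor_form_def dest: div_mod_eqI)
qed auto

lemma embeds_tensor_form:
  assumes "embeds A A'" "embeds B B'" "A \<in> carrier_mat m m" "B \<in> carrier_mat n n"
    and "A' \<in> carrier_mat m' m'" "B' \<in> carrier_mat n' n'"
  shows "embeds (tensor_form A B) (tensor_form A' B')"
proof -
  obtain P where P: "P \<in> carrier_mat m' m" "transpose_mat P * (A' * P) = A"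
    by (rule embedsE[OF assms(1,3,5)])
  obtain Q where Q: "Q \<in> carrier_mat n' n" "transpose_mat Q * (B' * Q) = B"
    by (rule embedsE[OF assms(2,4,6)])
  have "tensor_form A' B' * tensor_form P Q = tensor_form (A' * P) (B' * Q)"
    by (rule tensor_form_mult[OF assms(5) P(1) assms(6) Q(1)])
  moreover have "transpose_mat (tensor_form P Q) * tensor_form (A' * P) (B' * Q) = tensor_form A B"
    unfolding transpose_tensor_form using P Q assms(5,6)
    by (subst tensor_form_mult[of _ m m' _ m _ n n' _ n]) auto
  ultimately have "transpose_mat (tensor_form P Q) * (tensor_form A' B' * tensor_form P Q)
      = tensor_form A B" by (simp only:)
  then show ?thesis using P(1) Q(1) assms(3-6)
    by (intro embedsI[of "tensor_form P Q" "m' * n'" "m * n"]) auto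
qed

lemma is_form_tensor_form:
  assumes "is_form A" "is_form B"
  shows "is_form (tensor_form A B)"
proof -
  let ?m = "dim_row A" let ?n = "dim_row B"
  obtain A' where A': "A' \<in> carrier_mat ?m ?m" "A * A' = 1\<^sub>m ?m"
    by (rule form_inverse[OF assms(1)])
  obtain B' where B': "B' \<in> carrier_mat ?n ?n" "B * B' = 1\<^sub>m ?n"
    by (rule form_inverse[OF assms(2)])
  note A = form_carrier[OF assms(1)] and B = form_carrier[OF assms(2)]
  show ?thesis
  proof (rule is_formI)
    show "tensor_form A B \<in> carrier_mat (?m * ?n) (?m * ?n)" by (rule tensor_form_carrier[OF A B])
    show "tensor_form A' B' \<in> carrier_mat (?m * ?n) (?m * ?n)"
      by (rule tensor_form_carrier[OF A'(1) B'(1)])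
    show "transpose_mat (tensor_form A B) = tensor_form A B"
      using assms by (simp add: transpose_tensor_form is_form_def)
    show "tensor_form A B * tensor_form A' B' = 1\<^sub>m (?m * ?n)"
      unfolding tensor_form_mult[OF A A'(1) B B'(1)] A'(2) B'(2) tensor_form_one ..
  qed
qed

lemma tensor_form_smult:
  "tensor_form (c \<cdot>\<^sub>m A) B = (c::'a::field) \<cdot>\<^sub>m tensor_form A B"
  by (rule eq_matI) (auto simp: tensor_form_def div_mod_less)

definition products :: "'a::times list \<Rightarrow> 'a list \<Rightarrow> 'a list" where
  "products xs ys = concat (map (\<lambda>x. map ((*) x) ys) xs)"

lemma products_simps [simp]:
  "products [] ys = []" "products (x # xs) ys = map ((*) x) ys @ products xs ys"
  by (simp_all add: products_def)

lemma products_append: "products (xs @ ys) zs = products xs zs @ products ys zs"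
  by (simp add: products_def)

lemma length_products [simp]: "length (products xs ys) = length xs * length ys"
  by (induction xs) auto

lemma nth_products:
  "i < length xs * length ys \<Longrightarrow>
   products xs ys ! i = xs ! (i div length ys) * ys ! (i mod length ys)"
proof (induction xs arbitrary: i)
  case (Cons x xs)
  show ?case
  proof (cases "i < length ys")
    case False
    then obtain k where k: "i = length ys + k" using le_Suc_ex not_less by metis
    have "0 < length ys" using Cons.prems by (auto intro: Nat.gr0I)
    then show ?thesis using Cons.IH[of k] Cons.prems k by (auto simp: nth_append)
  qed (auto simp: nth_append)
qed simp

lemma tensor_form_diagonal:
  fixes xs ys :: "'a::field list"
  shows "tensor_form (mk_diagonal xs) (mk_diagonal ys) = mk_diagonal (products xs ys)"
proof (rule mk_diagonal_eqI)
  show "tensor_form (mk_diagonal xs) (mk_diagonal ys) \<in>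
      carrier_mat (length (products xs ys)) (length (products xs ys))"
    using tensor_form_carrier[OF mk_diagonal_carrier[of xs] mk_diagonal_carrier[of ys]] by simp
  fix i j assume ij: "i < length (products xs ys)" "j < length (products xs ys)"
  then have ij: "i < length xs * length ys" "j < length xs * length ys" by auto
  show "tensor_form (mk_diagonal xs) (mk_diagonal ys) $$ (i, j) =
      (if i = j then products xs ys ! i else 0)"
    using ij div_mod_less[OF ij(1)] div_mod_less[OF ij(2)]
    by (auto simp: tensor_form_def mk_diagonal_dim mk_diagonal_index nth_products dest: div_mod_eqI)
qed

section \<open>Subforms of anisotropic forms\<close>

text \<open>A wide matrix becomes square and singular when padded with zero rows. All dimension
  arguments below rest on this.\<close>

lemma exists_kernel_vec:
  fixes U :: "'a::field mat"
  assumes U: "U \<in> carrier_mat k m" and "k < m"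
  obtains v where "v \<in> carrier_vec m" "v \<noteq> 0\<^sub>v m" "U *\<^sub>v v = 0\<^sub>v k"
proof -
  let ?A = "mat m m (\<lambda>(i, j). if i < k then U $$ (i, j) else 0)"
  have A: "?A \<in> carrier_mat m m" by simp
  have "det ?A = 0"
  proof (rule ccontr)
    assume "det ?A \<noteq> 0"
    then obtain B where B: "B \<in> carrier_mat m m" "?A * B = 1\<^sub>m m"
      using det_non_zero_imp_unit[OF A, of "()"] by (auto simp: Units_def ring_mat_simps)
    \<comment> \<open>Row k is the first row of the padding, so a product with it cannot have the
      diagonal entry 1.\<close>
    have "(?A * B) $$ (k, k) = 0"
      using B(1) \<open>k < m\<close> by (simp add: scalar_prod_def)
    then show False using B(2) \<open>k < m\<close> by simp
  qed
  then obtain v where v: "v \<in> carrier_vec m" "v \<noteq> 0\<^sub>v m" "?A *\<^sub>v v = 0\<^sub>v m"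
    using det_0_iff_vec_prod_zero[OF A] by blast
  have "U *\<^sub>v v = 0\<^sub>v k"
  proof (rule eq_vecI)
    fix i assume "i < dim_vec (0\<^sub>v k :: 'a vec)"
    then have i: "i < k" by simp
    have "row U i = row ?A i" using U i \<open>k < m\<close> by (intro eq_vecI) auto
    then have "(U *\<^sub>v v) $ i = (?A *\<^sub>v v) $ i" using U i \<open>k < m\<close> by simp
    then show "(U *\<^sub>v v) $ i = 0\<^sub>v k $ i" using v(3) i \<open>k < m\<close> by simp
  qed (use U in auto)
  then show ?thesis using v that by blast
qed

lemma anisotropicD:
  "anisotropic A \<Longrightarrow> A \<in> carrier_mat n n \<Longrightarrow> v \<in> carrier_vec n \<Longrightarrow> qf_eval A v = 0 \<Longrightarrow> v = 0\<^sub>v n"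
  by (auto simp: anisotropic_def)

lemma congruence_kernel:
  fixes B P :: "'a::field mat"
  assumes "P \<in> carrier_mat n m" "B \<in> carrier_mat n n" "v \<in> carrier_vec m" "P *\<^sub>v v = 0\<^sub>v n"
  shows "(transpose_mat P * (B * P)) *\<^sub>v v = 0\<^sub>v m"
proof -
  have T: "transpose_mat P \<in> carrier_mat m n" using assms(1) by simp
  have "(transpose_mat P * (B * P)) *\<^sub>v v = transpose_mat P *\<^sub>v ((B * P) *\<^sub>v v)"
    by (rule assoc_mult_mat_vec[OF T mult_carrier_mat[OF assms(2,1)] assms(3)])
  also have "(B * P) *\<^sub>v v = B *\<^sub>v (P *\<^sub>v v)" by (rule assoc_mult_mat_vec[OF assms(2,1,3)])
  also have "B *\<^sub>v (P *\<^sub>v v) = 0\<^sub>v n" unfolding assms(4) using assms(2) by (intro eq_vecI) auto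
  also have "transpose_mat P *\<^sub>v 0\<^sub>v n = 0\<^sub>v m" using T by (intro eq_vecI) auto
  finally show ?thesis .
qed

text \<open>A vector in the kernel of the embedding lies in the radical of \<open>A\<close>, which
  is trivial.\<close>

lemma embeds_dim_le:
  assumes "is_form A" "embeds A B" "B \<in> carrier_mat n n"
  shows "dim_row A \<le> n"
proof (rule ccontr)
  let ?m = "dim_row A"
  assume "\<not> ?m \<le> n"
  obtain P where P: "P \<in> carrier_mat n ?m" "transpose_mat P * (B * P) = A"
    by (rule embedsE[OF assms(2) form_carrier[OF assms(1)] assms(3)])
  obtain v where v: "v \<in> carrier_vec ?m" "v \<noteq> 0\<^sub>v ?m" "P *\<^sub>v v = 0\<^sub>v n"
    using exists_kernel_vec[OF P(1)] \<open>\<not> ?m \<le> n\<close> by (metis not_le)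
  have "A *\<^sub>v v = 0\<^sub>v ?m"
    using congruence_kernel[OF P(1) assms(3) v(1) v(3)] unfolding P(2) .
  then have "\<forall>u \<in> carrier_vec ?m. u \<bullet> (A *\<^sub>v v) = 0" by simp
  then show False using assms(1) v(1,2) unfolding is_form_def by blast
qed

text \<open>An isotropic vector of \<open>A\<close> is mapped to an isotropic vector of
  \<open>B\<close>, hence to zero, so it lies in the radical of \<open>A\<close>.\<close>

lemma anisotropic_embeds:
  assumes "anisotropic B" "embeds A B" "is_form A" "B \<in> carrier_mat n n"
  shows "anisotropic A"
  unfolding anisotropic_def
proof (intro ballI impI)
  let ?m = "dim_row A"
  fix v assume v: "v \<in> carrier_vec ?m" "qf_eval A v = 0"
  obtain P where P: "P \<in> carrier_mat n ?m" "transpose_mat P * (B * P) = A"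
    by (rule embedsE[OF assms(2) form_carrier[OF assms(3)] assms(4)])
  have "qf_eval B (P *\<^sub>v v) = 0"
    using v(2) qf_eval_transform[OF P(1) assms(4) v(1)] P(2) by simp
  then have Pv: "P *\<^sub>v v = 0\<^sub>v n" using anisotropicD[OF assms(1,4)] P(1) v(1) by simp
  have "A *\<^sub>v v = 0\<^sub>v ?m"
    using congruence_kernel[OF P(1) assms(4) v(1) Pv] unfolding P(2) .
  then have "\<forall>u \<in> carrier_vec ?m. u \<bullet> (A *\<^sub>v v) = 0" by simp
  then show "v = 0\<^sub>v ?m" using assms(3) v(1) unfolding is_form_def by blast
qed

lemma anisotropic_smult:
  assumes "anisotropic A" "A \<in> carrier_mat n n" "c \<noteq> 0"
  shows "anisotropic (c \<cdot>\<^sub>m A)"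
  unfolding anisotropic_def
proof (intro ballI impI)
  fix v assume v: "v \<in> carrier_vec (dim_row (c \<cdot>\<^sub>m A))" "qf_eval (c \<cdot>\<^sub>m A) v = 0"
  have vn: "v \<in> carrier_vec n" using v(1) assms(2) by simp
  have "(c \<cdot>\<^sub>m A) *\<^sub>v v = c \<cdot>\<^sub>v (A *\<^sub>v v)"
    using assms(2) vn by (intro eq_vecI) (auto simp: scalar_prod_def sum_distrib_left mult.assoc)
  then have "qf_eval (c \<cdot>\<^sub>m A) v = c * qf_eval A v"
    using assms(2) vn by (simp add: qf_eval_def)
  then show "v = 0\<^sub>v (dim_row (c \<cdot>\<^sub>m A))"
    using v(2) assms anisotropicD[OF assms(1,2) vn] by simp
qed

lemma is_form_smult:
  fixes A :: "'a::field mat"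
  assumes "is_form A" "c \<noteq> 0"
  shows "is_form (c \<cdot>\<^sub>m A)"
proof -
  obtain n where A: "A \<in> carrier_mat n n" using form_carrier[OF assms(1)] by blast
  obtain B where B: "B \<in> carrier_mat n n" "A * B = 1\<^sub>m n"
    by (rule form_inverse[OF assms(1)]) (use A in auto)
  have "transpose_mat (c \<cdot>\<^sub>m A) = c \<cdot>\<^sub>m transpose_mat A" using A by (intro eq_matI) auto
  moreover have "(c \<cdot>\<^sub>m A) * (inverse c \<cdot>\<^sub>m B) = c \<cdot>\<^sub>m (inverse c \<cdot>\<^sub>m 1\<^sub>m n)"
    using mult_smult_assoc_mat[OF A, of "inverse c \<cdot>\<^sub>m B" n c] mult_smult_distrib[OF A B(1)] B by simp
  moreover have "c \<cdot>\<^sub>m (inverse c \<cdot>\<^sub>m 1\<^sub>m n) = 1\<^sub>m n"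
    using assms(2) by (intro eq_matI) auto
  ultimately show ?thesis using A B(1) assms(1)
    by (intro is_formI[of "c \<cdot>\<^sub>m A" n "inverse c \<cdot>\<^sub>m B"]) (auto simp: is_form_def)
qed

lemma is_form_orth_sum:
  fixes A B :: "'a::field mat"
  assumes "is_form A" "is_form B"
  shows "is_form (orth_sum A B)"
proof -
  obtain m n where A: "A \<in> carrier_mat m m" and B: "B \<in> carrier_mat n n"
    using form_carrier[OF assms(1)] form_carrier[OF assms(2)] by blast
  obtain A' where A': "A' \<in> carrier_mat m m" "A * A' = 1\<^sub>m m"
    by (rule form_inverse[OF assms(1)]) (use A in auto)
  obtain B' where B': "B' \<in> carrier_mat n n" "B * B' = 1\<^sub>m n"
    by (rule form_inverse[OF assms(2)]) (use B in auto)
  have "orth_sum A B * orth_sum A' B' = four_block_mat (1\<^sub>m m) (0\<^sub>m m n) (0\<^sub>m n m) (1\<^sub>m n)"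
    unfolding orth_sum_altdef[OF A B] orth_sum_altdef[OF A'(1) B'(1)]
    using A B A' B' by (subst mult_four_block_mat[of _ m m _ n _ n _ _ m _ n]) auto
  then have "orth_sum A B * orth_sum A' B' = 1\<^sub>m (m + n)" by simp
  moreover have "transpose_mat (orth_sum A B) = orth_sum A B"
    unfolding orth_sum_altdef[OF A B] using A B assms
    by (subst transpose_four_block_mat[of _ m m _ n _ n]) (auto simp: is_form_def)
  ultimately show ?thesis
    using is_formI[OF orth_sum_carrier[OF A B] _ orth_sum_carrier[OF A'(1) B'(1)]] by blast
qed

lemma congruence_index:
  fixes B P :: "'a::field mat"
  assumes "P \<in> carrier_mat n m" "B \<in> carrier_mat n n" "i < m" "j < m"
  shows "(transpose_mat P * (B * P)) $$ (i, j) = col P i \<bullet> (B *\<^sub>v col P j)"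
proof -
  have "col (B * P) j = B *\<^sub>v col P j" using assms by (intro eq_vecI) auto
  then show ?thesis using assms by simp
qed

text \<open>By dimension there is a nonzero vector \<open>w\<close> orthogonal to the image of
  \<open>p\<close>. Anisotropy makes its value nonzero, so \<open>w\<close> spans a regular line
  that can be added to the image.\<close>

lemma embeds_extend:
  fixes p q :: "'a::field mat"
  assumes q: "is_form q" "anisotropic q" and p: "is_form p" "embeds p q" "dim_row p < dim_row q"
  obtains a where "a \<noteq> 0" "embeds (orth_sum p (mk_diagonal [a])) q"
proof -
  obtain N m where qc: "q \<in> carrier_mat N N" and pc: "p \<in> carrier_mat m m"
    using form_carrier[OF q(1)] form_carrier[OF p(1)] by blast
  have mN: "m < N" using p(3) qc pc by simp
  have qT: "transpose_mat q = q" using q(1) by (simp add: is_form_def)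
  obtain P where P: "P \<in> carrier_mat N m" "transpose_mat P * (q * P) = p"
    by (rule embedsE[OF p(2) pc qc])
  have "transpose_mat P * q \<in> carrier_mat m N"
    by (rule mult_carrier_mat[OF _ qc]) (use P(1) in simp)
  then obtain w where w: "w \<in> carrier_vec N" "w \<noteq> 0\<^sub>v N" "(transpose_mat P * q) *\<^sub>v w = 0\<^sub>v m"
    by (rule exists_kernel_vec[OF _ mN])
  define a where "a = qf_eval q w"
  have "a \<noteq> 0" using anisotropicD[OF q(2) qc w(1)] w(2) a_def by auto
  have orth: "col P i \<bullet> (q *\<^sub>v w) = 0" if i: "i < m" for i
  proof -
    have "col P i \<bullet> (q *\<^sub>v w) = (transpose_mat P *\<^sub>v (q *\<^sub>v w)) $ i" using P(1) i by simp
    also have "transpose_mat P *\<^sub>v (q *\<^sub>v w) = (transpose_mat P * q) *\<^sub>v w"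
      by (rule assoc_mult_mat_vec[OF _ qc w(1), symmetric]) (use P(1) in simp)
    finally show ?thesis using w(3) i by simp
  qed
  have orth': "w \<bullet> (q *\<^sub>v col P i) = 0" if i: "i < m" for i
  proof -
    have c: "col P i \<in> carrier_vec N" using P(1) i by simp
    have "w \<bullet> (q *\<^sub>v col P i) = (q *\<^sub>v w) \<bullet> col P i"
      using transpose_vec_mult_scalar[OF qc c w(1)] qT by simp
    also have "\<dots> = col P i \<bullet> (q *\<^sub>v w)"
      by (rule comm_scalar_prod[OF mult_mat_vec_carrier[OF qc w(1)] c])
    finally show ?thesis using orth[OF i] by simp
  qed
  \<comment> \<open>The matrix of the embedding with \<open>w\<close> appended as last
    column.\<close>
  define R where "R = mat N (m + 1) (\<lambda>(i, j). if j < m then P $$ (i, j) else w $ i)"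
  have R: "R \<in> carrier_mat N (m + 1)" by (simp add: R_def)
  have colR: "col R j = (if j < m then col P j else w)" if "j < m + 1" for j
    using that P(1) w(1) by (intro eq_vecI) (auto simp: R_def)
  have ac: "mk_diagonal [a] \<in> carrier_mat 1 1" using mk_diagonal_carrier[of "[a]"] by simp
  have oc: "orth_sum p (mk_diagonal [a]) \<in> carrier_mat (m + 1) (m + 1)"
    by (rule orth_sum_carrier[OF pc ac])
  have "transpose_mat R * (q * R) = orth_sum p (mk_diagonal [a])"
  proof (rule eq_matI)
    fix i j assume "i < dim_row (orth_sum p (mk_diagonal [a]))" "j < dim_col (orth_sum p (mk_diagonal [a]))"
    then have ij: "i < m + 1" "j < m + 1" using oc by auto
    have "(transpose_mat R * (q * R)) $$ (i, j) = col R i \<bullet> (q *\<^sub>v col R j)"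
      by (rule congruence_index[OF R qc ij])
    also have "\<dots> = (if i < m then if j < m then p $$ (i, j) else 0 else if j < m then 0 else a)"
      using congruence_index[OF P(1) qc, of i j] P(2) orth orth' ij
      by (auto simp: colR a_def qf_eval_def)
    also have "\<dots> = orth_sum p (mk_diagonal [a]) $$ (i, j)"
      unfolding orth_sum_altdef[OF pc ac] using ij pc ac
      by (auto simp: mk_diagonal_index less_Suc_eq)
    finally show "(transpose_mat R * (q * R)) $$ (i, j) = orth_sum p (mk_diagonal [a]) $$ (i, j)" .
  qed (use R oc in auto)
  then have "embeds (orth_sum p (mk_diagonal [a])) q" by (rule embedsI[OF R oc qc])
  with \<open>a \<noteq> 0\<close> that show ?thesis by blast
qed

lemma orth_sum_assoc:
  assumes "A \<in> carrier_mat m m" "B \<in> carrier_mat n n" "C \<in> carrier_mat k k"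
  shows "orth_sum (orth_sum A B) C = orth_sum A (orth_sum B C)"
proof -
  have *: "orth_sum X Y = four_block_mat X (0\<^sub>m (dim_row X) (dim_col Y)) (0\<^sub>m (dim_row Y) (dim_col X)) Y"
    for X Y :: "'a mat"
    by (rule eq_matI) (auto simp: orth_sum_def Let_def)
  show ?thesis unfolding * by (rule assoc_four_block_mat[symmetric])
qed

lemma orth_sum_empty:
  assumes "A \<in> carrier_mat m m"
  shows "orth_sum A (mk_diagonal []) = A"
  unfolding orth_sum_altdef[OF assms mk_diagonal_carrier[of "[]"]]
  using assms by (intro eq_matI) (auto simp: mk_diagonal_dim)

text \<open>Repeats the one-dimensional extension until the dimensions agree. The complement comes
  out diagonal, so starting from the form of dimension 0 diagonalises \<open>q\<close>.\<close>

lemma embeds_complement: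
  fixes p q :: "'a::field mat"
  assumes q: "is_form q" "anisotropic q" and p: "is_form p" "embeds p q"
  shows "\<exists>rs. 0 \<notin> set rs \<and> dim_row p + length rs = dim_row q \<and> embeds (orth_sum p (mk_diagonal rs)) q"
  using p
proof (induction "dim_row q - dim_row p" arbitrary: p)
  case 0
  note pc = form_carrier[OF 0(2)]
  have "dim_row p \<le> dim_row q" by (rule embeds_dim_le[OF 0(2,3) form_carrier[OF q(1)]])
  then have "dim_row p + length ([] :: 'a list) = dim_row q" using 0(1) by simp
  moreover have "embeds (orth_sum p (mk_diagonal [])) q"
    unfolding orth_sum_empty[OF pc] by (rule 0(3))
  ultimately show ?case by (intro exI[of _ "[]"]) (simp only: list.set empty_iff not_False_eq_True simp_thms)
next
  case (Suc n)
  note pc = form_carrier[OF Suc(3)]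
  have "dim_row p < dim_row q" using Suc(2) by simp
  then obtain a where a: "a \<noteq> 0" "embeds (orth_sum p (mk_diagonal [a])) q"
    by (rule embeds_extend[OF q Suc(3,4)])
  have ac: "mk_diagonal [a] \<in> carrier_mat 1 1" using mk_diagonal_carrier[of "[a]"] by simp
  have f: "is_form (orth_sum p (mk_diagonal [a]))"
    using a(1) by (intro is_form_orth_sum Suc(3) is_form_mk_diagonal) simp
  have d: "dim_row (orth_sum p (mk_diagonal [a])) = dim_row p + 1"
    using orth_sum_carrier[OF pc ac] by simp
  have "n = dim_row q - dim_row (orth_sum p (mk_diagonal [a]))" using Suc(2) d by simp
  from Suc(1)[OF this f a(2), unfolded d] obtain rs where rs: "0 \<notin> set rs"
    "dim_row p + 1 + length rs = dim_row q"
    "embeds (orth_sum (orth_sum p (mk_diagonal [a])) (mk_diagonal rs)) q" by blast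
  have "orth_sum (orth_sum p (mk_diagonal [a])) (mk_diagonal rs) = orth_sum p (mk_diagonal (a # rs))"
    unfolding orth_sum_assoc[OF pc ac mk_diagonal_carrier[of rs]] mk_diagonal_append[of "[a]" rs, symmetric]
    by simp
  then have "embeds (orth_sum p (mk_diagonal (a # rs))) q" using rs(3) by (simp only:)
  moreover have "0 \<notin> set (a # rs)" "dim_row p + length (a # rs) = dim_row q" using rs(1,2) a(1) by auto
  ultimately show ?case by blast
qed

lemma embeds_sym:
  fixes A B :: "'a::field mat"
  assumes "(2::'a) \<noteq> 0" "is_form A" "is_form B" "embeds A B" "dim_row A = dim_row B"
  shows "embeds B A"
  using isometric_embeds(2)[OF assms(1-3) embeds_isometric[OF assms(2-5)]] .

text \<open>The embedded sum of \<open>p\<close> and its complement has the dimension of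
  \<open>q\<close>, and an embedding in equal dimensions is an isometry.\<close>

lemma embeds_imp_subform:
  fixes p q :: "'a::field mat"
  assumes "(2::'a) \<noteq> 0" and q: "is_form q" "anisotropic q" and p: "is_form p" "embeds p q"
  shows "subform p q"
proof -
  obtain rs where rs: "0 \<notin> set rs" "dim_row p + length rs = dim_row q"
    "embeds (orth_sum p (mk_diagonal rs)) q"
    using embeds_complement[OF q p] by blast
  have r: "is_form (mk_diagonal rs)" by (rule is_form_mk_diagonal[OF rs(1)])
  have f: "is_form (orth_sum p (mk_diagonal rs))" by (rule is_form_orth_sum[OF p(1) r])
  have d: "dim_row (orth_sum p (mk_diagonal rs)) = dim_row q"
    using orth_sum_carrier[OF form_carrier[OF p(1)] mk_diagonal_carrier[of rs]] rs(2) by simp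
  have "isometric q (orth_sum p (mk_diagonal rs))"
    using embeds_isometric[OF q(1) f embeds_sym[OF assms(1) f q(1) rs(3) d] d[symmetric]] .
  with r show ?thesis unfolding subform_def by blast
qed

lemma subform_imp_embeds:
  fixes p q :: "'a::field mat"
  assumes "(2::'a) \<noteq> 0" "is_form p" "is_form q" "subform p q"
  shows "embeds p q"
proof -
  obtain r where r: "is_form r" "isometric q (orth_sum p r)" using assms(4) unfolding subform_def by blast
  have "embeds p (orth_sum p r)"
    by (rule embeds_orth_sum_left[OF form_carrier[OF assms(2)] form_carrier[OF r(1)]])
  moreover have "embeds (orth_sum p r) q"
    by (rule isometric_embeds(2)[OF assms(1,3) is_form_orth_sum[OF assms(2) r(1)] r(2)])
  ultimately show ?thesis by (rule embeds_trans[OF _ _ form_carrier[OF assms(3)]])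
qed

lemma anisotropic_diagonalizable:
  fixes q :: "'a::field mat"
  assumes "(2::'a) \<noteq> 0" "is_form q" "anisotropic q"
  obtains qs where "0 \<notin> set qs" "length qs = dim_row q"
    "embeds (mk_diagonal qs) q" "embeds q (mk_diagonal qs)"
proof -
  let ?z = "mk_diagonal [] :: 'a mat"
  have z: "is_form ?z" by (rule is_form_mk_diagonal) simp
  have "embeds ?z q"
    by (rule embedsI[of "0\<^sub>m (dim_row q) 0" _ _ ?z, OF _ _ form_carrier[OF assms(2)]])
       (use mk_diagonal_carrier[of "[]"] in \<open>auto simp: mk_diagonal_def\<close>)
  from embeds_complement[OF assms(2,3) z this] obtain qs where qs: "0 \<notin> set qs"
    "length qs = dim_row q" "embeds (orth_sum ?z (mk_diagonal qs)) q"
    by (auto simp: mk_diagonal_dim)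
  have e: "embeds (mk_diagonal qs) q" using qs(3) mk_diagonal_append[of "[]" qs] by simp
  have "embeds q (mk_diagonal qs)"
    by (rule embeds_sym[OF assms(1) is_form_mk_diagonal[OF qs(1)] assms(2) e])
       (simp add: qs(2) mk_diagonal_dim)
  with qs e that show ?thesis by blast
qed

lemma embeds_map_mat:
  assumes "field_hom h" "embeds A B" "A \<in> carrier_mat m m" "B \<in> carrier_mat n n"
  shows "embeds (map_mat h A) (map_mat h B)"
proof -
  interpret field_hom h by fact
  obtain P where P: "P \<in> carrier_mat n m" "transpose_mat P * (B * P) = A"
    by (rule embedsE[OF assms(2-4)])
  have "transpose_mat (map_mat h P) * (map_mat h B * map_mat h P) = map_mat h A"
    unfolding P(2)[symmetric] using P(1) assms(4)
    by (simp add: mat_hom_mult[of _ m n _ m] mat_hom_mult[of _ n n _ m] map_mat_transpose)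
  then show ?thesis using P(1) assms(3,4) by (intro embedsI[of "map_mat h P" n m]) auto
qed

lemma is_form_map_mat:
  assumes "field_hom h" "is_form A"
  shows "is_form (map_mat h A)"
proof -
  interpret field_hom h by fact
  obtain n where A: "A \<in> carrier_mat n n" using form_carrier[OF assms(2)] by blast
  obtain B where B: "B \<in> carrier_mat n n" "A * B = 1\<^sub>m n"
    by (rule form_inverse[OF assms(2)]) (use A in auto)
  have "map_mat h A * map_mat h B = 1\<^sub>m n"
    using mat_hom_mult[OF A B(1)] B(2) mat_hom_one by simp
  moreover have "transpose_mat (map_mat h A) = map_mat h A"
    using assms(2) by (simp add: map_mat_transpose is_form_def)
  ultimately show ?thesis using A B(1) by (intro is_formI[of _ n "map_mat h B"]) auto
qed

lemma map_mat_mk_diagonal: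
  assumes "field_hom h"
  shows "map_mat h (mk_diagonal xs) = mk_diagonal (map h xs)"
proof -
  interpret field_hom h by fact
  show ?thesis by (rule mk_diagonal_eqI) (auto simp: mk_diagonal_dim mk_diagonal_index)
qed

section \<open>Chain equivalence of diagonal forms\<close>

definition scale :: "'a::field \<Rightarrow> 'a multiset \<Rightarrow> 'a multiset" where
  "scale c = image_mset ((*) c)"

lemma image_mset_times [simp]: "image_mset ((*) c) M = scale c M"
  by (simp add: scale_def)

lemma scale_simps [simp]:
  "scale c {#} = {#}" "scale c (add_mset a M) = add_mset (c * a) (scale c M)"
  "scale c (M + N) = scale c M + scale c N"
  unfolding scale_def by auto

lemma scale_scale [simp]: "scale c (scale d M) = scale (c * d) M"
  by (induction M) (auto simp: mult.assoc)

lemma scale_one [simp]: "scale 1 M = M"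
  by (induction M) auto

lemma size_scale [simp]: "size (scale c M) = size M"
  by (induction M) auto

text \<open>
  Replacing isometry by Witt's chain equivalence reduces the isometries between Pfister forms to
  computations with multisets.
\<close>

inductive chain_equiv :: "'a::field multiset \<Rightarrow> 'a multiset \<Rightarrow> bool" (infix "\<approx>" 50) where
  chain_refl: "M \<approx> M"
| square: "s \<noteq> 0 \<Longrightarrow> add_mset a M \<approx> add_mset (a * s\<^sup>2) M"
| binary: "s \<noteq> 0 \<Longrightarrow> t \<noteq> 0 \<Longrightarrow> s + t \<noteq> 0 \<Longrightarrow>
    add_mset s (add_mset t M) \<approx> add_mset (s + t) (add_mset (s * t * (s + t)) M)"
| chain_trans [trans]: "M \<approx> N \<Longrightarrow> N \<approx> R \<Longrightarrow> M \<approx> R"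

lemma chain_equiv_size: "M \<approx> N \<Longrightarrow> size M = size N"
  by (induction rule: chain_equiv.induct) auto

lemma chain_equiv_add_right: "M \<approx> N \<Longrightarrow> M + R \<approx> N + R"
  by (induction rule: chain_equiv.induct) (auto intro: chain_equiv.intros)

lemma chain_equiv_add: "M \<approx> N \<Longrightarrow> M' \<approx> N' \<Longrightarrow> M + M' \<approx> N + N'"
  by (metis chain_equiv_add_right add.commute chain_equiv.chain_trans)

lemma chain_equiv_add_mset: "M \<approx> N \<Longrightarrow> add_mset a M \<approx> add_mset a N"
  using chain_equiv_add_right[of M N "{#a#}"] by simp

lemma chain_equiv_square': "s \<noteq> 0 \<Longrightarrow> b = a * s\<^sup>2 \<Longrightarrow> add_mset a M \<approx> add_mset b M"
  using chain_equiv.square by blast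

lemma chain_equiv_sym: "M \<approx> N \<Longrightarrow> N \<approx> M"
proof (induction rule: chain_equiv.induct)
  case (square s a M)
  then show ?case by (intro chain_equiv_square'[of "inverse s"]) (auto simp: field_simps)
next
  case (binary s t M)
  \<comment> \<open>The binary move is undone by another binary move: \<open>?u\<close> and
    \<open>?v\<close> are square multiples of s + t and st(s + t), they add up to s, and
    \<open>?u * ?v * s\<close> is a square multiple of t.\<close>
  let ?u = "s\<^sup>2 / (s + t)" and ?v = "s * t / (s + t)"
  have "?u + ?v = s * (s + t) / (s + t)"
    by (simp add: add_divide_distrib[symmetric] power2_eq_square distrib_left)
  then have uv: "?u + ?v = s" using binary by simp
  have sq: "s\<^sup>2 / w = w * (s / w)\<^sup>2" if "w \<noteq> 0" for w
    using that by (simp add: field_simps power2_eq_square)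
  have sq2: "t = s\<^sup>2 / w * (s * t / w) * s * (w / s\<^sup>2)\<^sup>2" if "w \<noteq> 0" for w
    using that binary(1) by (simp add: field_simps power2_eq_square)
  have sq': "s * t / w = s * t * w * (1 / w)\<^sup>2" if "w \<noteq> 0" for w
    using that by (simp add: field_simps power2_eq_square)
  have "add_mset (s + t) (add_mset (s * t * (s + t)) M) \<approx> add_mset ?u (add_mset (s * t * (s + t)) M)"
    using binary by (intro chain_equiv_square'[of "s / (s + t)"] sq) auto
  also have "\<dots> \<approx> add_mset ?u (add_mset ?v M)"
    using binary by (intro chain_equiv_add_mset chain_equiv_square'[of "1 / (s + t)"] sq') auto
  also have "\<dots> \<approx> add_mset (?u + ?v) (add_mset (?u * ?v * (?u + ?v)) M)"
    using binary uv by (intro chain_equiv.binary) auto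
  also have "\<dots> \<approx> add_mset s (add_mset t M)"
    unfolding uv using binary
    by (intro chain_equiv_add_mset chain_equiv_square'[of "(s + t) / s\<^sup>2"] sq2) auto
  finally show ?case .
qed (auto intro: chain_equiv.intros)

lemma chain_equiv_commute: "M \<approx> N \<longleftrightarrow> N \<approx> M"
  using chain_equiv_sym by blast

lemma chain_equiv_scale:
  assumes "c \<noteq> 0" "M \<approx> N"
  shows "scale c M \<approx> scale c N"
  using assms(2)
proof (induction rule: chain_equiv.induct)
  case (square s a M)
  then show ?case by (auto intro!: chain_equiv_square'[of s])
next
  case (binary s t M)
  have "add_mset (c * s) (add_mset (c * t) (scale c M)) \<approx>
      add_mset (c * s + c * t) (add_mset (c * s * (c * t) * (c * s + c * t)) (scale c M))"
    using binary assms(1) by (intro chain_equiv.binary) (auto simp: distrib_left[symmetric])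
  \<comment> \<open>The binary move on cs and ct produces the factor c^3 where c is wanted; the
    surplus c^2 is a square.\<close>
  also have "\<dots> \<approx> add_mset (c * s + c * t) (add_mset (c * (s * t * (s + t))) (scale c M))"
    using binary assms(1) by (intro chain_equiv_add_mset chain_equiv_square'[of "1 / c"])
      (auto simp: field_simps power2_eq_square)
  finally show ?case by (simp add: distrib_left)
qed (auto intro: chain_equiv.intros)

lemma chain_equiv_scale_square: "c \<noteq> 0 \<Longrightarrow> M \<approx> scale (c\<^sup>2) M"
proof (induction M)
  case (add x M)
  then have "add_mset x M \<approx> add_mset x (scale (c\<^sup>2) M)" by (intro chain_equiv_add_mset) auto
  also have "\<dots> \<approx> add_mset (c\<^sup>2 * x) (scale (c\<^sup>2) M)"
    using add by (intro chain_equiv_square'[of c]) auto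
  finally show ?case by simp
qed (auto intro: chain_equiv.chain_refl)

text \<open>The binary move tensored with \<open>M\<close>: it is applied to each pair s x, t x, and
  the surplus x^2 in the second new entry is removed as a square.\<close>

lemma chain_equiv_scale_binary:
  assumes "s \<noteq> 0" "t \<noteq> 0" "s + t \<noteq> 0" "0 \<notin># M"
  shows "scale s M + scale t M \<approx> scale (s + t) M + scale (s * t * (s + t)) M"
  using assms(4)
proof (induction M)
  case (add x M)
  have "scale s (add_mset x M) + scale t (add_mset x M) =
      {#s * x, t * x#} + (scale s M + scale t M)" by simp
  also have "\<dots> \<approx> {#s * x, t * x#} + (scale (s + t) M + scale (s * t * (s + t)) M)"
    using add by (intro chain_equiv_add[OF chain_equiv.chain_refl]) auto
  also have "\<dots> \<approx> {#s * x + t * x, s * x * (t * x) * (s * x + t * x)#} +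
      (scale (s + t) M + scale (s * t * (s + t)) M)"
    using add assms by (intro chain_equiv_add chain_equiv.chain_refl chain_equiv.binary)
      (auto simp: distrib_right[symmetric])
  also have "\<dots> \<approx> {#(s + t) * x, s * t * (s + t) * x#} +
      (scale (s + t) M + scale (s * t * (s + t)) M)"
  proof (intro chain_equiv_add chain_equiv.chain_refl)
    have "add_mset (s * x * (t * x) * (s * x + t * x)) {#} \<approx> add_mset (s * t * (s + t) * x) {#}"
      using add by (intro chain_equiv_square'[of "1 / x"]) (auto simp: field_simps power2_eq_square)
    then show "{#s * x + t * x, s * x * (t * x) * (s * x + t * x)#} \<approx> {#(s + t) * x, s * t * (s + t) * x#}"
      unfolding distrib_right[symmetric] by (rule chain_equiv_add_mset)
  qed
  finally show ?case by (simp add: add_mset_commute)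
qed (auto intro: chain_equiv.chain_refl)

lemma chain_equiv_map:
  assumes "field_hom h" "M \<approx> N"
  shows "image_mset h M \<approx> image_mset h N"
proof -
  interpret field_hom h by fact
  show ?thesis using assms(2)
  proof (induction rule: chain_equiv.induct)
    case (square s a M)
    then show ?case by (auto intro!: chain_equiv.square simp: hom_distribs)
  next
    case (binary s t M)
    then have "h s + h t \<noteq> 0" by (simp flip: hom_add)
    then show ?case using chain_equiv.binary[of "h s" "h t" "image_mset h M"] binary
      by (simp add: hom_mult hom_add)
  qed (auto intro: chain_equiv.intros)
qed

lemma mset_products_append_right:
  "mset (products xs (ys @ zs)) = mset (products xs ys) + mset (products xs zs)"
  by (induction xs) auto

lemma mset_products_map_left:
  "mset (products (map ((*) c) xs) ys) = scale (c::'a::field) (mset (products xs ys))"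
  by (induction xs) auto

lemma mset_products_map_right:
  "mset (products xs (map ((*) c) ys)) = scale (c::'a::field) (mset (products xs ys))"
  by (induction xs) (simp_all del: map_map add: mult.commute[of _ c])

lemma mset_products_commute:
  "mset (products xs ys) = mset (products ys (xs :: 'a::field list))"
proof (induction xs)
  case Nil
  then show ?case by (induction ys) auto
next
  case (Cons x xs)
  have "mset (products ys [x]) = scale x (mset ys)" by (induction ys) auto
  then show ?case using mset_products_append_right[of ys "[x]" xs] Cons by simp
qed

lemma chain_equiv_products_right:
  assumes "0 \<notin> set xs" "mset ys \<approx> mset ys'"
  shows "mset (products xs ys) \<approx> mset (products xs ys')"
  using assms(1)
proof (induction xs)
  case (Cons x xs)
  then have "x \<noteq> 0" "mset (products xs ys) \<approx> mset (products xs ys')" by auto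
  then show ?case using assms(2) by (simp add: chain_equiv_add chain_equiv_scale)
qed (simp add: chain_equiv.chain_refl)

lemma chain_equiv_products_left:
  "0 \<notin> set xs \<Longrightarrow> mset ys \<approx> mset ys' \<Longrightarrow> mset (products ys xs) \<approx> mset (products ys' xs)"
  unfolding mset_products_commute[of _ xs] by (rule chain_equiv_products_right)

section \<open>Realising chain equivalence by congruences\<close>

lemma embeds_diagonal_append:
  assumes "embeds (mk_diagonal xs) (mk_diagonal xs')" "embeds (mk_diagonal ys) (mk_diagonal ys')"
  shows "embeds (mk_diagonal (xs @ ys)) (mk_diagonal (xs' @ ys'))"
  unfolding mk_diagonal_append
  by (rule embeds_orth_sum[OF assms mk_diagonal_carrier mk_diagonal_carrier mk_diagonal_carrier
      mk_diagonal_carrier])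

lemma embeds_diagonal_square:
  "embeds (mk_diagonal [a * s\<^sup>2]) (mk_diagonal [a :: 'a::field])"
proof -
  let ?P = "mat 1 1 (\<lambda>_. s)"
  have P: "?P \<in> carrier_mat (length [a]) 1" by simp
  have "transpose_mat ?P * (mk_diagonal [a] * ?P) = mk_diagonal [a * s\<^sup>2]"
  proof (rule mk_diagonal_eqI)
    fix i j assume "i < length [a * s\<^sup>2]" "j < length [a * s\<^sup>2]"
    then show "(transpose_mat ?P * (mk_diagonal [a] * ?P)) $$ (i, j) = (if i = j then [a * s\<^sup>2] ! i else 0)"
      by (subst congruence_diagonal_index[OF P]) (auto simp: power2_eq_square)
  qed (auto simp: mk_diagonal_dim)
  then show ?thesis
    by (intro embedsI[OF P]) (auto simp: mk_diagonal_dim)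
qed

text \<open>The columns (1, 1) and (t, -s) are orthogonal for the form with entries s, t, and their
  values are s + t and st(s + t).\<close>

lemma embeds_diagonal_binary:
  "embeds (mk_diagonal [s + t, s * t * (s + t)]) (mk_diagonal [s, t :: 'a::field])"
proof -
  let ?P = "mat 2 2 (\<lambda>(i, j). if i = 0 then (if j = 0 then 1 else t) else if j = 0 then 1 else - s)"
  have P: "?P \<in> carrier_mat (length [s, t]) 2" by (simp add: numeral_2_eq_2)
  have "transpose_mat ?P * (mk_diagonal [s, t] * ?P) = mk_diagonal [s + t, s * t * (s + t)]"
  proof (rule mk_diagonal_eqI)
    fix i j assume "i < length [s + t, s * t * (s + t)]" "j < length [s + t, s * t * (s + t)]"
    then have ij: "i < 2" "j < 2" by auto
    show "(transpose_mat ?P * (mk_diagonal [s, t] * ?P)) $$ (i, j) =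
        (if i = j then [s + t, s * t * (s + t)] ! i else 0)"
      using ij unfolding congruence_diagonal_index[OF P ij]
      by (auto simp: less_2_cases_iff algebra_simps)
  qed (auto simp: mk_diagonal_dim)
  then show ?thesis
    by (intro embedsI[OF P]) (auto simp: mk_diagonal_dim)
qed

text \<open>The matrices of the elementary moves express the new diagonal basis in the old one,
  which is why the embedding runs from \<open>ys\<close> to \<open>xs\<close>.\<close>

lemma chain_equiv_embeds':
  "M \<approx> N \<Longrightarrow> mset xs = M \<Longrightarrow> mset ys = N \<Longrightarrow> embeds (mk_diagonal ys) (mk_diagonal xs)"
proof (induction arbitrary: xs ys rule: chain_equiv.induct)
  case (chain_refl M)
  then show ?case by (intro embeds_diagonal_mset) simp
next
  case (square s a M)
  obtain ms where ms: "mset ms = M" using ex_mset by blast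
  have "embeds (mk_diagonal ys) (mk_diagonal ([a * s\<^sup>2] @ ms))"
    using square ms by (intro embeds_diagonal_mset) simp
  moreover have "embeds (mk_diagonal ([a * s\<^sup>2] @ ms)) (mk_diagonal ([a] @ ms))"
    by (intro embeds_diagonal_append embeds_diagonal_square embeds_refl[OF mk_diagonal_carrier])
  moreover have "embeds (mk_diagonal ([a] @ ms)) (mk_diagonal xs)"
    using square ms by (intro embeds_diagonal_mset) simp
  ultimately show ?case by (meson embeds_trans mk_diagonal_carrier)
next
  case (binary s t M)
  obtain ms where ms: "mset ms = M" using ex_mset by blast
  have "embeds (mk_diagonal ys) (mk_diagonal ([s + t, s * t * (s + t)] @ ms))"
    using binary ms by (intro embeds_diagonal_mset) simp
  moreover have "embeds (mk_diagonal ([s + t, s * t * (s + t)] @ ms)) (mk_diagonal ([s, t] @ ms))"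
    by (intro embeds_diagonal_append embeds_diagonal_binary embeds_refl[OF mk_diagonal_carrier])
  moreover have "embeds (mk_diagonal ([s, t] @ ms)) (mk_diagonal xs)"
    using binary ms by (intro embeds_diagonal_mset) simp
  ultimately show ?case by (meson embeds_trans mk_diagonal_carrier)
next
  case (chain_trans M N R)
  obtain ns where ns: "mset ns = N" using ex_mset by blast
  show ?case
    by (rule embeds_trans[OF chain_trans.IH(2)[OF ns chain_trans.prems(2)] chain_trans.IH(1)[OF chain_trans.prems(1) ns]
        mk_diagonal_carrier])
qed

lemma chain_equiv_embeds:
  "mset xs \<approx> mset ys \<Longrightarrow> embeds (mk_diagonal xs) (mk_diagonal ys)"
  using chain_equiv_embeds'[OF chain_equiv_sym] by blast

section \<open>Pfister forms\<close>

fun pfister_entries :: "'a::field list \<Rightarrow> 'a list" where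
  "pfister_entries [] = [1]"
| "pfister_entries (a # as) = pfister_entries as @ map ((*) a) (pfister_entries as)"

lemma pfister_prod_diagonal: "pfister_prod as = mk_diagonal (pfister_entries as)"
proof (induction as)
  case (Cons a as)
  have "pfister_prod (a # as) = tensor_form (mk_diagonal [1, a]) (pfister_prod as)"
    by (simp add: pfister_prod_def)
  moreover have "map ((*) 1) xs = xs" for xs :: "'a list" by (rule map_idI) simp
  ultimately show ?case by (simp add: Cons tensor_form_diagonal)
qed (simp add: pfister_prod_def)

lemma zero_notin_pfister_entries: "0 \<notin> set as \<Longrightarrow> 0 \<notin> set (pfister_entries as)"
  by (induction as) auto

lemma length_pfister_entries: "length (pfister_entries as) = 2 ^ length as"
  by (induction as) auto

text \<open>The value of a diagonal form on a list of coordinates. Lists split into halves in the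
  same way as \<open>pfister_entries\<close> does.\<close>

definition diag_eval :: "'a::field list \<Rightarrow> 'a list \<Rightarrow> 'a" where
  "diag_eval xs us = sum_list (map2 (\<lambda>x u. x * u\<^sup>2) xs us)"

lemma diag_eval_simps [simp]:
  "diag_eval [] us = 0" "diag_eval (x # xs) (u # us) = x * u\<^sup>2 + diag_eval xs us"
  by (simp_all add: diag_eval_def)

lemma diag_eval_append:
  "length us = length xs \<Longrightarrow>
   diag_eval (xs @ ys) (us @ vs) = diag_eval xs us + diag_eval ys vs"
  by (simp add: diag_eval_def)

lemma diag_eval_map:
  "length us = length xs \<Longrightarrow> diag_eval (map ((*) c) xs) us = c * diag_eval xs us"
  by (induction us xs rule: list_induct2) (auto simp: algebra_simps)

text \<open>Pfister forms are round: each nonzero value is a similarity factor. Write the value as s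
  + at with s, t values of the smaller form P. If both are nonzero, P absorbs s and t, the binary
  move on s and at gives (s + at)P and (s + at)(ast)P, and st is absorbed again.\<close>

lemma pfister_round:
  assumes "0 \<notin> set as" "length us = length (pfister_entries as)" "diag_eval (pfister_entries as) us \<noteq> 0"
  shows "mset (pfister_entries as) \<approx> scale (diag_eval (pfister_entries as) us) (mset (pfister_entries as))"
  using assms
proof (induction as arbitrary: us)
  case Nil
  then obtain u where "us = [u]" by (auto simp: length_Suc_conv)
  then show ?case using Nil by (auto intro!: chain_equiv_square'[of u])
next
  case (Cons a as)
  let ?P = "pfister_entries as"
  define M where "M = mset ?P"
  define us1 us2 where "us1 = take (length ?P) us" "us2 = drop (length ?P) us"
  have us: "us = us1 @ us2" "length us1 = length ?P" "length us2 = length ?P"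
    using Cons.prems by (auto simp: us1_us2_def)
  define s t where "s = diag_eval ?P us1" "t = diag_eval ?P us2"
  have val: "diag_eval (pfister_entries (a # as)) us = s + a * t"
    using us by (simp add: diag_eval_append diag_eval_map s_t_def)
  have a: "a \<noteq> 0" and as: "0 \<notin> set as" using Cons.prems by auto
  have M0: "0 \<notin># M" using zero_notin_pfister_entries[OF as] by (simp add: M_def)
  have sM: "M \<approx> scale s M" if "s \<noteq> 0" using Cons.IH[OF as us(2)] that by (simp add: s_t_def M_def)
  have tM: "M \<approx> scale t M" if "t \<noteq> 0" using Cons.IH[OF as us(3)] that by (simp add: s_t_def M_def)
  have ne: "s + a * t \<noteq> 0" using Cons.prems val by simp
  have "M + scale a M \<approx> scale (s + a * t) (M + scale a M)"
  \<comment> \<open>The binary move needs nonzero entries, so a vanishing half is treated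
    apart.\<close>
  proof (cases "s = 0 \<or> t = 0")
    case True
    then consider "s = 0" "t \<noteq> 0" | "t = 0" "s \<noteq> 0" using ne by auto
    then show ?thesis
    proof cases
      case 1
      \<comment> \<open>The value is at, and multiplication by a exchanges the two halves up to the
        square a^2.\<close>
      have "M \<approx> scale (a\<^sup>2) M" by (rule chain_equiv_scale_square[OF a])
      also have "\<dots> \<approx> scale (a\<^sup>2) (scale t M)" using a tM 1 by (intro chain_equiv_scale) auto
      finally have "M + scale a M \<approx> scale (a\<^sup>2) (scale t M) + scale a (scale t M)"
        using a tM 1 by (intro chain_equiv_add chain_equiv_scale)
      then show ?thesis using 1 by (simp add: power2_eq_square ac_simps)
    next
      case 2
      have "M + scale a M \<approx> scale s M + scale a (scale s M)"
        using a sM 2 by (intro chain_equiv_add chain_equiv_scale)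
      then show ?thesis using 2 by (simp add: ac_simps)
    qed
  next
    case False
    have "M + scale a M \<approx> scale s M + scale a (scale t M)"
      using False a sM tM by (intro chain_equiv_add chain_equiv_scale) auto
    also have "\<dots> = scale s M + scale (a * t) M" by simp
    also have "\<dots> \<approx> scale (s + a * t) M + scale (s * (a * t) * (s + a * t)) M"
      using False a ne M0 by (intro chain_equiv_scale_binary) auto
    also have "\<dots> \<approx> scale (s + a * t) M + scale ((s + a * t) * a) M"
    proof (intro chain_equiv_add chain_equiv.chain_refl)
      have "M \<approx> scale s M" using sM False by simp
      also have "\<dots> \<approx> scale s (scale t M)" using tM False by (intro chain_equiv_scale) auto
      finally have "scale ((s + a * t) * a) M \<approx> scale ((s + a * t) * a) (scale s (scale t M))"
        using ne a by (intro chain_equiv_scale) auto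
      then show "scale (s * (a * t) * (s + a * t)) M \<approx> scale ((s + a * t) * a) M"
        by (subst chain_equiv_commute) (simp add: ac_simps)
    qed
    finally show ?thesis by simp
  qed
  then show ?case by (simp add: val[simplified] M_def)
qed

section \<open>Isotropic Pfister forms\<close>

definition isotropic_list :: "'a::field list \<Rightarrow> bool" where
  "isotropic_list xs \<longleftrightarrow>
     (\<exists>us. length us = length xs \<and> (\<exists>u \<in> set us. u \<noteq> 0) \<and> diag_eval xs us = 0)"

lemma anisotropic_mk_diagonalI:
  assumes "\<not> isotropic_list xs"
  shows "anisotropic (mk_diagonal xs)"
  unfolding anisotropic_def
proof (intro ballI impI)
  fix v :: "'a vec" assume "v \<in> carrier_vec (dim_row (mk_diagonal xs))" and z: "qf_eval (mk_diagonal xs) v = 0"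
  then have v: "v \<in> carrier_vec (length xs)" by (simp add: mk_diagonal_dim)
  have "diag_eval xs (list_of_vec v) = (\<Sum>i<length xs. xs ! i * (v $ i)\<^sup>2)"
    unfolding diag_eval_def sum_list_sum_nth using v
    by (auto simp: atLeast0LessThan list_of_vec_index intro!: sum.cong)
  then have "diag_eval xs (list_of_vec v) = 0" using z qf_eval_diagonal[OF v] by simp
  then have "\<forall>u \<in> set (list_of_vec v). u = 0"
    using assms v unfolding isotropic_list_def by (metis carrier_vecD length_list_of_vec)
  moreover have "v $ i \<in> set (list_of_vec v)" if "i < length xs" for i
    using that v nth_mem[of i "list_of_vec v"] by (simp add: list_of_vec_index)
  ultimately show "v = 0\<^sub>v (dim_row (mk_diagonal xs))"
    using v by (intro eq_vecI) (auto simp: mk_diagonal_dim)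
qed

text \<open>Let P be the form without the first slot a. If P is isotropic, induction makes both P
  and aP hyperbolic. Otherwise an isotropic vector gives s + at = 0 with nonzero values s, t of P,
  and roundness yields that aP is equivalent to atP = -sP, hence to -P.\<close>

lemma pfister_isotropic_hyperbolic:
  assumes "0 \<notin> set as" "isotropic_list (pfister_entries as)"
  shows "\<exists>N. mset (pfister_entries as) \<approx> N + scale (-1) N"
  using assms
proof (induction as)
  case Nil
  then obtain us :: "'a list" where "length us = 1" "\<exists>u \<in> set us. u \<noteq> 0" "diag_eval [1] us = 0"
    by (auto simp: isotropic_list_def)
  then show ?case by (auto simp: length_Suc_conv)
next
  case (Cons a as)
  let ?P = "pfister_entries as"
  define M where "M = mset ?P"
  have a: "a \<noteq> 0" and as: "0 \<notin> set as" using Cons.prems by auto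
  have M': "mset (pfister_entries (a # as)) = M + scale a M" by (simp add: M_def)
  show ?case
  proof (cases "isotropic_list ?P")
    case True
    then obtain N where "M \<approx> N + scale (-1) N" using Cons.IH[OF as] M_def by blast
    then have "M + scale a M \<approx> (N + scale (-1) N) + scale a (N + scale (-1) N)"
      using a by (intro chain_equiv_add chain_equiv_scale)
    also have "\<dots> = (N + scale a N) + scale (-1) (N + scale a N)" by (simp add: ac_simps)
    finally show ?thesis unfolding M' by blast
  next
    case False
    then have z: "\<forall>u \<in> set us. u = 0" if "length us = length ?P" "diag_eval ?P us = 0" for us
      using that unfolding isotropic_list_def by blast
    from Cons.prems(2) obtain us where us0: "length us = length (pfister_entries (a # as))"
      "\<exists>u \<in> set us. u \<noteq> 0" "diag_eval (pfister_entries (a # as)) us = 0"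
      unfolding isotropic_list_def by blast
    define us1 us2 where "us1 = take (length ?P) us" "us2 = drop (length ?P) us"
    have us: "us = us1 @ us2" "length us1 = length ?P" "length us2 = length ?P"
      using us0(1) by (auto simp: us1_us2_def)
    define s t where "s = diag_eval ?P us1" "t = diag_eval ?P us2"
    have val: "s + a * t = 0"
      using us us0(3) by (simp add: diag_eval_append diag_eval_map s_t_def)
    have st: "s \<noteq> 0" "t \<noteq> 0"
    proof -
      \<comment> \<open>If both values vanished, anisotropy of the smaller form would make the whole
        vector zero; and since s = -at, neither can vanish alone.\<close>
      have "\<not> (s = 0 \<and> t = 0)"
      proof
        assume "s = 0 \<and> t = 0"
        then have "diag_eval ?P us1 = 0" "diag_eval ?P us2 = 0" unfolding s_t_def by blast+
        then have "\<forall>u \<in> set us1. u = 0" "\<forall>u \<in> set us2. u = 0"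
          using z[OF us(2)] z[OF us(3)] by blast+
        then show False using us0(2) us(1) by auto
      qed
      then show "s \<noteq> 0" "t \<noteq> 0" using val a by auto
    qed
    have sM: "M \<approx> scale s M" and tM: "M \<approx> scale t M"
      using pfister_round[OF as us(2)] pfister_round[OF as us(3)] st by (auto simp: s_t_def M_def)
    have "scale a M \<approx> scale a (scale t M)" using a tM by (rule chain_equiv_scale)
    also have "\<dots> = scale (-1) (scale s M)"
      using val by (simp add: eq_neg_iff_add_eq_0[THEN iffD2, of "a * t" s] add.commute)
    also have "\<dots> \<approx> scale (-1) M" by (rule chain_equiv_scale[OF _ chain_equiv_sym[OF sM]]) simp
    finally have "M + scale a M \<approx> M + scale (-1) M" by (intro chain_equiv_add chain_equiv.chain_refl)
    then show ?thesis unfolding M' by blast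
  qed
qed

text \<open>A diagonal entry is the value at a unit vector, so roundness applies.\<close>

lemma pfister_entries_similarity:
  assumes "0 \<notin> set as" "z \<in> set (pfister_entries as)"
  shows "mset (pfister_entries as) \<approx> scale z (mset (pfister_entries as))"
proof -
  let ?P = "pfister_entries as"
  obtain i where i: "i < length ?P" "?P ! i = z" using assms(2) by (auto simp: in_set_conv_nth)
  have "diag_eval xs (map (\<lambda>k. if k = i then 1 else 0) [0..<length xs]) = xs ! i"
    if "i < length xs" for xs :: "'a list"
  proof -
    have "diag_eval xs (map (\<lambda>k. if k = i then 1 else 0) [0..<length xs]) =
        (\<Sum>k = 0..<length xs. xs ! k * (if k = i then 1 else 0)\<^sup>2)"
      unfolding diag_eval_def sum_list_sum_nth by simp
    also have "\<dots> = (\<Sum>k = 0..<length xs. if k = i then xs ! i else 0)"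
      by (rule sum.cong) auto
    finally show ?thesis using that by simp
  qed
  from this[OF i(1)] have "diag_eval ?P (map (\<lambda>k. if k = i then 1 else 0) [0..<length ?P]) = z"
    unfolding i(2) .
  moreover have "z \<noteq> 0" using zero_notin_pfister_entries[OF assms(1)] assms(2) by metis
  ultimately show ?thesis
    using pfister_round[OF assms(1), of "map (\<lambda>k. if k = i then 1 else 0) [0..<length ?P]"]
    by (metis length_map length_upt diff_zero)
qed

lemma sum_lessThan_add:
  fixes f :: "nat \<Rightarrow> 'a::comm_monoid_add"
  shows "(\<Sum>i<m + n. f i) = (\<Sum>i<m. f i) + (\<Sum>i<n. f (m + i))"
  by (induction n) (simp_all add: add.assoc)

text \<open>An anisotropic form has trivial intersection with a totally isotropic subspace.\<close>

lemma anisotropic_dim_le_hyperbolic: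
  fixes p :: "'a::field mat"
  assumes "anisotropic p" "p \<in> carrier_mat m m"
    and "embeds p (mk_diagonal (ns @ map uminus ns))"
  shows "m \<le> length ns"
proof (rule ccontr)
  let ?k = "length ns" and ?D = "mk_diagonal (ns @ map uminus ns)"
  assume "\<not> m \<le> ?k"
  have D: "?D \<in> carrier_mat (?k + ?k) (?k + ?k)" using mk_diagonal_carrier[of "ns @ map uminus ns"] by simp
  obtain P where P: "P \<in> carrier_mat (?k + ?k) m" "transpose_mat P * (?D * P) = p"
    by (rule embedsE[OF assms(3,2) D])
  \<comment> \<open>Vectors killed by \<open>U\<close> are mapped to vectors with two equal halves,
    and on those the entries ns and -ns cancel.\<close>
  define U where "U = mat ?k m (\<lambda>(i, j). P $$ (i, j) - P $$ (?k + i, j))"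
  have "U \<in> carrier_mat ?k m" by (simp add: U_def)
  then obtain v where v: "v \<in> carrier_vec m" "v \<noteq> 0\<^sub>v m" "U *\<^sub>v v = 0\<^sub>v ?k"
    by (rule exists_kernel_vec) (use \<open>\<not> m \<le> ?k\<close> in auto)
  have eq: "(P *\<^sub>v v) $ i = (P *\<^sub>v v) $ (?k + i)" if i: "i < ?k" for i
  proof -
    have "0 = (U *\<^sub>v v) $ i" using v(3) i by simp
    also have "\<dots> = (P *\<^sub>v v) $ i - (P *\<^sub>v v) $ (?k + i)"
      using i P(1) v(1) by (simp add: U_def scalar_prod_def left_diff_distrib sum_subtractf)
    finally show ?thesis by simp
  qed
  have "qf_eval p v = qf_eval ?D (P *\<^sub>v v)"
    using qf_eval_transform[OF P(1) D v(1)] P(2) by simp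
  also have "\<dots> = (\<Sum>i<?k + ?k. (ns @ map uminus ns) ! i * ((P *\<^sub>v v) $ i)\<^sup>2)"
    using P(1) v(1) by (subst qf_eval_diagonal) auto
  also have "\<dots> = (\<Sum>i<?k. ns ! i * ((P *\<^sub>v v) $ i)\<^sup>2) +
      (\<Sum>i<?k. (ns @ map uminus ns) ! (?k + i) * ((P *\<^sub>v v) $ (?k + i))\<^sup>2)"
    unfolding sum_lessThan_add by (simp add: nth_append)
  also have "\<dots> = 0" using eq by (simp add: nth_append sum_negf)
  finally show False using anisotropicD[OF assms(1,2) v(1)] v(2) by blast
qed

section \<open>Leading terms and square classes of iterated Laurent series\<close>

lemma laurent_mult_zero_fun [simp]:
  "laurent_mult (\<lambda>_. 0) g = (\<lambda>_. 0)" "laurent_mult f (\<lambda>_. 0) = (\<lambda>_. 0)"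
  by auto

lemma laurent_least_slice:
  assumes "f \<in> laurent_coeffs (Suc n)" "f \<noteq> (\<lambda>_. 0)"
  obtains N where "slice f N \<noteq> (\<lambda>_. 0)" "\<forall>k<N. slice f k = (\<lambda>_. 0)"
proof -
  from assms(1) obtain A where A: "\<forall>k<A. slice f k = (\<lambda>_. 0)" by auto
  have "\<exists>k. slice f k \<noteq> (\<lambda>_. 0)"
  proof (rule ccontr)
    assume "\<not> ?thesis"
    then have "f e = 0" for e using assms(1) by (cases e) (auto simp: slice_def fun_eq_iff)
    then show False using assms(2) by auto
  qed
  then obtain k0 where k0: "slice f k0 \<noteq> (\<lambda>_. 0)" by blast
  \<comment> \<open>Indices are shifted by the lower bound \<open>A\<close> so that the least number
    principle on the naturals applies.\<close>
  then have "slice f (A + int (nat (k0 - A))) \<noteq> (\<lambda>_. 0)"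
    using A by (cases "k0 < A") auto
  then obtain m where m: "slice f (A + int m) \<noteq> (\<lambda>_. 0)"
    "\<And>m'. m' < m \<Longrightarrow> slice f (A + int m') = (\<lambda>_. 0)"
    using exists_least_iff[of "\<lambda>m. slice f (A + int m) \<noteq> (\<lambda>_. 0)"] by blast
  have "slice f k = (\<lambda>_. 0)" if "k < A + int m" for k
    using that A m(2)[of "nat (k - A)"] by (cases "k < A") auto
  with m(1) that show ?thesis by blast
qed

text \<open>This is the valuation of rank n with values in \<int>^n ordered lexicographically, the
  outermost variable first. The minimum is found one coordinate at a time.\<close>

lemma laurent_leading_exponent:
  "f \<in> laurent_coeffs n \<Longrightarrow> f \<noteq> (\<lambda>_. 0) \<Longrightarrow> \<exists>d. length d = n \<and> f d \<noteq> 0 \<and> (\<forall>e<d. f e = 0)"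
proof (induction n arbitrary: f)
  case 0
  then have "f [] \<noteq> 0" by auto (metis ext)
  then show ?case by auto
next
  case (Suc n)
  obtain N where N: "slice f N \<noteq> (\<lambda>_. 0)" "\<forall>k<N. slice f k = (\<lambda>_. 0)"
    by (rule laurent_least_slice[OF Suc.prems])
  have "slice f N \<in> laurent_coeffs n" using Suc.prems by auto
  from Suc.IH[OF this N(1)] obtain d where d: "length d = n" "slice f N d \<noteq> 0"
    "\<forall>e<d. slice f N e = 0" by blast
  \<comment> \<open>This includes e = [], which lies below every nonempty list; there
    \<open>f\<close> vanishes by definition of \<open>laurent_coeffs\<close>.\<close>
  have "f e = 0" if "e < N # d" for e
    using that d(3) N(2) Suc.prems(1) by (cases e) (auto simp: slice_def fun_eq_iff)
  then show ?case using d by (intro exI[of _ "N # d"]) (auto simp: slice_def)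
qed

definition exp_add :: "int list \<Rightarrow> int list \<Rightarrow> int list" (infixl "\<oplus>" 65) where
  "d \<oplus> e = map2 (+) d e"

lemma exp_add_simps [simp]:
  "[] \<oplus> e = []" "(k # d) \<oplus> (j # e) = (k + j) # (d \<oplus> e)"
  by (simp_all add: exp_add_def)

lemma length_exp_add [simp]: "length (d \<oplus> e) = min (length d) (length e)"
  by (simp add: exp_add_def)

lemma laurent_mult_leading:
  assumes "f \<in> laurent_coeffs n" "g \<in> laurent_coeffs n" "length d = n" "length d' = n"
    and "\<forall>e<d. f e = 0" "\<forall>e<d'. g e = 0"
  shows "laurent_mult f g (d \<oplus> d') = f d * g d'" "\<forall>e<d \<oplus> d'. laurent_mult f g e = 0"
proof -
  have "laurent_mult f g (d \<oplus> d') = f d * g d' \<and> (\<forall>e<d \<oplus> d'. laurent_mult f g e = 0)"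
    using assms
  proof (induction n arbitrary: f g d d')
    case (Suc n)
    obtain k c k' c' where d: "d = k # c" "length c = n" and d': "d' = k' # c'" "length c' = n"
      using Suc.prems(3,4) by (metis length_Suc_conv)
    have f0: "\<forall>i<k. slice f i = (\<lambda>_. 0)" and g0: "\<forall>i<k'. slice g i = (\<lambda>_. 0)"
      using Suc.prems(5,6) by (auto simp: slice_def d d')
    have IH: "laurent_mult (slice f k) (slice g k') (c \<oplus> c') = slice f k c * slice g k' c' \<and>
        (\<forall>e<c \<oplus> c'. laurent_mult (slice f k) (slice g k') e = 0)"
      using Suc.prems d d' by (intro Suc.IH) (auto simp: slice_def)
    have w: "laurent_mult f g (i # e) = (\<Sum>j\<in>{k..i - k'}. laurent_mult (slice f j) (slice g (i - j)) e)"
      for i e by (rule laurent_mult_window[OF f0 g0]) auto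
    have "laurent_mult f g e = 0" if e: "e < d \<oplus> d'" for e
    proof (cases e)
      case Nil
      then show ?thesis using Suc.prems(1) by auto
    next
      case (Cons i e')
      then have "i < k + k' \<or> i = k + k' \<and> e' < c \<oplus> c'" using e d d' by auto
      \<comment> \<open>For i < k + k' the summation range is empty; for i = k + k' it consists of j
        = k only.\<close>
      then show ?thesis unfolding Cons w using IH by auto
    qed
    moreover have "laurent_mult f g (d \<oplus> d') = f d * g d'"
      using IH w[of "k + k'" "c \<oplus> c'"] d d' by (simp del: laurent_mult.simps add: slice_def)
    ultimately show ?case by blast
  qed simp
  then show "laurent_mult f g (d \<oplus> d') = f d * g d'" "\<forall>e<d \<oplus> d'. laurent_mult f g e = 0" by auto
qed

section \<open>Square roots and square classes\<close>

definition single_slice :: "int \<Rightarrow> (int list \<Rightarrow> 'a::zero) \<Rightarrow> int list \<Rightarrow> 'a" where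
  "single_slice j g e = (case e of [] \<Rightarrow> 0 | k # e' \<Rightarrow> if k = j then g e' else 0)"

lemma single_slice_simps [simp]:
  "single_slice j g [] = 0" "single_slice j g (k # e) = (if k = j then g e else 0)"
  by (auto simp: single_slice_def)

lemma slice_single_slice: "slice (single_slice j g) k = (if k = j then g else (\<lambda>_. 0))"
  by (auto simp: slice_def)

lemma single_slice_coeffs: "g \<in> laurent_coeffs n \<Longrightarrow> single_slice j g \<in> laurent_coeffs (Suc n)"
  by (rule laurent_coeffs_SucI[of _ _ j]) (auto simp: slice_single_slice laurent_coeffs_zero)

lemma laurent_monom_Cons: "laurent_monom (k # d) c = single_slice k (laurent_monom d c)"
proof
  fix e show "laurent_monom (k # d) c e = single_slice k (laurent_monom d c) e"
    by (cases e) (auto simp: laurent_monom_def)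
qed

lemma laurent_mult_single_slice:
  "laurent_mult f (single_slice j g) (k # e) = laurent_mult (slice f (k - j)) g e"
proof -
  have "laurent_mult f (single_slice j g) (k # e) =
      (\<Sum>i\<in>{k - j}. laurent_mult (slice f i) (slice (single_slice j g) (k - i)) e)"
    unfolding laurent_mult.simps
    by (rule sum.mono_neutral_left) (auto simp: slice_single_slice split: if_splits)
  then show ?thesis by (simp add: slice_single_slice)
qed

lemma laurent_mult_single_slices:
  "laurent_mult (single_slice i f) (single_slice j g) = single_slice (i + j) (laurent_mult f g)"
proof
  fix e show "laurent_mult (single_slice i f) (single_slice j g) e =
      single_slice (i + j) (laurent_mult f g) e"
  proof (cases e)
    case (Cons k e')
    show ?thesis unfolding Cons laurent_mult_single_slice by (auto simp: slice_single_slice)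
  qed simp
qed

lemma laurent_mult_monoms:
  "length d = length e \<Longrightarrow>
   laurent_mult (laurent_monom d a) (laurent_monom e b) = laurent_monom (d \<oplus> e) (a * b)"
proof (induction d e rule: list_induct2)
  case Nil
  have "laurent_mult (laurent_monom [] a) (laurent_monom [] b) e = a * laurent_monom [] b e" for e
    using laurent_mult_monom_left[of "laurent_monom [] b" 0 a e] laurent_coeffs_monom[of "[]" b] by simp
  then show ?case by (auto simp: laurent_monom_def fun_eq_iff)
next
  case (Cons k d j e)
  then show ?case by (simp add: laurent_monom_Cons laurent_mult_single_slices)
qed

lemma laurent_mult_one:
  "f \<in> laurent_coeffs n \<Longrightarrow> laurent_mult (laurent_monom (replicate n 0) 1) f = f"
  using laurent_mult_monom_left[of f n 1] by auto

text \<open>Comparing coefficients of x^s in h^2 = u, for the outermost variable x, expresses 2 h_s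
  through u_s and earlier coefficients of h. Since h_0 = 1 and 2 is invertible, the recursion can be
  solved.\<close>

lemma laurent_one_unit_sqrt:
  fixes u :: "int list \<Rightarrow> 'a::field"
  assumes two: "(2::'a) \<noteq> 0" and u: "u \<in> laurent_coeffs (Suc n)"
    and u0: "slice u 0 = laurent_monom (replicate n 0) 1" and neg: "\<forall>k<0. slice u k = (\<lambda>_. 0)"
  obtains h where "h \<in> laurent_coeffs (Suc n)" "laurent_mult h h = u"
proof -
  define one :: "int list \<Rightarrow> 'a" where "one = laurent_monom (replicate n 0) 1"
  have one: "one \<in> laurent_coeffs n"
    using laurent_coeffs_monom[of "replicate n 0"] by (simp add: one_def)
  \<comment> \<open>the coefficients of the square root, by comparing coefficients\<close>
  define R where "R s H = (if s = 0 then one else (\<lambda>e. inverse 2 *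
     (slice u (int s) e - (\<Sum>j\<in>{1..<s}. laurent_mult (H j) (H (s - j)) e))))" for s H
  define H where "H = wfrec {(x::nat, y). x < y} (\<lambda>h s. R s h)"
  have H: "H s = R s H" for s
  proof -
    have "H s = R s (cut H {(x, y). x < y} s)"
      unfolding H_def by (rule wfrec[OF wf])
    also have "\<dots> = R s H"
      unfolding R_def by (auto simp: cut_apply fun_eq_iff intro!: sum.cong)
    finally show ?thesis .
  qed
  have scal: "(\<lambda>e. c * f e) \<in> laurent_coeffs n" if "f \<in> laurent_coeffs n" for c :: 'a and f
  proof -
    have "laurent_mult (laurent_monom (replicate n 0) c) f = (\<lambda>e. c * f e)"
      using laurent_mult_monom_left[OF that] by auto
    then show ?thesis
      using laurent_mult_closed[OF _ that, of "laurent_monom (replicate n 0) c"]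
        laurent_coeffs_monom[of "replicate n 0" c] by simp
  qed
  have sl: "slice u k \<in> laurent_coeffs n" for k using u by auto
  have Hcl: "H s \<in> laurent_coeffs n" for s
  proof (induction s rule: less_induct)
    case (less s)
    have "(\<lambda>e. slice u (int s) e + - (\<Sum>j\<in>{1..<s}. laurent_mult (H j) (H (s - j)) e)) \<in> laurent_coeffs n"
      by (intro laurent_coeffs_add sl laurent_coeffs_uminus laurent_coeffs_sum laurent_mult_closed less) auto
    from scal[OF this, of "inverse 2"] show ?case
      by (subst H, unfold R_def) (auto simp: one)
  qed
  define h where "h e = (case e of [] \<Rightarrow> 0 | k # d \<Rightarrow> if k < 0 then 0 else H (nat k) d)" for e
  have slh: "slice h k = (if k < 0 then (\<lambda>_. 0) else H (nat k))" for k
    by (auto simp: slice_def h_def)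
  have h0: "\<forall>k<0. slice h k = (\<lambda>_. 0)" by (simp add: slh)
  have h: "h \<in> laurent_coeffs (Suc n)"
    by (rule laurent_coeffs_SucI[OF _ _ h0]) (auto simp: slh Hcl laurent_coeffs_zero, simp add: h_def)
  have "laurent_mult h h e = u e" for e
  proof (cases e)
    case Nil
    then show ?thesis using u by (simp add: h_def)
  next
    case (Cons k d)
    have w: "laurent_mult h h (k # d) = (\<Sum>i\<in>{0..k}. laurent_mult (slice h i) (slice h (k - i)) d)"
      by (rule laurent_mult_window[OF h0 h0]) auto
    show ?thesis
    proof (cases "k < 0")
      case True
      then show ?thesis unfolding Cons w using neg by (auto simp: slice_def fun_eq_iff)
    next
      case False
      define s where "s = nat k"
      have k: "k = int s" using False by (simp add: s_def)
      have "laurent_mult h h (k # d) = (\<Sum>j\<le>s. laurent_mult (H j) (H (s - j)) d)"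
        unfolding w
        by (rule sum.reindex_bij_witness[of _ int nat]) (auto simp: slh k nat_diff_distrib)
      also have "\<dots> = slice u (int s) d"
      proof (cases "s = 0")
        case True
        then show ?thesis using laurent_mult_one[OF one] by (simp add: H R_def u0 one_def)
      next
        case False
        have H0: "H 0 = one" by (simp add: H R_def)
        \<comment> \<open>The two end terms are the ones that contain \<open>H s\<close>; together
          they give 2 \<open>H s\<close>.\<close>
        have "{..s} = insert 0 (insert s {1..<s})" by auto
        then have "(\<Sum>j\<le>s. laurent_mult (H j) (H (s - j)) d) = laurent_mult (H 0) (H s) d +
            (laurent_mult (H s) (H 0) d + (\<Sum>j\<in>{1..<s}. laurent_mult (H j) (H (s - j)) d))"
          using False by simp
        also have "\<dots> = 2 * H s d + (\<Sum>j\<in>{1..<s}. laurent_mult (H j) (H (s - j)) d)"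
          unfolding H0 laurent_mult_commute[of "H s" one]
          using laurent_mult_one[OF Hcl[of s]] by (simp add: one_def)
        also have "2 * H s d = slice u (int s) d - (\<Sum>j\<in>{1..<s}. laurent_mult (H j) (H (s - j)) d)"
          using False two by (subst H) (simp add: R_def mult.assoc[symmetric])
        finally show ?thesis by simp
      qed
      finally show ?thesis by (simp only: Cons k slice_def)
    qed
  qed
  with h that show ?thesis by blast
qed

lemma laurent_mult_left_commute:
  assumes "f \<in> laurent_coeffs n" "g \<in> laurent_coeffs n" "h \<in> laurent_coeffs n"
  shows "laurent_mult f (laurent_mult g h) = laurent_mult g (laurent_mult f h)"
proof -
  have c: "laurent_mult f g = laurent_mult g f" using laurent_mult_commute by blast
  show ?thesis
    using laurent_mult_assoc[OF assms] laurent_mult_assoc[OF assms(2,1,3)] c by (metis ext)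
qed

text \<open>With x the outermost variable, split f as x^N g u, where g is the lowest nonzero slice
  and u has constant slice 1. Then u is a square, and g is a monomial times a square by
  induction.\<close>

lemma laurent_square_class:
  fixes f :: "int list \<Rightarrow> 'a::field"
  assumes "(2::'a) \<noteq> 0" "f \<in> laurent_coeffs n" "f \<noteq> (\<lambda>_. 0)"
  shows "\<exists>a d s. a \<noteq> 0 \<and> length d = n \<and> s \<in> laurent_coeffs n \<and>
    f = laurent_mult (laurent_monom d a) (laurent_mult s s)"
  using assms(2,3)
proof (induction n arbitrary: f)
  case 0
  then have nz: "f [] \<noteq> 0" by auto (metis ext)
  have s: "laurent_monom [] (1::'a) \<in> laurent_coeffs 0" using laurent_coeffs_monom[of "[]"] by simp
  have "f = laurent_monom [] (f [])" using 0 by (auto simp: laurent_monom_def fun_eq_iff)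
  also have "\<dots> = laurent_mult (laurent_monom [] (f []))
      (laurent_mult (laurent_monom [] 1) (laurent_monom [] 1))"
    by (simp add: laurent_mult_monoms)
  finally show ?case using nz s by (metis list.size(3))
next
  case (Suc n)
  obtain N where N: "slice f N \<noteq> (\<lambda>_. 0)" "\<forall>k<N. slice f k = (\<lambda>_. 0)"
    by (rule laurent_least_slice[OF Suc.prems])
  define g where "g = slice f N"
  have g: "g \<in> laurent_coeffs n" "g \<noteq> (\<lambda>_. 0)" using Suc.prems N(1) by (auto simp: g_def)
  from Suc.IH[OF this] obtain a d s where ads: "a \<noteq> 0" "length d = n" "s \<in> laurent_coeffs n"
    "g = laurent_mult (laurent_monom d a) (laurent_mult s s)" by blast
  obtain b where b: "b \<in> laurent_coeffs n" "laurent_mult g b = laurent_monom (replicate n 0) 1"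
    using laurent_inverse_exists[OF g] by blast
  \<comment> \<open>Division of f by x^N g, where b is the inverse of g.\<close>
  define u where "u = laurent_mult f (single_slice (- N) b)"
  have b': "single_slice (- N) b \<in> laurent_coeffs (Suc n)" by (rule single_slice_coeffs[OF b(1)])
  have u: "u \<in> laurent_coeffs (Suc n)"
    unfolding u_def by (rule laurent_mult_closed[OF Suc.prems(1) b'])
  have slu: "slice u k = laurent_mult (slice f (k + N)) b" for k
    unfolding u_def slice_def[of "laurent_mult _ _"] laurent_mult_single_slice by simp
  obtain h where h: "h \<in> laurent_coeffs (Suc n)" "laurent_mult h h = u"
  proof (rule laurent_one_unit_sqrt[OF assms(1) u])
    show "slice u 0 = laurent_monom (replicate n 0) 1" unfolding slu using b(2) by (simp add: g_def)
    show "\<forall>k<0. slice u k = (\<lambda>_. 0)" unfolding slu using N(2) by simp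
  qed
  \<comment> \<open>The decomposition will be f = M (L h)^2, with L the root s of the square part of
    g, viewed as constant in the outermost variable.\<close>
  define M where "M = single_slice N (laurent_monom d a)"
  define L where "L = single_slice 0 s"
  have L: "L \<in> laurent_coeffs (Suc n)" unfolding L_def by (rule single_slice_coeffs[OF ads(3)])
  have M: "M \<in> laurent_coeffs (Suc n)"
    unfolding M_def using laurent_coeffs_monom[of d a] ads(2) by (intro single_slice_coeffs) simp
  have Lh: "laurent_mult L h \<in> laurent_coeffs (Suc n)" by (rule laurent_mult_closed[OF L h(1)])
  have g': "single_slice N g \<in> laurent_coeffs (Suc n)" by (rule single_slice_coeffs[OF g(1)])
  have "laurent_mult (laurent_mult L h) (laurent_mult L h) = laurent_mult L (laurent_mult h (laurent_mult L h))"
    using laurent_mult_assoc[OF L h(1) Lh] by auto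
  also have "\<dots> = laurent_mult L (laurent_mult L u)"
    unfolding laurent_mult_left_commute[OF h(1) L h(1)] h(2) ..
  also have "\<dots> = laurent_mult (laurent_mult L L) u"
    using laurent_mult_assoc[OF L L u] by auto
  finally have "laurent_mult M (laurent_mult (laurent_mult L h) (laurent_mult L h)) =
      laurent_mult (laurent_mult M (laurent_mult L L)) u"
    using laurent_mult_assoc[OF M laurent_mult_closed[OF L L] u] by auto
  also have "laurent_mult M (laurent_mult L L) = single_slice N g"
    unfolding M_def L_def laurent_mult_single_slices ads(4) by simp
  also have "laurent_mult (single_slice N g) u = laurent_mult f (laurent_mult (single_slice N g) (single_slice (- N) b))"
    unfolding u_def by (rule laurent_mult_left_commute[OF g' Suc.prems(1) b'])
  also have "\<dots> = laurent_mult f (laurent_monom (replicate (Suc n) 0) 1)"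
    by (simp add: laurent_mult_single_slices b(2) laurent_monom_Cons)
  also have "\<dots> = f"
    using laurent_mult_one[OF Suc.prems(1)] laurent_mult_commute by (metis ext)
  finally have "f = laurent_mult (laurent_monom (N # d) a) (laurent_mult (laurent_mult L h) (laurent_mult L h))"
    by (simp only: M_def laurent_monom_Cons)
  then show ?case using ads(1,2) Lh by (metis length_Cons)
qed

section \<open>Exponents modulo 2\<close>

definition same_class :: "int list \<Rightarrow> int list \<Rightarrow> bool" where
  "same_class = list_all2 (\<lambda>x y. even (x - y))"

definition half_diff :: "int list \<Rightarrow> int list \<Rightarrow> int list" where
  "half_diff = map2 (\<lambda>x y. (x - y) div 2)"

lemma same_class_half_diff: "same_class e d \<Longrightarrow> d \<oplus> (half_diff e d \<oplus> half_diff e d) = e"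
  unfolding same_class_def half_diff_def
  by (induction rule: list_all2_induct) auto

lemma same_class_add_double:
  "length d = length h \<Longrightarrow> same_class (d \<oplus> (h \<oplus> h)) d \<and> half_diff (d \<oplus> (h \<oplus> h)) d = h"
  by (induction d h rule: list_induct2) (auto simp: same_class_def half_diff_def)

text \<open>Doubling and translation are strictly monotone for the lexicographic order, so terms x^d
  w^2 can be compared through the leading exponents of w.\<close>

lemma exp_add_double_less:
  "length d = length h \<Longrightarrow> length h = length v \<Longrightarrow>
   d \<oplus> (h \<oplus> h) < d \<oplus> (v \<oplus> v) \<longleftrightarrow> h < v"
  by (induction d h v rule: list_induct3) auto

lemma same_class_length: "same_class d e \<Longrightarrow> length d = length e"
  unfolding same_class_def by (rule list_all2_lengthD)

lemma same_class_refl: "same_class d d"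
  by (simp add: same_class_def list_all2_refl)

lemma same_class_sym: "same_class d e \<Longrightarrow> same_class e d"
  unfolding same_class_def by (induction rule: list_all2_induct) auto

lemma same_class_trans: "same_class d e \<Longrightarrow> same_class e f \<Longrightarrow> same_class d f"
  by (auto simp: same_class_def list_all2_conv_all_nth)

lemma same_class_add_left:
  "length c = length d \<Longrightarrow> length d = length e \<Longrightarrow> same_class (c \<oplus> d) (c \<oplus> e) \<longleftrightarrow> same_class d e"
  unfolding same_class_def by (induction c d e rule: list_induct3) auto

text \<open>The value is immaterial unless \<open>d\<close> has length \<open>CARD('n)\<close>.\<close>

definition laurent_term :: "'a::field \<Rightarrow> int list \<Rightarrow> ('a, 'n::finite) iter_laurent" where
  "laurent_term a d = Abs_iter_laurent (laurent_monom d a)"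

lemma Rep_laurent_term:
  assumes "length d = CARD('n::finite)"
  shows "Rep_iter_laurent (laurent_term a d :: ('a::field, 'n) iter_laurent) = laurent_monom d a"
  unfolding laurent_term_def
  by (rule Abs_iter_laurent_inverse) (use laurent_coeffs_monom[of d a] assms in simp)

lemma Rep_mult: "Rep_iter_laurent (f * g) = laurent_mult (Rep_iter_laurent f) (Rep_iter_laurent g)"
  by (simp add: times_iter_laurent.rep_eq)

lemma laurent_term_mult:
  assumes "length d = CARD('n::finite)" "length e = CARD('n)"
  shows "laurent_term a d * laurent_term b e = (laurent_term (a * b) (d \<oplus> e) :: ('a::field, 'n) iter_laurent)"
proof -
  have "Rep_iter_laurent (laurent_term a d * laurent_term b e :: ('a, 'n) iter_laurent)
      = Rep_iter_laurent (laurent_term (a * b) (d \<oplus> e) :: ('a, 'n) iter_laurent)"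
    using assms by (simp add: Rep_mult Rep_laurent_term laurent_mult_monoms)
  then show ?thesis by (simp add: Rep_iter_laurent_inject)
qed

lemma Rep_laurent_const:
  "Rep_iter_laurent (laurent_const a :: ('a::field, 'n::finite) iter_laurent) =
   laurent_monom (replicate CARD('n) 0) a"
  by (rule laurent_const.rep_eq)

lemma Rep_mult_const:
  fixes f :: "('a::field, 'n::finite) iter_laurent"
  shows "Rep_iter_laurent (f * laurent_const c) e = Rep_iter_laurent f e * c"
  unfolding Rep_mult Rep_laurent_const laurent_mult_commute[of "Rep_iter_laurent f"]
  by (subst laurent_mult_monom_left[OF Rep_iter_laurent]) (rule mult.commute)

lemma laurent_term_mult_const:
  assumes "length d = CARD('n::finite)"
  shows "laurent_term a d * laurent_const c = (laurent_term (a * c) d :: ('a::field, 'n) iter_laurent)"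
proof -
  have "Rep_iter_laurent (laurent_term a d * laurent_const c :: ('a, 'n) iter_laurent) e
      = Rep_iter_laurent (laurent_term (a * c) d :: ('a, 'n) iter_laurent) e" for e
    using assms by (simp add: Rep_mult_const Rep_laurent_term laurent_monom_def)
  then show ?thesis using Rep_iter_laurent_inject by blast
qed

lemma Rep_zero: "Rep_iter_laurent 0 = (\<lambda>_. 0)"
  by (rule zero_iter_laurent.rep_eq)

lemma Rep_eq_zero_iff: "Rep_iter_laurent f = (\<lambda>_. 0) \<longleftrightarrow> f = 0"
  using Rep_iter_laurent_inject[of f 0] by (simp add: Rep_zero)

lemma Rep_sum: "Rep_iter_laurent (\<Sum>i\<in>S. F i) e = (\<Sum>i\<in>S. Rep_iter_laurent (F i) e)"
  by (induction S rule: infinite_finite_induct) (simp_all add: Rep_zero plus_iter_laurent.rep_eq)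

lemma laurent_term_eq_zero_iff:
  assumes "length d = CARD('n::finite)"
  shows "(laurent_term a d :: ('a::field, 'n) iter_laurent) = 0 \<longleftrightarrow> a = 0"
  by (subst Rep_eq_zero_iff[symmetric]) (auto simp: Rep_laurent_term[OF assms] laurent_monom_def fun_eq_iff)

lemma iter_laurent_square_class:
  fixes f :: "('a::field, 'n::finite) iter_laurent"
  assumes "(2::'a) \<noteq> 0" "f \<noteq> 0"
  obtains a d s where "a \<noteq> 0" "length d = CARD('n)" "s \<noteq> 0" "f = laurent_term a d * s\<^sup>2"
proof -
  have "Rep_iter_laurent f \<noteq> (\<lambda>_. 0)" using assms(2) Rep_eq_zero_iff by blast
  from laurent_square_class[OF assms(1) Rep_iter_laurent this] obtain a d s where
    ads: "a \<noteq> 0" "length d = CARD('n)" "s \<in> laurent_coeffs CARD('n)"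
    "Rep_iter_laurent f = laurent_mult (laurent_monom d a) (laurent_mult s s)" by blast
  define t :: "('a, 'n) iter_laurent" where "t = Abs_iter_laurent s"
  have "Rep_iter_laurent t = s" unfolding t_def by (rule Abs_iter_laurent_inverse[OF ads(3)])
  then have "Rep_iter_laurent f = Rep_iter_laurent (laurent_term a d * t\<^sup>2)"
    using ads by (simp add: power2_eq_square Rep_mult Rep_laurent_term)
  then have "f = laurent_term a d * t\<^sup>2" by (simp add: Rep_iter_laurent_inject)
  moreover from this have "t \<noteq> 0" using assms(2) by auto
  ultimately show ?thesis using ads that by blast
qed

definition leading_exp :: "('a::field, 'n::finite) iter_laurent \<Rightarrow> int list" where
  "leading_exp f = (SOME d. length d = CARD('n) \<and> Rep_iter_laurent f d \<noteq> 0 \<and>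
     (\<forall>e<d. Rep_iter_laurent f e = 0))"

lemma leading_exp:
  fixes f :: "('a::field, 'n::finite) iter_laurent"
  assumes "f \<noteq> 0"
  shows "length (leading_exp f) = CARD('n)" "Rep_iter_laurent f (leading_exp f) \<noteq> 0"
    "\<forall>e<leading_exp f. Rep_iter_laurent f e = 0"
proof -
  have "\<exists>d. length d = CARD('n) \<and> Rep_iter_laurent f d \<noteq> 0 \<and> (\<forall>e<d. Rep_iter_laurent f e = 0)"
    using laurent_leading_exponent[OF Rep_iter_laurent, of f] assms Rep_eq_zero_iff by blast
  from someI_ex[OF this] show "length (leading_exp f) = CARD('n)"
    "Rep_iter_laurent f (leading_exp f) \<noteq> 0" "\<forall>e<leading_exp f. Rep_iter_laurent f e = 0"
    unfolding leading_exp_def by blast+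
qed

lemma Rep_term_square:
  fixes w :: "('a::field, 'n::finite) iter_laurent"
  assumes "length d = CARD('n)" "length v = CARD('n)" "\<forall>e<v. Rep_iter_laurent w e = 0"
  shows "Rep_iter_laurent (laurent_term a d * w\<^sup>2) (d \<oplus> (v \<oplus> v)) = a * (Rep_iter_laurent w v)\<^sup>2"
    and "\<forall>e<d \<oplus> (v \<oplus> v). Rep_iter_laurent (laurent_term a d * w\<^sup>2) e = 0"
proof -
  let ?w = "Rep_iter_laurent w"
  have w: "?w \<in> laurent_coeffs CARD('n)" by (rule Rep_iter_laurent)
  have m: "laurent_monom d a \<in> laurent_coeffs CARD('n)"
    using laurent_coeffs_monom[of d a] assms(1) by simp
  have R: "Rep_iter_laurent (laurent_term a d * w\<^sup>2) = laurent_mult (laurent_monom d a) (laurent_mult ?w ?w)"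
    by (simp add: power2_eq_square Rep_mult Rep_laurent_term[OF assms(1)])
  note ww = laurent_mult_leading[OF w w assms(2,2,3,3)]
  have l: "length (v \<oplus> v) = CARD('n)" using assms(2) by simp
  have m0: "\<forall>e<d. laurent_monom d a e = 0" by (auto simp: laurent_monom_def)
  note mw = laurent_mult_leading[OF m laurent_mult_closed[OF w w] assms(1) l m0 ww(2)]
  show "Rep_iter_laurent (laurent_term a d * w\<^sup>2) (d \<oplus> (v \<oplus> v)) = a * (?w v)\<^sup>2"
    unfolding R mw(1) ww(1) by (simp add: laurent_monom_def power2_eq_square)
  show "\<forall>e<d \<oplus> (v \<oplus> v). Rep_iter_laurent (laurent_term a d * w\<^sup>2) e = 0"
    unfolding R by (rule mw(2))
qed

text \<open>When e lies at or below the leading exponent of every summand, a summand contributes at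
  e at most through its leading term; strictly below it, both the summand and the coefficient of
  \<open>w j\<close> at \<open>half_diff e (d j)\<close> vanish. So extracting the coefficient at e
  gives a value of the residue form.\<close>

lemma Rep_diagonal_sum:
  fixes w :: "'j \<Rightarrow> ('a::field, 'n::finite) iter_laurent"
  assumes J: "finite J" and d: "\<And>j. j \<in> J \<Longrightarrow> length (d j) = CARD('n)"
    and e: "length e = CARD('n)"
      "\<And>j. j \<in> J \<Longrightarrow> w j \<noteq> 0 \<Longrightarrow> e \<le> d j \<oplus> (leading_exp (w j) \<oplus> leading_exp (w j))"
  shows "Rep_iter_laurent (\<Sum>j\<in>J. laurent_term (a j) (d j) * (w j)\<^sup>2) e =
    (\<Sum>j | j \<in> J \<and> same_class e (d j). a j * (Rep_iter_laurent (w j) (half_diff e (d j)))\<^sup>2)"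
proof -
  have "Rep_iter_laurent (laurent_term (a j) (d j) * (w j)\<^sup>2) e =
      (if same_class e (d j) then a j * (Rep_iter_laurent (w j) (half_diff e (d j)))\<^sup>2 else 0)"
    if j: "j \<in> J" for j
  proof (cases "w j = 0")
    case False
    note vj = leading_exp(1,3)[OF False]
    note T = Rep_term_square[OF d[OF j] vj, of "a j"]
    let ?v = "leading_exp (w j)"
    let ?m = "d j \<oplus> (?v \<oplus> ?v)"
    have sc: "same_class ?m (d j) \<and> half_diff ?m (d j) = ?v"
      using d[OF j] vj by (intro same_class_add_double) simp
    show ?thesis
    proof (cases "e = ?m")
      case True
      then show ?thesis using T(1) sc by simp
    next
      case False
      then have less: "e < ?m" using e(2)[OF j \<open>w j \<noteq> 0\<close>] by simp
      have "Rep_iter_laurent (w j) (half_diff e (d j)) = 0" if c: "same_class e (d j)"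
      proof -
        have "length (half_diff e (d j)) = CARD('n)" using e(1) d[OF j] by (simp add: half_diff_def)
        then have "half_diff e (d j) < ?v"
          using less same_class_half_diff[OF c] exp_add_double_less[of "d j" "half_diff e (d j)" ?v]
            vj d[OF j] by simp
        then show ?thesis using vj by blast
      qed
      then show ?thesis using T(2) less by auto
    qed
  qed (simp add: Rep_zero)
  then have "Rep_iter_laurent (\<Sum>j\<in>J. laurent_term (a j) (d j) * (w j)\<^sup>2) e =
      (\<Sum>j\<in>J. if same_class e (d j) then a j * (Rep_iter_laurent (w j) (half_diff e (d j)))\<^sup>2 else 0)"
    unfolding Rep_sum by (intro sum.cong) auto
  also have "\<dots> = (\<Sum>j | j \<in> J \<and> same_class e (d j). a j * (Rep_iter_laurent (w j) (half_diff e (d j)))\<^sup>2)"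
    by (rule sum.inter_filter[OF J, symmetric])
  finally show ?thesis .
qed

text \<open>
  Terms with exponents in different classes modulo 2 cannot cancel, and cancellation of leading terms
  within a class is excluded by anisotropy of the residue form.
\<close>

lemma diagonal_sum_leading:
  fixes w :: "'j \<Rightarrow> ('a::field, 'n::finite) iter_laurent"
  assumes J: "finite J" and d: "\<And>j. j \<in> J \<Longrightarrow> length (d j) = CARD('n)"
    and aniso: "\<And>e u. (\<Sum>j | j \<in> J \<and> same_class e (d j). a j * (u j)\<^sup>2) = 0 \<Longrightarrow>
      \<forall>j\<in>J. same_class e (d j) \<longrightarrow> u j = 0"
    and ex: "j0 \<in> J" "w j0 \<noteq> 0"
  shows "\<exists>m. length m = CARD('n) \<and>
    Rep_iter_laurent (\<Sum>j\<in>J. laurent_term (a j) (d j) * (w j)\<^sup>2) m \<noteq> 0 \<and>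
    (\<forall>j\<in>J. w j \<noteq> 0 \<longrightarrow> m \<le> d j \<oplus> (leading_exp (w j) \<oplus> leading_exp (w j)))"
proof -
  define v where "v j = leading_exp (w j)" for j
  note v = leading_exp[of "w j" for j, folded v_def]
  let ?S = "{j \<in> J. w j \<noteq> 0}"
  \<comment> \<open>The lowest leading exponent of a single summand. The coefficient at m is a value
    of the residue form of its class, at a vector whose coordinate i is nonzero, where i attains the
    minimum.\<close>
  define m where "m = Min ((\<lambda>j. d j \<oplus> (v j \<oplus> v j)) ` ?S)"
  have S: "finite ?S" "?S \<noteq> {}" using J ex by auto
  then have "m \<in> (\<lambda>j. d j \<oplus> (v j \<oplus> v j)) ` ?S" unfolding m_def by (intro Min_in) auto
  then obtain i where i: "i \<in> J" "w i \<noteq> 0" "m = d i \<oplus> (v i \<oplus> v i)" by auto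
  have le: "m \<le> d j \<oplus> (v j \<oplus> v j)" if "j \<in> J" "w j \<noteq> 0" for j
    unfolding m_def using S that by (intro Min_le) auto
  have lm: "length m = CARD('n)" using i d v(1)[OF i(2)] by simp
  have sc: "same_class m (d i) \<and> half_diff m (d i) = v i"
    unfolding i(3) using d[OF i(1)] v(1)[OF i(2)] by (intro same_class_add_double) simp
  have "Rep_iter_laurent (\<Sum>j\<in>J. laurent_term (a j) (d j) * (w j)\<^sup>2) m =
    (\<Sum>j | j \<in> J \<and> same_class m (d j). a j * (Rep_iter_laurent (w j) (half_diff m (d j)))\<^sup>2)"
    by (intro Rep_diagonal_sum[OF J d lm le[unfolded v_def]])
  moreover have "Rep_iter_laurent (w i) (half_diff m (d i)) \<noteq> 0" using sc v(2)[OF i(2)] by simp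
  then have "\<not> (\<forall>j\<in>J. same_class m (d j) \<longrightarrow> Rep_iter_laurent (w j) (half_diff m (d j)) = 0)"
    using i(1) sc by blast
  then have "(\<Sum>j | j \<in> J \<and> same_class m (d j). a j * (Rep_iter_laurent (w j) (half_diff m (d j)))\<^sup>2) \<noteq> 0"
    using aniso[where e = m and u = "\<lambda>j. Rep_iter_laurent (w j) (half_diff m (d j))"] by blast
  ultimately have "Rep_iter_laurent (\<Sum>j\<in>J. laurent_term (a j) (d j) * (w j)\<^sup>2) m \<noteq> 0" by simp
  with lm le show ?thesis unfolding v_def by blast
qed

section \<open>Residue forms\<close>

definition laurent_entries :: "('a \<times> int list) list \<Rightarrow> ('a::field, 'n::finite) iter_laurent list" where
  "laurent_entries js = map (\<lambda>(a, d). laurent_term a d) js"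

definition residue_entries :: "int list \<Rightarrow> ('a \<times> int list) list \<Rightarrow> 'a list" where
  "residue_entries e js = map fst (filter (\<lambda>(a, d). same_class e d) js)"

lemma length_laurent_entries [simp]: "length (laurent_entries js) = length js"
  by (simp add: laurent_entries_def)

text \<open>Positions instead of entries, so that vectors for the whole form can be restricted to
  the coordinates of one class.\<close>

definition class_index :: "int list \<Rightarrow> ('a \<times> int list) list \<Rightarrow> nat list" where
  "class_index e js = filter (\<lambda>j. same_class e (snd (js ! j))) [0..<length js]"

lemma residue_entries_index: "residue_entries e js = map (\<lambda>j. fst (js ! j)) (class_index e js)"
proof -
  have "filter (\<lambda>(a, d). same_class e d) js = filter (\<lambda>(a, d). same_class e d) (map ((!) js) [0..<length js])"
    by (simp only: map_nth)
  also have "\<dots> = map ((!) js) (class_index e js)"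
    unfolding filter_map class_index_def by (simp add: o_def case_prod_beta)
  finally show ?thesis by (simp add: residue_entries_def)
qed

lemma sum_class_index:
  "(\<Sum>k<length (class_index e js). f (class_index e js ! k)) =
   (\<Sum>j | j \<in> {..<length js} \<and> same_class e (snd (js ! j)). f j)"
proof -
  have "distinct (class_index e js)" by (simp add: class_index_def)
  moreover have "set (class_index e js) = {j \<in> {..<length js}. same_class e (snd (js ! j))}"
    by (auto simp: class_index_def)
  ultimately have "bij_betw ((!) (class_index e js)) {..<length (class_index e js)}
      {j \<in> {..<length js}. same_class e (snd (js ! j))}"
    by (intro bij_betw_nth) auto
  then show ?thesis by (rule sum.reindex_bij_betw)
qed

text \<open>Anisotropy of a residue form in terms of families indexed by positions in
  \<open>js\<close>, as \<open>diagonal_sum_leading\<close> requires it.\<close>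

lemma residue_anisotropicD:
  assumes "anisotropic (mk_diagonal (residue_entries e js))"
    and z: "(\<Sum>j | j \<in> {..<length js} \<and> same_class e (snd (js ! j)). fst (js ! j) * (u j)\<^sup>2) = 0"
    and j: "j < length js" "same_class e (snd (js ! j))"
  shows "u j = (0 :: 'a::field)"
proof -
  let ?I = "class_index e js"
  let ?v = "vec (length ?I) (\<lambda>k. u (?I ! k))"
  have l: "length (residue_entries e js) = length ?I" by (simp add: residue_entries_index)
  have v: "?v \<in> carrier_vec (length (residue_entries e js))" by (simp add: l)
  have "qf_eval (mk_diagonal (residue_entries e js)) ?v =
      (\<Sum>k<length ?I. fst (js ! (?I ! k)) * (u (?I ! k))\<^sup>2)"
    unfolding qf_eval_diagonal[OF v] l by (intro sum.cong) (auto simp: residue_entries_index)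
  also have "\<dots> = 0" using sum_class_index[of "\<lambda>j. fst (js ! j) * (u j)\<^sup>2" e js] z by simp
  finally have v0: "?v = 0\<^sub>v (length (residue_entries e js))"
    by (rule anisotropicD[OF assms(1) mk_diagonal_carrier v])
  have "j \<in> set ?I" using j by (simp add: class_index_def)
  then obtain k where k: "k < length ?I" "?I ! k = j" by (auto simp: in_set_conv_nth)
  have "?v $ k = 0" unfolding v0 using k(1) l by simp
  then show ?thesis using k by simp
qed

context
  fixes js :: "('a::field \<times> int list) list"
  assumes lengths: "\<And>a d. (a, d) \<in> set js \<Longrightarrow> length d = CARD('n::finite)"
    and residues: "\<And>e. anisotropic (mk_diagonal (residue_entries e js))"
begin

lemma length_snd_nth: "j \<in> {..<length js} \<Longrightarrow> length (snd (js ! j)) = CARD('n)"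
  using lengths[of "fst (js ! j)" "snd (js ! j)"] by simp

lemma qf_eval_laurent_entries:
  fixes w :: "('a, 'n) iter_laurent vec"
  assumes "w \<in> carrier_vec (length js)"
  shows "qf_eval (mk_diagonal (laurent_entries js)) w =
    (\<Sum>j\<in>{..<length js}. laurent_term (fst (js ! j)) (snd (js ! j)) * (w $ j)\<^sup>2)"
  using assms by (subst qf_eval_diagonal) (auto simp: laurent_entries_def case_prod_beta)

lemma qf_eval_leading:
  fixes w :: "('a, 'n) iter_laurent vec"
  assumes w: "w \<in> carrier_vec (length js)" and ex: "j0 < length js" "w $ j0 \<noteq> 0"
  shows "\<exists>m. length m = CARD('n) \<and>
    Rep_iter_laurent (qf_eval (mk_diagonal (laurent_entries js)) w) m \<noteq> 0 \<and>
    (\<forall>j\<in>{..<length js}. w $ j \<noteq> 0 \<longrightarrow>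
      m \<le> snd (js ! j) \<oplus> (leading_exp (w $ j) \<oplus> leading_exp (w $ j)))"
  unfolding qf_eval_laurent_entries[OF w]
proof (rule diagonal_sum_leading)
  fix e and u :: "nat \<Rightarrow> 'a"
  assume z: "(\<Sum>j | j \<in> {..<length js} \<and> same_class e (snd (js ! j)). fst (js ! j) * (u j)\<^sup>2) = 0"
  show "\<forall>j\<in>{..<length js}. same_class e (snd (js ! j)) \<longrightarrow> u j = 0"
    using residue_anisotropicD[OF residues z] by blast
qed (use ex length_snd_nth in simp_all)

lemma anisotropic_laurent_entries:
  "anisotropic (mk_diagonal (laurent_entries js :: ('a, 'n) iter_laurent list))"
  unfolding anisotropic_def
proof (intro ballI impI)
  let ?D = "mk_diagonal (laurent_entries js :: ('a, 'n) iter_laurent list)"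
  fix w assume "w \<in> carrier_vec (dim_row ?D)" and z: "qf_eval ?D w = 0"
  then have w: "w \<in> carrier_vec (length js)" by (simp add: mk_diagonal_dim)
  have "w $ j = 0" if j: "j < length js" for j
  proof (rule ccontr)
    assume "w $ j \<noteq> 0"
    then obtain m where "Rep_iter_laurent (qf_eval ?D w) m \<noteq> 0"
      using qf_eval_leading[OF w j] by blast
    then show False using z by (simp add: Rep_zero)
  qed
  then show "w = 0\<^sub>v (dim_row ?D)" using w by (intro eq_vecI) (auto simp: mk_diagonal_dim)
qed

text \<open>
  The embedding over \<open>F\<close> takes the coefficient of \<open>x\<^sup>h\<close>, \<open>h = (d - d\<^sub>j) / 2\<close>, in each coordinate \<open>j\<close> of
  the class of \<open>d\<close>: no leading term lies below \<open>d\<close>, so this coefficient computes the value at \<open>x\<^sup>d\<close>.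
\<close>

lemma residue_embeds:
  assumes two: "(2::'a) \<noteq> 0" and d: "length d = CARD('n)"
    and emb: "embeds (mk_diagonal (map (\<lambda>q. laurent_term q d) qs))
      (mk_diagonal (laurent_entries js :: ('a, 'n) iter_laurent list))"
  shows "embeds (mk_diagonal qs) (mk_diagonal (residue_entries d js))"
proof -
  let ?D = "mk_diagonal (laurent_entries js :: ('a, 'n) iter_laurent list)"
  let ?Q = "mk_diagonal (map (\<lambda>q. laurent_term q d) qs) :: ('a, 'n) iter_laurent mat"
  let ?m = "length qs" and ?N = "length js"
  let ?I = "class_index d js" and ?E = "residue_entries d js"
  have Q: "?Q \<in> carrier_mat ?m ?m" using mk_diagonal_carrier[of "map (\<lambda>q. laurent_term q d) qs"] by simp
  have D: "?D \<in> carrier_mat ?N ?N" using mk_diagonal_carrier[of "laurent_entries js"] by simp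
  obtain P where P: "P \<in> carrier_mat ?N ?m" "transpose_mat P * (?D * P) = ?Q"
    by (rule embedsE[OF emb Q D])
  have lE: "length ?E = length ?I" by (simp add: residue_entries_index)
  have I: "?I ! k < ?N" if "k < length ?I" for k
    using nth_mem[OF that] by (auto simp: class_index_def)
  define S where "S = mat (length ?E) ?m
    (\<lambda>(k, i). Rep_iter_laurent (P $$ (?I ! k, i)) (half_diff d (snd (js ! (?I ! k)))))"
  have S: "S \<in> carrier_mat (length ?E) ?m" by (simp add: S_def)
  have "transpose_mat S * (mk_diagonal ?E * S) = mk_diagonal qs"
  proof (rule symmetric_mat_eqI[OF two _ mk_diagonal_carrier
        congruence_symmetric[OF mk_diagonal_carrier S transpose_mk_diagonal] transpose_mk_diagonal])
    show "transpose_mat S * (mk_diagonal ?E * S) \<in> carrier_mat ?m ?m"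
      using mult_carrier_mat[OF mk_diagonal_carrier S] S by auto
    fix u :: "'a vec" assume u: "u \<in> carrier_vec ?m"
    \<comment> \<open>A vector over F is lifted to constant series. Constants act on each
      coefficient separately, so extracting coefficients commutes with applying \<open>P\<close> to
      such vectors.\<close>
    define U where "U = map_vec (laurent_const :: 'a \<Rightarrow> ('a, 'n) iter_laurent) u"
    have U: "U \<in> carrier_vec ?m" using u by (simp add: U_def)
    define w where "w = P *\<^sub>v U"
    have w: "w \<in> carrier_vec ?N" unfolding w_def by (rule mult_mat_vec_carrier[OF P(1) U])
    let ?r = "\<Sum>i<?m. qs ! i * (u $ i)\<^sup>2"
    interpret field_hom "laurent_const :: 'a \<Rightarrow> ('a, 'n) iter_laurent" by (rule field_hom_laurent_const)
    have "qf_eval ?D w = qf_eval ?Q U"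
      unfolding w_def qf_eval_transform[OF P(1) D U] P(2) ..
    also have "\<dots> = (\<Sum>i<?m. laurent_term (qs ! i) d * (U $ i)\<^sup>2)"
      using U by (subst qf_eval_diagonal) auto
    also have "\<dots> = (\<Sum>i<?m. laurent_term (qs ! i * (u $ i)\<^sup>2) d)"
      using u by (intro sum.cong)
        (auto simp: U_def laurent_term_mult_const[OF d, symmetric] hom_power)
    finally have ev: "Rep_iter_laurent (qf_eval ?D w) e = (if e = d then ?r else 0)" for e
      by (simp add: Rep_sum Rep_laurent_term[OF d] laurent_monom_def)
    have le: "d \<le> snd (js ! j) \<oplus> (leading_exp (w $ j) \<oplus> leading_exp (w $ j))" if j: "j \<in> {..<?N}" "w $ j \<noteq> 0" for j
    proof -
      have "j < ?N" using j(1) by simp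
      from qf_eval_leading[OF w this j(2)] obtain m where m: "Rep_iter_laurent (qf_eval ?D w) m \<noteq> 0"
        "\<forall>j\<in>{..<length js}. w $ j \<noteq> 0 \<longrightarrow>
          m \<le> snd (js ! j) \<oplus> (leading_exp (w $ j) \<oplus> leading_exp (w $ j))"
        by blast
      \<comment> \<open>The value on \<open>U\<close> is a constant times x^d, so \<open>d\<close>
        is the only exponent at which it can be nonzero.\<close>
      have "m = d" using m(1) unfolding ev by (simp split: if_splits)
      with m(2) j show ?thesis by blast
    qed
    have "(S *\<^sub>v u) $ k = Rep_iter_laurent (w $ (?I ! k)) (half_diff d (snd (js ! (?I ! k))))"
      if k: "k < length ?I" for k
    proof -
      let ?h = "half_diff d (snd (js ! (?I ! k)))"
      have "w $ (?I ! k) = (\<Sum>i = 0..<?m. P $$ (?I ! k, i) * laurent_const (u $ i))"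
        using P(1) I[OF k] u by (simp add: w_def U_def scalar_prod_def)
      then have "Rep_iter_laurent (w $ (?I ! k)) ?h =
          (\<Sum>i = 0..<?m. Rep_iter_laurent (P $$ (?I ! k, i)) ?h * u $ i)"
        by (simp add: Rep_sum Rep_mult_const)
      also have "\<dots> = (S *\<^sub>v u) $ k" using k u by (simp add: S_def lE scalar_prod_def)
      finally show ?thesis by simp
    qed
    then have "qf_eval (mk_diagonal ?E) (S *\<^sub>v u) = (\<Sum>k<length ?I. fst (js ! (?I ! k)) *
        (Rep_iter_laurent (w $ (?I ! k)) (half_diff d (snd (js ! (?I ! k)))))\<^sup>2)"
      unfolding qf_eval_diagonal[OF mult_mat_vec_carrier[OF S u]] lE
      by (intro sum.cong) (auto simp: residue_entries_index)
    also have "\<dots> = (\<Sum>j | j \<in> {..<?N} \<and> same_class d (snd (js ! j)).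
        fst (js ! j) * (Rep_iter_laurent (w $ j) (half_diff d (snd (js ! j))))\<^sup>2)"
      by (rule sum_class_index)
    also have "\<dots> = Rep_iter_laurent (qf_eval ?D w) d"
      unfolding qf_eval_laurent_entries[OF w]
      by (rule Rep_diagonal_sum[symmetric]) (use length_snd_nth le d in auto)
    also have "\<dots> = qf_eval (mk_diagonal qs) u"
      unfolding qf_eval_diagonal[OF u] ev by simp
    finally show "qf_eval (transpose_mat S * (mk_diagonal ?E * S)) u = qf_eval (mk_diagonal qs) u"
      unfolding qf_eval_transform[OF S mk_diagonal_carrier u] .
  qed
  then show ?thesis by (rule embedsI[OF S mk_diagonal_carrier mk_diagonal_carrier])
qed

end

section \<open>Pfister forms over iterated Laurent series\<close>

text \<open>The tensor product of the monomial form \<open>zs\<close> with the constant form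
  \<open>ts\<close>, with exponents still visible so that residue forms can be read off.\<close>

definition block_entries :: "('a::field \<times> int list) list \<Rightarrow> 'a list \<Rightarrow> ('a \<times> int list) list" where
  "block_entries zs ts = concat (map (\<lambda>(a, d). map (\<lambda>t. (a * t, d)) ts) zs)"

definition distinct_classes :: "nat \<Rightarrow> ('a::field \<times> int list) list \<Rightarrow> bool" where
  "distinct_classes n zs \<longleftrightarrow> (\<forall>(a, d) \<in> set zs. a \<noteq> 0 \<and> length d = n) \<and>
     sorted_wrt (\<lambda>d e. \<not> same_class d e) (map snd zs)"

lemma laurent_entries_block:
  assumes "\<forall>(a, d) \<in> set zs. length d = CARD('n::finite)"
  shows "(laurent_entries (block_entries zs ts) :: ('a::field, 'n) iter_laurent list) =
    products (laurent_entries zs) (map laurent_const ts)"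
  using assms
proof (induction zs)
  case (Cons z zs)
  obtain a d where z: "z = (a, d)" by force
  have "length d = CARD('n)" using Cons.prems z by auto
  then have "map (\<lambda>t. laurent_term (a * t) d) ts =
      (map (\<lambda>t. laurent_term a d * laurent_const t) ts :: ('a, 'n) iter_laurent list)"
    by (simp add: laurent_term_mult_const)
  moreover have "laurent_entries (block_entries zs ts) =
      (products (laurent_entries zs) (map laurent_const ts) :: ('a, 'n) iter_laurent list)"
    using Cons.prems by (intro Cons.IH) auto
  ultimately show ?case
    by (simp add: z block_entries_def laurent_entries_def o_def case_prod_beta)
qed (simp add: block_entries_def laurent_entries_def)

lemma residue_entries_block_Cons:
  "residue_entries e (block_entries ((a, d) # zs) ts) =
   (if same_class e d then map ((*) a) ts else []) @ residue_entries e (block_entries zs ts)"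
  by (auto simp: residue_entries_def block_entries_def filter_map o_def)

lemma residue_entries_block_empty:
  "\<forall>(a, d) \<in> set zs. \<not> same_class e d \<Longrightarrow> residue_entries e (block_entries zs ts) = []"
  by (induction zs) (auto simp: residue_entries_block_Cons, simp add: residue_entries_def block_entries_def)

text \<open>At most one exponent of \<open>zs\<close> lies in the class of \<open>e\<close>, so at
  most one copy of \<open>ts\<close> survives.\<close>

lemma residue_entries_block:
  assumes "sorted_wrt (\<lambda>d e. \<not> same_class d e) (map snd zs)"
  shows "residue_entries e (block_entries zs ts) = [] \<or>
    (\<exists>(a, d) \<in> set zs. same_class e d \<and> residue_entries e (block_entries zs ts) = map ((*) a) ts)"
  using assms
proof (induction zs)
  case (Cons z zs)
  obtain a d where z: "z = (a, d)" by force
  show ?case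
  proof (cases "same_class e d")
    case True
    have "\<forall>(b, d') \<in> set zs. \<not> same_class e d'"
      using Cons.prems True z same_class_trans[OF same_class_sym[OF True]] by force
    from residue_entries_block_empty[OF this, of ts] True show ?thesis
      by (auto simp: z residue_entries_block_Cons)
  next
    case False
    then show ?thesis using Cons by (auto simp: z residue_entries_block_Cons)
  qed
qed (simp add: residue_entries_def block_entries_def)

lemma anisotropic_empty: "anisotropic (mk_diagonal ([] :: 'a::field list))"
  by (rule anisotropic_mk_diagonalI) (simp add: isotropic_list_def)

lemma length_block_snd:
  "distinct_classes n zs \<Longrightarrow> (a, d) \<in> set (block_entries zs ts) \<Longrightarrow> length d = n"
  by (auto simp: distinct_classes_def block_entries_def)

lemma residue_entries_block_anisotropic:
  assumes "distinct_classes n zs" "anisotropic (mk_diagonal ts)"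
  shows "anisotropic (mk_diagonal (residue_entries e (block_entries zs ts)))"
proof -
  have s: "sorted_wrt (\<lambda>d e. \<not> same_class d e) (map snd zs)"
    using assms(1) by (simp add: distinct_classes_def)
  show ?thesis using residue_entries_block[OF s, of e ts]
  proof
    assume "residue_entries e (block_entries zs ts) = []"
    then show ?thesis by (simp add: anisotropic_empty)
  next
    assume "\<exists>(a, d) \<in> set zs. same_class e d \<and> residue_entries e (block_entries zs ts) = map ((*) a) ts"
    then obtain a d where a: "(a, d) \<in> set zs" "residue_entries e (block_entries zs ts) = map ((*) a) ts"
      by blast
    have "a \<noteq> 0" using a(1) assms(1) by (auto simp: distinct_classes_def)
    then show ?thesis
      unfolding a(2) smult_mk_diagonal[symmetric]
      by (rule anisotropic_smult[OF assms(2) mk_diagonal_carrier])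
  qed
qed

lemma anisotropic_block:
  fixes zs :: "('a::field \<times> int list) list"
  assumes "distinct_classes CARD('n::finite) zs" "anisotropic (mk_diagonal ts)"
  shows "anisotropic (mk_diagonal
    (products (laurent_entries zs) (map laurent_const ts) :: ('a, 'n) iter_laurent list))"
proof -
  have l: "\<forall>(a, d) \<in> set zs. length d = CARD('n)"
    using assms(1) by (auto simp: distinct_classes_def)
  show ?thesis
    unfolding laurent_entries_block[OF l, symmetric]
    by (rule anisotropic_laurent_entries[OF length_block_snd[OF assms(1)]
          residue_entries_block_anisotropic[OF assms]])
qed

text \<open>A nonempty regular form cannot embed into a form of dimension 0, so the residue form at
  \<open>d\<close> is not empty and must be a multiple of \<open>ts\<close>.\<close>

lemma embeds_block:
  fixes zs :: "('a::field \<times> int list) list"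
  assumes two: "(2::'a) \<noteq> 0" and zs: "distinct_classes CARD('n::finite) zs"
    and ts: "anisotropic (mk_diagonal ts)"
    and d: "length d = CARD('n)" and qs: "qs \<noteq> []" "0 \<notin> set qs"
    and emb: "embeds (mk_diagonal (map (\<lambda>q. laurent_term q d) qs)) (mk_diagonal
      (products (laurent_entries zs) (map laurent_const ts) :: ('a, 'n) iter_laurent list))"
  shows "\<exists>(a, e) \<in> set zs. same_class d e \<and> embeds (mk_diagonal qs) (mk_diagonal (map ((*) a) ts))"
proof -
  have l: "\<forall>(a, d) \<in> set zs. length d = CARD('n)"
    and s: "sorted_wrt (\<lambda>d e. \<not> same_class d e) (map snd zs)"
    using zs by (auto simp: distinct_classes_def)
  have e: "embeds (mk_diagonal qs) (mk_diagonal (residue_entries d (block_entries zs ts)))"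
    by (rule residue_embeds[OF length_block_snd[OF zs] residue_entries_block_anisotropic[OF zs ts]
          two d emb[folded laurent_entries_block[OF l]]])
  have "residue_entries d (block_entries zs ts) \<noteq> []"
    using embeds_dim_le[OF is_form_mk_diagonal[OF qs(2)] e mk_diagonal_carrier] qs(1)
    by (auto simp: mk_diagonal_dim)
  then show ?thesis using residue_entries_block[OF s, of d ts] e by auto
qed

section \<open>Classes of K modulo constants and squares, and the slots of Pfister forms\<close>

definition similar :: "('a::field, 'n::finite) iter_laurent \<Rightarrow> ('a, 'n) iter_laurent \<Rightarrow> bool" where
  "similar x y \<longleftrightarrow> (\<exists>a s. a \<noteq> 0 \<and> s \<noteq> 0 \<and> y = laurent_const a * x * s\<^sup>2)"

lemma similar_cancel:
  assumes "c \<noteq> 0" "similar (c * x) (c * y)"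
  shows "similar x y"
proof -
  obtain a s where "a \<noteq> 0" "s \<noteq> 0" "c * y = laurent_const a * (c * x) * s\<^sup>2"
    using assms(2) by (auto simp: similar_def)
  then have "c * y = c * (laurent_const a * x * s\<^sup>2)" by (simp add: ac_simps)
  with assms(1) have "y = laurent_const a * x * s\<^sup>2" by simp
  with \<open>a \<noteq> 0\<close> \<open>s \<noteq> 0\<close> show ?thesis unfolding similar_def by blast
qed

text \<open>Modulo squares the entries are the subset products of the slots; these are closed under
  multiplication because a repeated slot contributes a square.\<close>

lemma pfister_entries_closed:
  assumes "0 \<notin> set bs" "x \<in> set (pfister_entries bs)" "y \<in> set (pfister_entries bs)"
  shows "\<exists>z \<in> set (pfister_entries bs). \<exists>r. r \<noteq> 0 \<and> x * y = z * r\<^sup>2"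
  using assms
proof (induction bs arbitrary: x y)
  case Nil
  then show ?case by (auto intro: exI[of _ 1])
next
  case (Cons b bs)
  let ?P = "set (pfister_entries bs)"
  have b: "b \<noteq> 0" and bs: "0 \<notin> set bs" using Cons.prems by auto
  from Cons.prems obtain x' y' where xy: "x' \<in> ?P" "y' \<in> ?P" "x = x' \<or> x = b * x'" "y = y' \<or> y = b * y'"
    by auto
  obtain z r where z: "z \<in> ?P" "r \<noteq> 0" "x' * y' = z * r\<^sup>2" using Cons.IH[OF bs xy(1,2)] by blast
  have "x * y = z * r\<^sup>2 \<or> x * y = b * z * r\<^sup>2 \<or> x * y = z * (b * r)\<^sup>2"
    using xy(3,4) z(3) by (auto simp: power2_eq_square ac_simps)
  then show ?case
  proof (elim disjE)
    assume "x * y = z * r\<^sup>2"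
    then show ?thesis using z by (intro bexI[of _ z] exI[of _ r]) auto
  next
    assume "x * y = b * z * r\<^sup>2"
    then show ?thesis using z by (intro bexI[of _ "b * z"] exI[of _ r]) auto
  next
    assume "x * y = z * (b * r)\<^sup>2"
    then show ?thesis using z b by (intro bexI[of _ z] exI[of _ "b * r"]) auto
  qed
qed

text \<open>
  A slot \<open>b\<close> in the class of an entry \<open>z\<close> modulo \<open>F\<^sup>\<times> K\<^sup>\<times>\<^sup>2\<close> can be replaced by a slot from \<open>F\<close>,
  since Pfister forms are similar to themselves with factor \<open>z\<close>.
\<close>

lemma pfister_normal_form:
  fixes bs :: "('a::field, 'n::finite) iter_laurent list"
  assumes "0 \<notin> set bs"
  shows "\<exists>bs' as. 0 \<notin> set bs' \<and> 0 \<notin> set as \<and>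
    mset (pfister_entries bs) \<approx>
      mset (products (pfister_entries bs') (map laurent_const (pfister_entries as))) \<and>
    sorted_wrt (\<lambda>x y. \<not> similar x y) (pfister_entries bs')"
  using assms
proof (induction bs)
  case Nil
  interpret field_hom "laurent_const :: 'a \<Rightarrow> ('a, 'n) iter_laurent" by (rule field_hom_laurent_const)
  show ?case by (intro exI[of _ "[]"]) (simp add: chain_equiv.chain_refl)
next
  case (Cons b bs)
  interpret field_hom "laurent_const :: 'a \<Rightarrow> ('a, 'n) iter_laurent" by (rule field_hom_laurent_const)
  have b: "b \<noteq> 0" and "0 \<notin> set bs" using Cons.prems by auto
  from Cons.IH[OF this(2)] obtain bs' as where bs': "0 \<notin> set bs'" and as: "0 \<notin> set as"
    and eq: "mset (pfister_entries bs) \<approx>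
      mset (products (pfister_entries bs') (map laurent_const (pfister_entries as)))"
    and sorted: "sorted_wrt (\<lambda>x y. \<not> similar x y) (pfister_entries bs')" by blast
  define Z where "Z = pfister_entries bs'"
  define T where "T = map (laurent_const :: 'a \<Rightarrow> ('a, 'n) iter_laurent) (pfister_entries as)"
  define M where "M = mset (products Z T)"
  have Z0: "0 \<notin> set Z" unfolding Z_def by (rule zero_notin_pfister_entries[OF bs'])
  have T0: "0 \<notin> set T" using zero_notin_pfister_entries[OF as] by (auto simp: T_def)
  have step: "mset (pfister_entries (b # bs)) \<approx> M + scale b M"
    using eq b unfolding M_def Z_def T_def by (simp add: chain_equiv_add chain_equiv_scale)
  show ?case
  proof (cases "\<exists>z \<in> set Z. similar z b")
    case True
    then obtain z a s where z: "z \<in> set Z" "a \<noteq> 0" "s \<noteq> 0" "b = laurent_const a * z * s\<^sup>2"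
      by (auto simp: similar_def)
    have ca: "laurent_const a \<noteq> (0 :: ('a, 'n) iter_laurent)" using z(2) by simp
    \<comment> \<open>The monomial part absorbs its entry z, and s^2 is a square, so of the slot b =
      a z s^2 only the constant a remains.\<close>
    have "mset Z \<approx> mset (map ((*) z) Z)"
      using pfister_entries_similarity[OF bs', of z] z(1) by (simp add: Z_def)
    then have "M \<approx> mset (products (map ((*) z) Z) T)"
      unfolding M_def by (rule chain_equiv_products_left[OF T0])
    then have "M \<approx> scale z M" by (simp only: mset_products_map_left M_def)
    from chain_equiv_scale[OF ca this] have "scale (laurent_const a) M \<approx> scale (laurent_const a * z) M"
      by simp
    also have "\<dots> \<approx> scale (s\<^sup>2) (scale (laurent_const a * z) M)"
      by (rule chain_equiv_scale_square[OF z(3)])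
    also have "\<dots> = scale b M" by (simp add: z(4) ac_simps)
    finally have "M + scale b M \<approx> M + scale (laurent_const a) M"
      by (intro chain_equiv_add chain_equiv.chain_refl) (rule chain_equiv_sym)
    also have "\<dots> = mset (products Z (map laurent_const (pfister_entries (a # as))))"
    proof -
      have "map laurent_const (pfister_entries (a # as)) = T @ map ((*) (laurent_const a)) T"
        by (simp add: T_def o_def hom_mult)
      then show ?thesis by (simp only: mset_products_append_right mset_products_map_right M_def)
    qed
    finally have "mset (pfister_entries (b # bs)) \<approx>
        mset (products (pfister_entries bs') (map laurent_const (pfister_entries (a # as))))"
      unfolding Z_def by (rule chain_equiv.chain_trans[OF step])
    then show ?thesis using bs' as z(2) sorted by (intro exI[of _ bs'] exI[of _ "a # as"]) auto
  next
    case False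
    have "M + scale b M = mset (products (pfister_entries (b # bs')) T)"
      by (simp add: products_append mset_products_map_left M_def Z_def)
    moreover have "sorted_wrt (\<lambda>x y. \<not> similar x y) (pfister_entries (b # bs'))"
    proof -
      have "\<not> similar x (b * y)" if xy: "x \<in> set Z" "y \<in> set Z" for x y
      proof
        assume "similar x (b * y)"
        then obtain a s where as: "a \<noteq> 0" "s \<noteq> 0" "b * y = laurent_const a * x * s\<^sup>2"
          by (auto simp: similar_def)
        obtain z r where zr: "z \<in> set Z" "r \<noteq> 0" "x * y = z * r\<^sup>2"
          using pfister_entries_closed[OF bs'] xy unfolding Z_def by blast
        have y: "y \<noteq> 0" using xy Z0 by metis
        \<comment> \<open>Since x y is an entry up to squares, b would lie in the class of an entry,
          which the case assumption excludes.\<close>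
        have "b * y\<^sup>2 = laurent_const a * (x * y) * s\<^sup>2"
          using as(3) by (simp add: power2_eq_square ac_simps)
        also have "\<dots> = laurent_const a * z * (r * s)\<^sup>2"
          unfolding zr(3) by (simp add: power2_eq_square ac_simps)
        finally have "b = laurent_const a * z * (r * s)\<^sup>2 / y\<^sup>2" using y by (simp add: eq_divide_eq)
        then have "b = laurent_const a * z * (r * s / y)\<^sup>2" by (simp add: power_divide)
        then have "similar z b" unfolding similar_def
          using as zr y by (intro exI[of _ a] exI[of _ "r * s / y"]) auto
        with False zr(1) show False by blast
      qed
      moreover have "sorted_wrt (\<lambda>x y. \<not> similar (b * x) (b * y)) Z"
        using sorted unfolding Z_def
        by (rule sorted_wrt_mono_rel[rotated]) (use similar_cancel[OF b] in blast)
      ultimately show ?thesis using sorted by (auto simp: sorted_wrt_append sorted_wrt_map Z_def)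
    qed
    ultimately show ?thesis using step bs' as b unfolding T_def
      by (intro exI[of _ "b # bs'"] exI[of _ as]) auto
  qed
qed

lemma chain_equiv_squares:
  "list_all2 (\<lambda>x y. \<exists>s. s \<noteq> 0 \<and> x = y * s\<^sup>2) xs ys \<Longrightarrow> mset xs \<approx> mset ys"
proof (induction rule: list_all2_induct)
  case (Cons x xs y ys)
  then obtain s where s: "s \<noteq> 0" "x = y * s\<^sup>2" by blast
  have "add_mset y (mset ys) \<approx> add_mset x (mset ys)" by (rule chain_equiv_square'[OF s])
  also have "\<dots> \<approx> add_mset x (mset xs)"
    by (rule chain_equiv_add_mset[OF chain_equiv_sym]) (rule Cons)
  finally show ?case by (simp add: chain_equiv_sym)
qed (simp add: chain_equiv.chain_refl)

lemma similar_laurent_terms: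
  assumes "same_class e d" "length d = CARD('n::finite)" "a \<noteq> 0" "b \<noteq> 0"
  shows "similar (laurent_term a d :: ('a::field, 'n) iter_laurent) (laurent_term b e)"
proof -
  let ?h = "half_diff e d"
  have lh: "length ?h = CARD('n)"
    using assms(2) same_class_length[OF assms(1)] by (simp add: half_diff_def)
  have nz: "laurent_term 1 ?h \<noteq> (0 :: ('a, 'n) iter_laurent)" by (simp add: laurent_term_eq_zero_iff[OF lh])
  have "laurent_const (b / a) * laurent_term a d * (laurent_term 1 ?h)\<^sup>2 =
      (laurent_term b (d \<oplus> (?h \<oplus> ?h)) :: ('a, 'n) iter_laurent)"
    using assms lh by (simp add: mult.commute[of "laurent_const _"] laurent_term_mult_const
        laurent_term_mult power2_eq_square)
  then show ?thesis unfolding similar_def same_class_half_diff[OF assms(1)]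
    using assms nz by (intro exI[of _ "b / a"] exI[of _ "laurent_term 1 ?h"]) auto
qed

lemma similar_times_squares:
  assumes "similar x y" "s \<noteq> 0" "t \<noteq> 0"
  shows "similar (x * s\<^sup>2) (y * t\<^sup>2)"
proof -
  obtain a r where "a \<noteq> 0" "r \<noteq> 0" "y = laurent_const a * x * r\<^sup>2" using assms(1) by (auto simp: similar_def)
  then have "y * t\<^sup>2 = laurent_const a * (x * s\<^sup>2) * (r * t / s)\<^sup>2"
    using assms(2) by (simp add: power_divide power_mult_distrib)
  then show ?thesis unfolding similar_def
    using \<open>a \<noteq> 0\<close> \<open>r \<noteq> 0\<close> assms by (intro exI[of _ a] exI[of _ "r * t / s"]) auto
qed

text \<open>Turns the multiple by c of a form with inequivalent entries into block shape. Each c z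
  is a monomial up to squares; two monomials with exponents in one class are similar, and then
  cancelling c would make the original entries similar.\<close>

lemma laurent_monomial_representatives:
  fixes Z :: "('a::field, 'n::finite) iter_laurent list"
  assumes two: "(2::'a) \<noteq> 0" and Z: "0 \<notin> set Z" "sorted_wrt (\<lambda>x y. \<not> similar x y) Z" and c: "c \<noteq> 0"
  obtains zs where "distinct_classes CARD('n) zs"
    "\<forall>T. 0 \<notin> set T \<longrightarrow> scale c (mset (products Z T)) \<approx> mset (products (laurent_entries zs) T)"
proof -
  define P where "P x p \<longleftrightarrow> fst p \<noteq> 0 \<and> length (snd p) = CARD('n) \<and>
      (\<exists>s. s \<noteq> 0 \<and> x = laurent_term (fst p) (snd p) * s\<^sup>2)"
    for x :: "('a, 'n) iter_laurent" and p
  define g where "g x = (SOME p. P x p)" for x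
  have g': "P x (g x)" if "x \<noteq> 0" for x
  proof -
    obtain a d s where "a \<noteq> 0" "length d = CARD('n)" "s \<noteq> 0" "x = laurent_term a d * s\<^sup>2"
      by (rule iter_laurent_square_class[OF two \<open>x \<noteq> 0\<close>])
    then have "P x (a, d)" by (auto simp: P_def)
    then show ?thesis unfolding g_def by (rule someI)
  qed
  note g = g'[unfolded P_def]
  define zs where "zs = map (\<lambda>z. g (c * z)) Z"
  have nz: "c * z \<noteq> 0" if "z \<in> set Z" for z using that Z(1) c by auto
  have sim: "similar x y" if xy: "x \<in> set Z" "y \<in> set Z" and "same_class (snd (g (c * x))) (snd (g (c * y)))" for x y
  proof -
    note gx = g[OF nz[OF xy(1)]] and gy = g[OF nz[OF xy(2)]]
    obtain s where s: "s \<noteq> 0" "c * x = laurent_term (fst (g (c * x))) (snd (g (c * x))) * s\<^sup>2"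
      using gx by blast
    obtain t where t: "t \<noteq> 0" "c * y = laurent_term (fst (g (c * y))) (snd (g (c * y))) * t\<^sup>2"
      using gy by blast
    have "similar (laurent_term (fst (g (c * x))) (snd (g (c * x))) :: ('a, 'n) iter_laurent)
        (laurent_term (fst (g (c * y))) (snd (g (c * y))))"
      using gx gy same_class_sym[OF that(3)] by (intro similar_laurent_terms) auto
    from similar_times_squares[OF this s(1) t(1)] have "similar (c * x) (c * y)"
      using s(2) t(2) by simp
    then show ?thesis by (rule similar_cancel[OF c])
  qed
  have "sorted_wrt (\<lambda>x y. \<not> same_class (snd (g (c * x))) (snd (g (c * y)))) Z"
    by (rule sorted_wrt_mono_rel[OF _ Z(2)]) (use sim in blast)
  then have "distinct_classes CARD('n) zs"
    using g nz by (auto simp: distinct_classes_def zs_def sorted_wrt_map o_def case_prod_beta)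
  moreover have "scale c (mset (products Z T)) \<approx> mset (products (laurent_entries zs) T)"
    if T: "0 \<notin> set T" for T
  proof -
    have "list_all2 (\<lambda>x y. \<exists>s. s \<noteq> 0 \<and> x = y * s\<^sup>2) (map ((*) c) Z) (laurent_entries zs)"
      unfolding laurent_entries_def zs_def map_map list_all2_map1 list_all2_map2
      by (rule list.rel_refl_strong) (use g[OF nz] in \<open>simp add: case_prod_beta\<close>)
    from chain_equiv_products_left[OF T chain_equiv_squares[OF this]] show ?thesis
      by (simp only: mset_products_map_left)
  qed
  ultimately show ?thesis using that by blast
qed

section \<open>The exponents of the monomials in \<pi>\<close>

fun exponent_sums :: "nat \<Rightarrow> int list list \<Rightarrow> int list list" where
  "exponent_sums n [] = [replicate n 0]"
| "exponent_sums n (e # es) = exponent_sums n es @ map ((\<oplus>) e) (exponent_sums n es)"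

text \<open>The exponent of x_i. The head of a list belongs to x_n, so the entry 1 stands at
  position n - i.\<close>

definition unit_exponent :: "nat \<Rightarrow> nat \<Rightarrow> int list" where
  "unit_exponent n i = replicate (n - i) 0 @ [1] @ replicate (i - 1) 0"

lemma length_exponent_sums:
  "\<forall>e \<in> set es. length e = n \<Longrightarrow> \<forall>d \<in> set (exponent_sums n es). length d = n"
  by (induction es) auto

lemma length_exponent_sums_list: "length (exponent_sums n es) = 2 ^ length es"
  by (induction es) auto

lemma pfister_entries_laurent_terms:
  assumes "\<forall>e \<in> set es. length e = CARD('n::finite)"
  shows "pfister_entries (map (laurent_term 1) es) =
    (map (laurent_term 1) (exponent_sums CARD('n) es) :: ('a::field, 'n) iter_laurent list)"
  using assms
proof (induction es)
  case Nil
  have "Rep_iter_laurent (1 :: ('a, 'n) iter_laurent) =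
      Rep_iter_laurent (laurent_term 1 (replicate CARD('n) 0) :: ('a, 'n) iter_laurent)"
    by (simp add: Rep_laurent_term one_iter_laurent.rep_eq)
  then have "(1 :: ('a, 'n) iter_laurent) = laurent_term 1 (replicate CARD('n) 0)"
    using Rep_iter_laurent_inject by blast
  then show ?case by simp
next
  case (Cons e es)
  have "laurent_term 1 e * laurent_term 1 d = (laurent_term 1 (e \<oplus> d) :: ('a, 'n) iter_laurent)"
    if "d \<in> set (exponent_sums CARD('n) es)" for d
    using that Cons.prems length_exponent_sums[of es "CARD('n)"] by (simp add: laurent_term_mult)
  then show ?case using Cons by simp
qed

lemma unit_exponent_nth:
  assumes "1 \<le> i" "i \<le> n" "1 \<le> j" "j \<le> n"
  shows "unit_exponent n i ! (n - j) = (if i = j then 1 else 0)"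
  using assms by (auto simp: unit_exponent_def nth_append nth_Cons split: nat.splits)

lemma length_unit_exponent: "1 \<le> i \<Longrightarrow> i \<le> n \<Longrightarrow> length (unit_exponent n i) = n"
  by (simp add: unit_exponent_def)

lemma length_exponent_sums_unit:
  assumes "set js \<subseteq> {1..n}" "d \<in> set (exponent_sums n (map (unit_exponent n) js))"
  shows "length d = n"
proof -
  have "\<forall>e \<in> set (map (unit_exponent n) js). length e = n"
    using assms(1) by (auto intro!: length_unit_exponent)
  from length_exponent_sums[OF this] show ?thesis using assms(2) by blast
qed

lemma exponent_sums_unit_zero:
  assumes "set js \<subseteq> {1..n}" "j \<in> {1..n}" "j \<notin> set js"
  shows "\<forall>d \<in> set (exponent_sums n (map (unit_exponent n) js)). d ! (n - j) = 0"
  using assms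
proof (induction js)
  case (Cons i js)
  have l: "length d = n" if "d \<in> set (exponent_sums n (map (unit_exponent n) js))" for d
    using length_exponent_sums_unit[OF _ that] Cons.prems by simp
  show ?case using Cons l
    by (auto simp: exp_add_def length_unit_exponent unit_exponent_nth)
qed auto

text \<open>The sums without the new unit exponent have 0 at position n - i, those with it have 1,
  so parity separates the two halves; within a half, translation preserves classes.\<close>

lemma exponent_sums_distinct_classes:
  assumes "distinct js" "set js \<subseteq> {1..n}"
  shows "sorted_wrt (\<lambda>d e. \<not> same_class d e) (exponent_sums n (map (unit_exponent n) js))"
  using assms
proof (induction js)
  case (Cons i js)
  let ?E = "exponent_sums n (map (unit_exponent n) js)" and ?u = "unit_exponent n i"
  have l: "length d = n" if "d \<in> set ?E" for d
    using length_exponent_sums_unit[OF _ that] Cons.prems by simp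
  have i: "1 \<le> i" "i \<le> n" using Cons.prems by auto
  have z: "d ! (n - i) = 0" if "d \<in> set ?E" for d
    using exponent_sums_unit_zero[of js n i] that Cons.prems by auto
  have "\<not> same_class d (?u \<oplus> e)" if de: "d \<in> set ?E" "e \<in> set ?E" for d e
  proof
    assume "same_class d (?u \<oplus> e)"
    then have "even (d ! (n - i) - (?u \<oplus> e) ! (n - i))"
      using l[OF de(1)] i by (auto simp: same_class_def list_all2_conv_all_nth)
    moreover have "(?u \<oplus> e) ! (n - i) = 1"
      using i l[OF de(2)] z[OF de(2)] unit_exponent_nth[of i n i]
      by (simp add: exp_add_def length_unit_exponent)
    ultimately show False using z[OF de(1)] by simp
  qed
  moreover have "sorted_wrt (\<lambda>d e. \<not> same_class (?u \<oplus> d) (?u \<oplus> e)) ?E"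
  proof (rule sorted_wrt_mono_rel)
    show "sorted_wrt (\<lambda>d e. \<not> same_class d e) ?E" using Cons by auto
    show "\<not> same_class (?u \<oplus> d) (?u \<oplus> e)" if "d \<in> set ?E" "e \<in> set ?E" "\<not> same_class d e" for d e
      using that l i by (simp add: same_class_add_left length_unit_exponent)
  qed
  ultimately show ?case using Cons by (auto simp: sorted_wrt_append sorted_wrt_map)
qed simp

definition pi_exponents :: "nat \<Rightarrow> int list list" where
  "pi_exponents n = exponent_sums n (map (unit_exponent n) [1..<n + 1])"

lemma pi_exponents:
  "\<forall>d \<in> set (pi_exponents n). length d = n" "length (pi_exponents n) = 2 ^ n"
  "sorted_wrt (\<lambda>d e. \<not> same_class d e) (pi_exponents n)"
proof -
  show "\<forall>d \<in> set (pi_exponents n). length d = n"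
    unfolding pi_exponents_def by (rule length_exponent_sums) (auto simp: length_unit_exponent)
  show "length (pi_exponents n) = 2 ^ n" by (simp add: pi_exponents_def length_exponent_sums_list)
  show "sorted_wrt (\<lambda>d e. \<not> same_class d e) (pi_exponents n)"
    unfolding pi_exponents_def by (rule exponent_sums_distinct_classes) auto
qed

lemma laurent_var_term:
  "laurent_var i = (laurent_term 1 (unit_exponent CARD('n) i) :: ('a::field, 'n::finite) iter_laurent)"
  by (simp add: laurent_var_def laurent_term_def unit_exponent_def)

lemma pfister_entries_laurent_vars:
  "pfister_entries (map laurent_var [1..<CARD('n) + 1]) =
   (map (laurent_term 1) (pi_exponents CARD('n)) :: ('a::field, 'n::finite) iter_laurent list)"
proof -
  have "map laurent_var [1..<CARD('n) + 1] =
      (map (laurent_term 1) (map (unit_exponent CARD('n)) [1..<CARD('n) + 1]) :: ('a, 'n) iter_laurent list)"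
    by (simp add: laurent_var_term)
  moreover have "\<forall>e \<in> set (map (unit_exponent CARD('n)) [1..<CARD('n) + 1]). length e = CARD('n)"
    by (auto simp: length_unit_exponent)
  ultimately show ?thesis
    unfolding pi_exponents_def using pfister_entries_laurent_terms by (simp only:)
qed

lemma distinct_classes_pi: "distinct_classes n (map (\<lambda>d. (1 :: 'a::field, d)) (pi_exponents n))"
  using pi_exponents[of n] by (auto simp: distinct_classes_def o_def)

lemma laurent_entries_pi:
  "laurent_entries (map (\<lambda>d. (1, d)) ds) = map (laurent_term 1) ds"
  by (simp add: laurent_entries_def)

text \<open>If v is the leading exponent of s, then a x^d s^2 has leading exponent d + 2v, and this
  must be e.\<close>

lemma similar_laurent_termsD:
  assumes "similar (laurent_term 1 d :: ('a::field, 'n::finite) iter_laurent) (laurent_term 1 e)"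
    and "length d = CARD('n)" "length e = CARD('n)"
  shows "same_class e d"
proof -
  obtain a s where as: "a \<noteq> 0" "s \<noteq> 0" and "(laurent_term 1 e :: ('a, 'n) iter_laurent) =
      laurent_const a * laurent_term 1 d * s\<^sup>2" using assms(1) by (auto simp: similar_def)
  then have eq: "(laurent_term 1 e :: ('a, 'n) iter_laurent) = laurent_term a d * s\<^sup>2"
    using laurent_term_mult_const[OF assms(2), of 1 a] by (simp add: mult.commute[of "laurent_const a"])
  let ?v = "leading_exp s"
  have "Rep_iter_laurent (laurent_term a d * s\<^sup>2) (d \<oplus> (?v \<oplus> ?v)) \<noteq> 0"
    using Rep_term_square(1)[OF assms(2) leading_exp(1,3)[OF as(2)], of a] leading_exp(2)[OF as(2)] as(1)
    by simp
  then have "d \<oplus> (?v \<oplus> ?v) = e"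
    unfolding eq[symmetric] by (auto simp: Rep_laurent_term[OF assms(3)] laurent_monom_def split: if_splits)
  then show ?thesis
    using same_class_add_double[of d ?v] leading_exp(1)[OF as(2)] assms(2) by auto
qed

lemma sorted_pi_not_similar:
  "sorted_wrt (\<lambda>x y. \<not> similar x y)
     (map (laurent_term 1) (pi_exponents CARD('n)) :: ('a::field, 'n::finite) iter_laurent list)"
  unfolding sorted_wrt_map
proof (rule sorted_wrt_mono_rel[OF _ pi_exponents(3)])
  fix d e assume "d \<in> set (pi_exponents CARD('n))" "e \<in> set (pi_exponents CARD('n))" "\<not> same_class d e"
  then show "\<not> similar (laurent_term 1 d :: ('a, 'n) iter_laurent) (laurent_term 1 e)"
    using similar_laurent_termsD[of d e] same_class_sym[of e d] pi_exponents(1) by blast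
qed

lemma mset_pfister_entries_append:
  "mset (pfister_entries (xs @ ys)) = mset (products (pfister_entries xs) (pfister_entries ys))"
proof (induction xs)
  case Nil
  show ?case by simp
next
  case (Cons x xs)
  then show ?case by (simp add: products_append mset_products_map_left)
qed

lemma mset_map_uminus: "mset (map uminus xs) = scale (-1) (mset (xs :: 'b::field list))"
  by (induction xs) auto

lemma pfister_entries_map:
  assumes "field_hom h"
  shows "pfister_entries (map h as) = map h (pfister_entries as)"
proof -
  interpret field_hom h by fact
  show ?thesis by (induction as) (auto simp: hom_mult)
qed

section \<open>The form \<open>q \<otimes> \<pi>\<close> and its neighbours\<close>

context
  fixes \<pi> :: "('a::field, 'n::finite) iter_laurent mat"
  assumes two: "(2::'a) \<noteq> 0"
    and \<pi>: "is_form \<pi>" "isometric \<pi> (pfister_prod (map laurent_var [1..<CARD('n) + 1]))"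
begin

abbreviation \<pi>s :: "('a, 'n) iter_laurent list" where
  "\<pi>s \<equiv> map (laurent_term 1) (pi_exponents CARD('n))"

lemma two': "(2 :: ('a, 'n) iter_laurent) \<noteq> 0"
proof -
  interpret field_hom "laurent_const :: 'a \<Rightarrow> ('a, 'n) iter_laurent" by (rule field_hom_laurent_const)
  have "laurent_const 2 = (2 :: ('a, 'n) iter_laurent)"
    using hom_add[of 1 1] by simp
  then show ?thesis using two hom_0_iff[of 2] by simp
qed

lemma zero_notin_pi: "0 \<notin> set \<pi>s"
  using pi_exponents(1)[of "CARD('n)"] by (auto simp: laurent_term_eq_zero_iff eq_commute[of 0])

lemma pi_embeds: "embeds \<pi> (mk_diagonal \<pi>s)" "embeds (mk_diagonal \<pi>s) \<pi>" "dim_row \<pi> = 2 ^ CARD('n)"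
proof -
  have i: "isometric \<pi> (mk_diagonal \<pi>s)"
    using \<pi>(2) unfolding pfister_prod_diagonal pfister_entries_laurent_vars .
  show "embeds \<pi> (mk_diagonal \<pi>s)" "embeds (mk_diagonal \<pi>s) \<pi>"
    by (rule isometric_embeds[OF two' \<pi>(1) is_form_mk_diagonal[OF zero_notin_pi] i])+
  show "dim_row \<pi> = 2 ^ CARD('n)"
    using i by (simp add: isometric_def mk_diagonal_dim pi_exponents(2))
qed

lemma is_form_ext: "is_form (q :: 'a mat) \<Longrightarrow> is_form (scalar_ext q :: ('a, 'n) iter_laurent mat)"
  by (rule is_form_map_mat[OF field_hom_laurent_const])

lemma is_form_tensor: "is_form (q :: 'a mat) \<Longrightarrow> is_form (tensor_form (scalar_ext q) \<pi>)"
  by (rule is_form_tensor_form[OF is_form_ext \<pi>(1)])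

lemma dim_tensor: "dim_row (tensor_form (scalar_ext q) \<pi>) = dim_row (q :: 'a mat) * 2 ^ CARD('n)"
  by (simp add: pi_embeds(3))

text \<open>Used to put the monomials of \<pi> outside and the constants inside, as in
  \<open>laurent_entries_block\<close>.\<close>

lemma embeds_products_commute:
  "embeds (mk_diagonal (products xs ys)) (mk_diagonal (products ys (xs :: ('a, 'n) iter_laurent list)))"
  by (rule embeds_diagonal_mset) (simp add: mset_products_commute[of xs])

lemma embeds_tensor_diagonal:
  fixes q :: "'a mat"
  assumes "is_form q" "embeds q (mk_diagonal qs)"
  shows "embeds (tensor_form (scalar_ext q) \<pi>) (mk_diagonal (products \<pi>s (map laurent_const qs)))"
proof -
  note q = form_carrier[OF is_form_ext[OF assms(1)]]
  have "embeds (scalar_ext q :: ('a, 'n) iter_laurent mat) (mk_diagonal (map laurent_const qs))"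
    using embeds_map_mat[OF field_hom_laurent_const assms(2) form_carrier[OF assms(1)] mk_diagonal_carrier]
    unfolding map_mat_mk_diagonal[OF field_hom_laurent_const] .
  from embeds_tensor_form[OF this pi_embeds(1) q form_carrier[OF \<pi>(1)] mk_diagonal_carrier mk_diagonal_carrier]
  show ?thesis
    unfolding tensor_form_diagonal
    by (rule embeds_trans[OF _ embeds_products_commute mk_diagonal_carrier])
qed

lemma embeds_diagonal_tensor:
  fixes q :: "'a mat"
  assumes "is_form q" "embeds (mk_diagonal qs) q"
  shows "embeds (mk_diagonal (products \<pi>s (map laurent_const qs))) (tensor_form (scalar_ext q) \<pi>)"
proof -
  note q = form_carrier[OF is_form_ext[OF assms(1)]]
  have "embeds (mk_diagonal (map laurent_const qs)) (scalar_ext q :: ('a, 'n) iter_laurent mat)"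
    using embeds_map_mat[OF field_hom_laurent_const assms(2) mk_diagonal_carrier form_carrier[OF assms(1)]]
    unfolding map_mat_mk_diagonal[OF field_hom_laurent_const] .
  from embeds_tensor_form[OF this pi_embeds(2) mk_diagonal_carrier mk_diagonal_carrier q form_carrier[OF \<pi>(1)]]
  show ?thesis
    unfolding tensor_form_diagonal
    by (rule embeds_trans[OF embeds_products_commute _ form_carrier[OF is_form_tensor[OF assms(1)]]])
qed

text \<open>In block shape each residue form is empty or a diagonalisation of q, because the
  monomials of \<pi> have coefficient 1 and pairwise different classes.\<close>

lemma anisotropic_tensor:
  fixes q :: "'a mat"
  assumes "is_form q" "anisotropic q"
  shows "anisotropic (tensor_form (scalar_ext q) \<pi>)"
proof -
  obtain qs where qs: "0 \<notin> set qs" "embeds (mk_diagonal qs) q" "embeds q (mk_diagonal qs)"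
    by (rule anisotropic_diagonalizable[OF two assms])
  have "anisotropic (mk_diagonal qs)"
    by (rule anisotropic_embeds[OF assms(2) qs(2) is_form_mk_diagonal[OF qs(1)] form_carrier[OF assms(1)]])
  from anisotropic_block[OF distinct_classes_pi this]
  have "anisotropic (mk_diagonal (products \<pi>s (map laurent_const qs)))"
    unfolding laurent_entries_pi .
  from anisotropic_embeds[OF this embeds_tensor_diagonal[OF assms(1) qs(3)] is_form_tensor[OF assms(1)]
      mk_diagonal_carrier]
  show ?thesis .
qed

text \<open>The slots are those of \<sigma>, read as constants, followed by the variables.\<close>

lemma pfister_tensor:
  fixes \<sigma> :: "'a mat"
  assumes "pfister \<sigma>"
  shows "pfister (tensor_form (scalar_ext \<sigma>) \<pi>)"
proof -
  interpret field_hom "laurent_const :: 'a \<Rightarrow> ('a, 'n) iter_laurent" by (rule field_hom_laurent_const)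
  obtain as where \<sigma>: "is_form \<sigma>" and as: "0 \<notin> set as" "isometric \<sigma> (mk_diagonal (pfister_entries as))"
    using assms unfolding pfister_def pfister_prod_diagonal by blast
  have fs: "is_form (mk_diagonal (pfister_entries as))"
    by (rule is_form_mk_diagonal[OF zero_notin_pfister_entries[OF as(1)]])
  let ?xs = "map laurent_const as @ map laurent_var [1..<CARD('n) + 1] :: ('a, 'n) iter_laurent list"
  let ?ys = "products \<pi>s (map laurent_const (pfister_entries as))"
  have m: "mset (pfister_entries ?xs) = mset ?ys"
    unfolding mset_pfister_entries_append pfister_entries_map[OF field_hom_laurent_const]
      pfister_entries_laurent_vars mset_products_commute[of \<pi>s] ..
  have "laurent_var i \<noteq> (0 :: ('a, 'n) iter_laurent)" if "1 \<le> i" "i \<le> CARD('n)" for i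
    using that by (simp add: laurent_var_term laurent_term_eq_zero_iff length_unit_exponent)
  then have xs0: "0 \<notin> set ?xs" using as(1) by (auto simp: less_Suc_eq_le)
  have fx: "is_form (mk_diagonal (pfister_entries ?xs))"
    by (rule is_form_mk_diagonal[OF zero_notin_pfister_entries[OF xs0]])
  have "embeds \<sigma> (mk_diagonal (pfister_entries as))" by (rule isometric_embeds(1)[OF two \<sigma> fs as(2)])
  from embeds_tensor_diagonal[OF \<sigma> this] have "embeds (tensor_form (scalar_ext \<sigma>) \<pi>) (mk_diagonal ?ys)" .
  moreover have "embeds (mk_diagonal ?ys) (mk_diagonal (pfister_entries ?xs))"
    by (rule embeds_diagonal_mset) (simp only: m subset_mset.order_refl)
  ultimately have e: "embeds (tensor_form (scalar_ext \<sigma>) \<pi>) (mk_diagonal (pfister_entries ?xs))"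
    by (rule embeds_trans[OF _ _ mk_diagonal_carrier])
  have "dim_row \<sigma> = 2 ^ length as" using as(2)
    by (simp add: isometric_def mk_diagonal_dim length_pfister_entries)
  then have d: "dim_row (tensor_form (scalar_ext \<sigma>) \<pi>) = dim_row (mk_diagonal (pfister_entries ?xs))"
    by (simp add: pi_embeds(3) mk_diagonal_dim length_pfister_entries power_add del: upt_Suc)
  have "isometric (tensor_form (scalar_ext \<sigma>) \<pi>) (pfister_prod ?xs)"
    unfolding pfister_prod_diagonal by (rule embeds_isometric[OF is_form_tensor[OF \<sigma>] fx e d])
  then show ?thesis unfolding pfister_def using is_form_tensor[OF \<sigma>] xs0 by blast
qed

lemma neighbour_embeds:
  fixes p \<theta> :: "'b::field mat"
  assumes "(2::'b) \<noteq> 0" "neighbour p \<theta>"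
  obtains a where "a \<noteq> 0" "embeds p (a \<cdot>\<^sub>m \<theta>)" "is_form p" "is_form \<theta>" "dim_row \<theta> < 2 * dim_row p"
proof -
  obtain a where a: "a \<noteq> 0" "subform p (a \<cdot>\<^sub>m \<theta>)" and f: "is_form p" "is_form \<theta>"
    and d: "2 * dim_row p > dim_row \<theta>"
    using assms(2) unfolding neighbour_def pfister_def by blast
  have "embeds p (a \<cdot>\<^sub>m \<theta>)"
    by (rule subform_imp_embeds[OF assms(1) f(1) is_form_smult[OF f(2) a(1)] a(2)])
  with a(1) f d that show ?thesis by blast
qed

text \<open>The embedding is simply tensored with \<pi>; anisotropy of
  \<open>\<sigma> \<otimes> \<pi>\<close> supplies the complement that \<open>subform\<close>
  demands.\<close>

lemma neighbour_tensor:
  fixes q \<sigma> :: "'a mat"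
  assumes "is_form q" and \<sigma>: "pfister \<sigma>" "anisotropic \<sigma>" and a: "a \<noteq> 0" "embeds q (a \<cdot>\<^sub>m \<sigma>)"
    and d: "dim_row \<sigma> < 2 * dim_row q"
  shows "neighbour (tensor_form (scalar_ext q) \<pi>) (tensor_form (scalar_ext \<sigma>) \<pi>)"
proof -
  interpret field_hom "laurent_const :: 'a \<Rightarrow> ('a, 'n) iter_laurent" by (rule field_hom_laurent_const)
  have f\<sigma>: "is_form \<sigma>" using \<sigma>(1) by (simp add: pfister_def)
  have fa: "is_form (a \<cdot>\<^sub>m \<sigma>)" by (rule is_form_smult[OF f\<sigma> a(1)])
  let ?c = "laurent_const a :: ('a, 'n) iter_laurent"
  have c: "?c \<noteq> 0" using a(1) by simp
  have sm: "scalar_ext (a \<cdot>\<^sub>m \<sigma>) = ?c \<cdot>\<^sub>m scalar_ext \<sigma>" by (rule eq_matI) (auto simp: hom_mult)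
  have "embeds (scalar_ext q :: ('a, 'n) iter_laurent mat) (scalar_ext (a \<cdot>\<^sub>m \<sigma>))"
    by (rule embeds_map_mat[OF field_hom_laurent_const a(2) form_carrier[OF assms(1)] form_carrier[OF fa]])
  from embeds_tensor_form[OF this embeds_refl[OF form_carrier[OF \<pi>(1)]] form_carrier[OF is_form_ext[OF assms(1)]]
      form_carrier[OF \<pi>(1)] form_carrier[OF is_form_ext[OF fa]] form_carrier[OF \<pi>(1)]]
  have e: "embeds (tensor_form (scalar_ext q) \<pi>) (?c \<cdot>\<^sub>m tensor_form (scalar_ext \<sigma>) \<pi>)"
    unfolding sm tensor_form_smult .
  note ft = is_form_tensor[OF f\<sigma>]
  have "subform (tensor_form (scalar_ext q) \<pi>) (?c \<cdot>\<^sub>m tensor_form (scalar_ext \<sigma>) \<pi>)"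
    by (rule embeds_imp_subform[OF two' is_form_smult[OF ft c]
          anisotropic_smult[OF anisotropic_tensor[OF f\<sigma> \<sigma>(2)] form_carrier[OF ft] c]
          is_form_tensor[OF assms(1)] e])
  moreover have "2 * dim_row (tensor_form (scalar_ext q) \<pi>) > dim_row (tensor_form (scalar_ext \<sigma>) \<pi>)"
    unfolding dim_tensor using d by (simp add: mult.assoc[symmetric])
  ultimately show ?thesis unfolding neighbour_def
    using is_form_tensor[OF assms(1)] pfister_tensor[OF \<sigma>(1)] c by blast
qed

text \<open>The block of \<open>q \<otimes> \<pi>\<close> belonging to one monomial of \<pi>, which
  is the part that a residue form sees.\<close>

lemma embeds_monomial_slice:
  assumes "d \<in> set (pi_exponents CARD('n))"
  shows "embeds (mk_diagonal (map (\<lambda>q. laurent_term q d) qs))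
    (mk_diagonal (products \<pi>s (map laurent_const qs)))"
proof (rule embeds_diagonal_mset)
  have "length d = CARD('n)" using assms pi_exponents(1) by blast
  then have "map (\<lambda>q. laurent_term q d) qs = map ((*) (laurent_term 1 d)) (map laurent_const qs :: ('a, 'n) iter_laurent list)"
    by (simp add: laurent_term_mult_const)
  moreover have "mset (map ((*) x) ys) \<subseteq># mset (products xs ys)" if "x \<in> set xs"
    for x and xs ys :: "('a, 'n) iter_laurent list"
    using that by (induction xs) (auto intro: subset_mset.order_trans)
  ultimately show "mset (map (\<lambda>q. laurent_term q d) qs) \<subseteq># mset (products \<pi>s (map laurent_const qs))"
    using assms by (metis (no_types, lifting) image_eqI set_map)
qed

text \<open>Combines restriction to the block of \<open>d\<close> with passage to residue forms.
  This is the descent from K to F used for both parts of the theorem.\<close>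

lemma tensor_embeds_block:
  fixes q :: "'a mat"
  assumes q: "is_form q" "anisotropic q" "dim_row q > 0"
    and zs: "distinct_classes CARD('n) zs" and ts: "anisotropic (mk_diagonal ts)"
    and e: "embeds (tensor_form (scalar_ext q) \<pi>) (mk_diagonal (products (laurent_entries zs) (map laurent_const ts)))"
    and d: "d \<in> set (pi_exponents CARD('n))"
  shows "\<exists>(a, e) \<in> set zs. same_class d e \<and> embeds q (a \<cdot>\<^sub>m mk_diagonal ts)"
proof -
  obtain qs where qs: "0 \<notin> set qs" "length qs = dim_row q" "embeds (mk_diagonal qs) q" "embeds q (mk_diagonal qs)"
    by (rule anisotropic_diagonalizable[OF two q(1,2)])
  have "embeds (mk_diagonal (map (\<lambda>q. laurent_term q d) qs)) (tensor_form (scalar_ext q) \<pi>)"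
    by (rule embeds_trans[OF embeds_monomial_slice[OF d] embeds_diagonal_tensor[OF q(1) qs(3)]
          form_carrier[OF is_form_tensor[OF q(1)]]])
  from embeds_trans[OF this e mk_diagonal_carrier]
  have "embeds (mk_diagonal (map (\<lambda>q. laurent_term q d) qs))
    (mk_diagonal (products (laurent_entries zs) (map laurent_const ts) :: ('a, 'n) iter_laurent list))" .
  moreover have "length d = CARD('n)" using d pi_exponents(1) by blast
  moreover have "qs \<noteq> []" using qs(2) q(3) by auto
  ultimately obtain a e where a: "(a, e) \<in> set zs" "same_class d e"
    "embeds (mk_diagonal qs) (mk_diagonal (map ((*) a) ts))"
    using embeds_block[OF two zs ts _ _ qs(1), of d] by blast
  have "embeds q (a \<cdot>\<^sub>m mk_diagonal ts)"
    unfolding smult_mk_diagonal by (rule embeds_trans[OF qs(4) a(3) mk_diagonal_carrier])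
  with a(1,2) show ?thesis by blast
qed

text \<open>The scalar c is moved into \<pi>: up to squares, c\<pi> is again a monomial form with
  distinct classes. Its residue forms after tensoring with \<rho> are multiples of \<rho>, one of
  which contains q.\<close>

lemma neighbour_tensorD:
  fixes q \<rho> :: "'a mat"
  assumes q: "is_form q" "anisotropic q" and \<rho>: "pfister \<rho>" "anisotropic \<rho>"
    and nb: "neighbour (tensor_form (scalar_ext q) \<pi>) (tensor_form (scalar_ext \<rho>) \<pi>)"
  shows "neighbour q \<rho>"
proof -
  obtain c where c: "c \<noteq> 0" "embeds (tensor_form (scalar_ext q) \<pi>) (c \<cdot>\<^sub>m tensor_form (scalar_ext \<rho>) \<pi>)"
    "dim_row (tensor_form (scalar_ext \<rho>) \<pi>) < 2 * dim_row (tensor_form (scalar_ext q) \<pi>)"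
    by (rule neighbour_embeds[OF two' nb])
  have f: "is_form \<rho>" using \<rho>(1) by (simp add: pfister_def)
  obtain rs where rs: "0 \<notin> set rs" "embeds (mk_diagonal rs) \<rho>" "embeds \<rho> (mk_diagonal rs)"
    by (rule anisotropic_diagonalizable[OF two f \<rho>(2)])
  have ar: "anisotropic (mk_diagonal rs)"
    by (rule anisotropic_embeds[OF \<rho>(2) rs(2) is_form_mk_diagonal[OF rs(1)] form_carrier[OF f]])
  obtain zs where zs: "distinct_classes CARD('n) zs"
    "\<forall>T. 0 \<notin> set T \<longrightarrow> scale c (mset (products \<pi>s T)) \<approx> mset (products (laurent_entries zs) T)"
    by (rule laurent_monomial_representatives[OF two zero_notin_pi sorted_pi_not_similar c(1)])
  interpret field_hom "laurent_const :: 'a \<Rightarrow> ('a, 'n) iter_laurent" by (rule field_hom_laurent_const)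
  let ?T = "map laurent_const rs :: ('a, 'n) iter_laurent list"
  have "0 \<notin> set ?T" using rs(1) by auto
  from zs(2)[rule_format, OF this] have "mset (map ((*) c) (products \<pi>s ?T)) \<approx> mset (products (laurent_entries zs) ?T)"
    by simp
  from chain_equiv_embeds[OF this]
  have "embeds (c \<cdot>\<^sub>m mk_diagonal (products \<pi>s ?T)) (mk_diagonal (products (laurent_entries zs) ?T))"
    unfolding smult_mk_diagonal .
  from embeds_trans[OF embeds_smult[OF embeds_tensor_diagonal[OF f rs(3)] mk_diagonal_carrier] this mk_diagonal_carrier]
  have "embeds (c \<cdot>\<^sub>m tensor_form (scalar_ext \<rho>) \<pi>) (mk_diagonal (products (laurent_entries zs) ?T))" .
  from embeds_trans[OF c(2) this mk_diagonal_carrier]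
  have e: "embeds (tensor_form (scalar_ext q) \<pi>) (mk_diagonal (products (laurent_entries zs) ?T))" .
  have dim: "dim_row \<rho> < 2 * dim_row q" using c(3) unfolding dim_tensor by (simp add: mult.assoc[symmetric])
  then have "dim_row q > 0" by simp
  \<comment> \<open>One class is enough here: the dimension inequality for q and \<rho> follows by
    cancelling 2^n.\<close>
  moreover have "pi_exponents CARD('n) \<noteq> []" using pi_exponents(2)[of "CARD('n)"] by auto
  then have "hd (pi_exponents CARD('n)) \<in> set (pi_exponents CARD('n))" by simp
  ultimately obtain a where a: "a \<in> fst ` set zs" "embeds q (a \<cdot>\<^sub>m mk_diagonal rs)"
    using tensor_embeds_block[OF q _ zs(1) ar e] by force
  have a0: "a \<noteq> 0" using a(1) zs(1) by (auto simp: distinct_classes_def)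
  have "embeds q (a \<cdot>\<^sub>m \<rho>)"
    by (rule embeds_trans[OF a(2) embeds_smult[OF rs(2) form_carrier[OF f]]
          form_carrier[OF is_form_smult[OF f a0], unfolded index_smult_mat]]) 
  then have "subform q (a \<cdot>\<^sub>m \<rho>)"
    by (rule embeds_imp_subform[OF two is_form_smult[OF f a0]
          anisotropic_smult[OF \<rho>(2) form_carrier[OF f] a0] q(1)])
  then show ?thesis unfolding neighbour_def using q(1) \<rho>(1) a0 dim by blast
qed

text \<open>Here \<sigma> is the constant part \<open>?S\<close> of the normal form of \<theta>,
  while \<open>zs\<close> represents its monomial part multiplied by c.\<close>

lemma neighbour_tensor_descend:
  fixes q :: "'a mat"
  assumes q: "is_form q" "anisotropic q"
    and \<theta>: "pfister \<theta>" "neighbour (tensor_form (scalar_ext q) \<pi>) \<theta>"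
  shows "\<exists>\<sigma>. pfister \<sigma> \<and> neighbour (tensor_form (scalar_ext q) \<pi>) (tensor_form (scalar_ext \<sigma>) \<pi>)"
proof -
  interpret field_hom "laurent_const :: 'a \<Rightarrow> ('a, 'n) iter_laurent" by (rule field_hom_laurent_const)
  let ?A = "tensor_form (scalar_ext q) \<pi>"
  obtain c where c: "c \<noteq> 0" "embeds ?A (c \<cdot>\<^sub>m \<theta>)" "is_form \<theta>" "dim_row \<theta> < 2 * dim_row ?A"
    using neighbour_embeds[OF two' \<theta>(2)] by blast
  obtain bs where bs: "0 \<notin> set bs" "isometric \<theta> (mk_diagonal (pfister_entries bs))"
    using \<theta>(1) unfolding pfister_def pfister_prod_diagonal by blast
  have "embeds \<theta> (mk_diagonal (pfister_entries bs))"
    by (rule isometric_embeds(1)[OF two' c(3) is_form_mk_diagonal[OF zero_notin_pfister_entries[OF bs(1)]] bs(2)])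
  from embeds_smult[OF this mk_diagonal_carrier]
  have e1: "embeds (c \<cdot>\<^sub>m \<theta>) (mk_diagonal (map ((*) c) (pfister_entries bs)))"
    unfolding smult_mk_diagonal .
  have dim\<theta>: "dim_row \<theta> = length (pfister_entries bs)" using bs(2) by (simp add: isometric_def mk_diagonal_dim)
  obtain bs' as where bs': "0 \<notin> set bs'" and as: "0 \<notin> set as"
    and eq: "mset (pfister_entries bs) \<approx>
      mset (products (pfister_entries bs') (map laurent_const (pfister_entries as)))"
    and sorted: "sorted_wrt (\<lambda>x y. \<not> similar x y) (pfister_entries bs')"
    using pfister_normal_form[OF bs(1)] by blast
  obtain zs where zs: "distinct_classes CARD('n) zs"
    "\<forall>T. 0 \<notin> set T \<longrightarrow> scale c (mset (products (pfister_entries bs') T)) \<approx> mset (products (laurent_entries zs) T)"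
    by (rule laurent_monomial_representatives[OF two zero_notin_pfister_entries[OF bs'] sorted c(1)])
  let ?S = "pfister_entries as"
  let ?T = "map laurent_const ?S :: ('a, 'n) iter_laurent list"
  let ?L = "products (laurent_entries zs) ?T"
  have S0: "0 \<notin> set ?S" by (rule zero_notin_pfister_entries[OF as])
  then have "0 \<notin> set ?T" by auto
  from chain_equiv.chain_trans[OF chain_equiv_scale[OF c(1) eq] zs(2)[rule_format, OF this]]
  have L: "mset (map ((*) c) (pfister_entries bs)) \<approx> mset ?L" by simp
  have e: "embeds ?A (mk_diagonal ?L)"
    by (rule embeds_trans[OF embeds_trans[OF c(2) e1 mk_diagonal_carrier] chain_equiv_embeds[OF L] mk_diagonal_carrier])
  have dimL: "dim_row \<theta> = length zs * length ?S" using chain_equiv_size[OF L] dim\<theta> by simp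
  have zs0: "0 \<notin> set (laurent_entries zs :: ('a, 'n) iter_laurent list)"
    using zs(1) by (auto simp: distinct_classes_def laurent_entries_def laurent_term_eq_zero_iff eq_commute[of 0])
  have "\<not> isotropic_list ?S"
  proof
    assume "isotropic_list ?S"
    then obtain N where "mset ?S \<approx> N + scale (-1) N" using pfister_isotropic_hyperbolic[OF as] by blast
    from chain_equiv_map[OF field_hom_laurent_const this]
    have "mset ?T \<approx> image_mset laurent_const N + image_mset laurent_const (scale (-1) N)" by simp
    moreover have "image_mset laurent_const (scale (-1) N) = scale (-1) (image_mset laurent_const N :: ('a, 'n) iter_laurent multiset)"
      by (induction N) (auto simp: hom_uminus)
    moreover obtain ns where ns: "mset ns = (image_mset laurent_const N :: ('a, 'n) iter_laurent multiset)"
      using ex_mset by blast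
    moreover from ns have "mset (ns @ map ((*) (-1)) ns) =
        image_mset laurent_const N + scale (-1) (image_mset laurent_const N)" by simp
    ultimately have "mset ?T \<approx> mset (ns @ map ((*) (-1)) ns)" by (simp only:)
    \<comment> \<open>A tensor product with a hyperbolic form is again hyperbolic.\<close>
    from chain_equiv_products_right[OF zs0 this]
    have h: "mset ?L \<approx> mset (products (laurent_entries zs) ns @ map uminus (products (laurent_entries zs) ns))"
      by (simp only: mset_append mset_products_append_right mset_products_map_right mset_map_uminus)
    \<comment> \<open>The anisotropic \<open>?A\<close> fits into half the dimension of \<theta>,
      against the inequality in the definition of a neighbour.\<close>
    have "dim_row ?A \<le> length (products (laurent_entries zs) ns :: ('a, 'n) iter_laurent list)"
      by (rule anisotropic_dim_le_hyperbolic[OF anisotropic_tensor[OF q] form_carrier[OF is_form_tensor[OF q(1)]]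
            embeds_trans[OF e chain_equiv_embeds[OF h] mk_diagonal_carrier]])
    moreover have "dim_row \<theta> = 2 * length (products (laurent_entries zs) ns :: ('a, 'n) iter_laurent list)"
      using chain_equiv_size[OF h] dimL by simp
    ultimately show False using c(4) by simp
  qed
  then have S: "anisotropic (mk_diagonal ?S)" by (rule anisotropic_mk_diagonalI)
  have "dim_row q > 0" using c(4) unfolding dim_tensor by (cases "dim_row q") auto
  note block = tensor_embeds_block[OF q this zs(1) S e]
  let ?D = "pi_exponents CARD('n)"
  have "\<forall>d \<in> set ?D. \<exists>z. z \<in> set zs \<and> same_class d (snd z)"
  proof
    fix d assume "d \<in> set ?D"
    from block[OF this] obtain a e where "(a, e) \<in> set zs" "same_class d e" by blast
    then show "\<exists>z. z \<in> set zs \<and> same_class d (snd z)" by (intro exI[of _ "(a, e)"]) simp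
  qed
  from bchoice[OF this] obtain f where f': "\<forall>d \<in> set ?D. f d \<in> set zs \<and> same_class d (snd (f d))" ..
  note f = f'[rule_format]
  \<comment> \<open>Exponents of \<pi> sent to the same block share its class, whereas different
    positions in \<open>?D\<close> have different classes. Hence there are at least 2^n
    blocks.\<close>
  have "inj_on f (set ?D)"
  proof (rule inj_onI)
    fix d d' assume d: "d \<in> set ?D" "d' \<in> set ?D" "f d = f d'"
    have "same_class d (snd (f d))" "same_class d' (snd (f d))" using f[OF d(1)] f[OF d(2)] d(3) by simp_all
    then have s: "same_class d d'" "same_class d' d" by (blast intro: same_class_trans same_class_sym)+
    obtain i j where ij: "i < length ?D" "?D ! i = d" "j < length ?D" "?D ! j = d'"
      using d(1,2) by (auto simp: in_set_conv_nth)
    have "\<not> i < j" "\<not> j < i"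
      using sorted_wrt_nth_less[OF pi_exponents(3)[of "CARD('n)"]] ij s by blast+
    then show "d = d'" using ij by (simp add: not_less)
  qed
  then have "card (set ?D) \<le> card (set zs)" using f by (intro card_inj_on_le[of f]) auto
  moreover have "distinct ?D"
  proof -
    have "distinct xs" if "sorted_wrt (\<lambda>d e. \<not> same_class d e) xs" for xs
      using that by (induction xs) (auto simp: same_class_refl)
    then show ?thesis using pi_exponents(3) by blast
  qed
  ultimately have "2 ^ CARD('n) \<le> length zs"
    using distinct_card[of ?D] card_length[of zs] pi_exponents(2)[of "CARD('n)"] by simp
  then have "length ?S * 2 ^ CARD('n) \<le> dim_row \<theta>" unfolding dimL by (simp add: mult.commute)
  also have "\<dots> < 2 * (dim_row q * 2 ^ CARD('n))" using c(4) unfolding dim_tensor .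
  finally have "length ?S * 2 ^ CARD('n) < (2 * dim_row q) * 2 ^ CARD('n)" by (simp only: mult.assoc)
  then have "length ?S < 2 * dim_row q" by (simp only: mult_less_cancel2)
  then have dim: "dim_row (mk_diagonal ?S) < 2 * dim_row q" by (simp add: mk_diagonal_dim)
  have "?D \<noteq> []" using pi_exponents(2)[of "CARD('n)"] by auto
  then obtain a where a: "a \<in> fst ` set zs" "embeds q (a \<cdot>\<^sub>m mk_diagonal ?S)"
    using block[of "hd ?D"] by force
  have a0: "a \<noteq> 0" using a(1) zs(1) by (auto simp: distinct_classes_def)
  have fS: "is_form (mk_diagonal ?S)" by (rule is_form_mk_diagonal[OF S0])
  have "isometric (mk_diagonal ?S) (mk_diagonal ?S)"
    by (rule embeds_isometric[OF fS fS embeds_refl[OF mk_diagonal_carrier] refl])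
  then have p: "pfister (mk_diagonal ?S)"
    unfolding pfister_def pfister_prod_diagonal using fS as by blast
  show ?thesis using neighbour_tensor[OF q(1) p S a0 a(2) dim] p by blast
qed

end

theorem proposition3p4:
  fixes q \<rho> :: "'a::field mat"
    and \<pi> :: "('a, 'n::finite) iter_laurent mat"
  assumes "CHAR('a) \<noteq> 2"
    and "is_form q" and "anisotropic q"
    and "pfister \<rho>" and "anisotropic \<rho>"
    and "is_form \<pi>" and "isometric \<pi> (pfister_prod (map laurent_var [1..<CARD('n) + 1]))"
  shows "((\<exists>\<theta>. pfister \<theta> \<and> neighbour (tensor_form (scalar_ext q) \<pi>) \<theta>) \<longleftrightarrow>
          (\<exists>\<sigma>. pfister \<sigma> \<and>
             neighbour (tensor_form (scalar_ext q) \<pi>) (tensor_form (scalar_ext \<sigma>) \<pi>)))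
       \<and> (neighbour (tensor_form (scalar_ext q) \<pi>) (tensor_form (scalar_ext \<rho>) \<pi>) \<longleftrightarrow>
          neighbour q \<rho>)"
proof -
  have two: "(2::'a) \<noteq> 0"
  proof
    assume "(2::'a) = 0"
    then have "of_nat 2 = (0::'a)" by simp
    then have "CHAR('a) dvd 2" by (simp only: of_nat_eq_0_iff_char_dvd)
    \<comment> \<open>Characteristic 1 is impossible in a field, as 1 is not 0.\<close>
    then have "CHAR('a) = 1 \<or> CHAR('a) = 2" using two_is_prime_nat by (auto simp: prime_nat_iff)
    then show False using assms(1) by simp
  qed
  note \<pi> = two assms(6,7)
  have "neighbour (tensor_form (scalar_ext q) \<pi>) (tensor_form (scalar_ext \<rho>) \<pi>)" if nb: "neighbour q \<rho>"
  proof -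
    obtain a where "a \<noteq> 0" "embeds q (a \<cdot>\<^sub>m \<rho>)" "dim_row \<rho> < 2 * dim_row q"
      by (rule neighbour_embeds[OF \<pi> two nb])
    then show ?thesis by (rule neighbour_tensor[OF \<pi> assms(2,4,5)])
  qed
  moreover have "neighbour q \<rho>"
    if "neighbour (tensor_form (scalar_ext q) \<pi>) (tensor_form (scalar_ext \<rho>) \<pi>)"
    by (rule neighbour_tensorD[OF \<pi> assms(2,3,4,5) that])
  moreover have "\<exists>\<sigma>. pfister \<sigma> \<and> neighbour (tensor_form (scalar_ext q) \<pi>) (tensor_form (scalar_ext \<sigma>) \<pi>)"
    if "pfister \<theta>" "neighbour (tensor_form (scalar_ext q) \<pi>) \<theta>" for \<theta>
    by (rule neighbour_tensor_descend[OF \<pi> assms(2,3) that])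
  \<comment> \<open>For the converse of (i), \<open>\<sigma> \<otimes> \<pi>\<close> itself is the
    witness; that it is Pfister is part of \<open>neighbour\<close>.\<close>
  moreover have "pfister \<theta>" if "neighbour p \<theta>" for p \<theta> :: "('a, 'n) iter_laurent mat"
    using that by (simp add: neighbour_def)
  ultimately show ?thesis by blast
qed

end
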